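(* Let $n\ge 1$ and let $\boldsymbol x=\{x_1,\dots,x_{2n}\}$ be distinct real points. Assume $\boldsymbol\zeta=\{\zeta_1,\dots,\zeta_{n+1}\}\subset\widehat{\mathbb C}$ (distinct points, none of them in $\boldsymbol x$) is closed under complex conjugation and solves the stationary relation $$\sum_{j=1}^{2n}\frac{1}{\zeta_k-x_j}=\sum_{l\neq k}\frac{2}{\zeta_k-\zeta_l},\qquad k=1,\dots,n+1.$$ Then there exists $R\in \mathrm{CRR}_{n+1}(\boldsymbol x)$ with pole set $\boldsymbol\zeta$. Furthermore, for $$\boldsymbol\rho_j=\sum_{k\ne j}2\delta_{x_k}-\sum_{k=1}^{n+1}4\delta_{\zeta_k},\qquad j=1,\dots,2n,$$ the hulls $K_t$ generated by any $\boldsymbol\nu$-superposition of the $\mathrm{SLE}(0,x_j,\boldsymbol\rho_j)$ Loewner flows, $j=1,\dots,2n$, satisfy $K_t\subset\Gamma(R)$, for any time $t$ before the collision of any poles or critical points (i.e. of any two of the points $x_1(t),\dots,x_{2n}(t),g_t(\zeta_1),\dots,g_t(\zeta_{n+1})$). For any such $t$, $$R\circ g_t^{-1}\in \mathrm{CRR}_{n+1}(\boldsymbol x(t)),$$ where $\boldsymbol x(t)=\{x_1(t),\dots,x_{2n}(t)\}$ are the locations of the critical points at time $t$ under the $\boldsymbol\nu$-superposition.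
   Context: $\mathbb H$ is the upper half-plane, $\widehat{\mathbb C}$ the Riemann sphere, $\widehat{\mathbb R}=\mathbb R\cup\{\infty\}$. For distinct real $\boldsymbol x=\{x_1,\dots,x_{2n}\}$, $\mathrm{CRR}_{n+1}(\boldsymbol x)$ is the set of rational functions with real coefficients, of degree $n+1$, whose critical points are precisely $\boldsymbol x$. The real locus of $R$ is $\Gamma(R)=\{z\in\widehat{\mathbb C}:R(z)\in\widehat{\mathbb R}\}$. Convention at infinity: one of the $\zeta_k$ may be $\infty$; every fraction $c/(a-b)$ in which $a$ or $b$ equals $\infty$ is $0$, and $g_t(\infty)=\infty$. $\mathrm{SLE}(0,x,\boldsymbol\rho)$: for $x\in\mathbb R$ and a finite atomic (signed) measure $\boldsymbol\rho$ on $\widehat{\mathbb C}$ symmetric under conjugation, it is the Loewner chain $\partial_tg_t(z)=\frac{2}{g_t(z)-x_t}$, $g_0(z)=z$, with driving function $\dot x_t=\int_{\mathbb C}\frac{d\boldsymbol\rho(w)}{x_t-g_t(w)}$, $x_0=x$. $\boldsymbol\nu$-superposition: given measurable $\nu_1,\dots,\nu_{2n}:[0,\infty)\to[0,\infty)$, the $\boldsymbol\nu$-superposition of the $2n$ Loewner flows $\mathrm{SLE}(0,x_j,\boldsymbol\rho_j)$, $j=1,\dots,2n$, with $\boldsymbol\rho_j=\sum_{k\ne j}2\delta_{x_k}-\sum_{k=1}^{n+1}4\delta_{\zeta_k}$, is the Loewner chain $$\partial_tg_t(z)=\sum_{j=1}^{2n}\frac{2\nu_j(t)}{g_t(z)-x_j(t)},\qquad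 g_0(z)=z,$$ where, with $\zeta_k(t)=g_t(\zeta_k)$, the driving functions solve $$\dot x_j=\nu_j\Big(\sum_{k\ne j}\frac{2}{x_j-x_k}-\sum_{k=1}^{n+1}\frac{4}{x_j-\zeta_k(t)}\Big)+\sum_{k\ne j}\frac{2\nu_k}{x_j-x_k},\qquad x_j(0)=x_j .$$ (This is the superposition of the individual flows, where the atoms of $\boldsymbol\rho_j$ at $x_k$ are transported to $x_k(t)$ and those at $\zeta_k$ to $g_t(\zeta_k)$.) For $z\in\overline{\mathbb H}$, $\tau_z$ is the first time at which $g_t(z)=x_j(t)$ for some $j$, and the hull is $K_t=\{z\in\overline{\mathbb H}:\tau_z\le t\}$; $g_t$ is the conformal map of $\mathbb H\setminus K_t$ onto $\mathbb H$ with $g_t(z)=z+o(1)$ at $\infty$. The statement $R\circ g_t^{-1}\in\mathrm{CRR}_{n+1}(\boldsymbol x(t))$ means that the function $R\circ g_t^{-1}$ on $\mathbb H$ is the restriction of an element of $\mathrm{CRR}_{n+1}(\boldsymbol x(t))$. *)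

theory Defs
  imports "HOL-Analysis.Analysis" "HOL-Computational_Algebra.Computational_Algebra"
begin

text \<open>The Riemann sphere: \<open>None\<close> is the point at infinity.\<close>

type_synonym csphere = "complex option"

abbreviation sreal :: "real \<Rightarrow> csphere" where
  "sreal a \<equiv> Some (complex_of_real a)"

definition real_sphere :: "csphere set" where
  "real_sphere = insert None (range sreal)"

definition upper_half :: "complex set" where
  "upper_half = {z. 0 < Im z}"

text \<open>The fraction \<open>c / (a - b)\<close>, which is \<open>0\<close> by convention if \<open>a\<close> or \<open>b\<close> is infinite.\<close>

definition sfrac :: "complex \<Rightarrow> csphere \<Rightarrow> csphere \<Rightarrow> complex" where
  "sfrac c a b = (case (a, b) of (Some u, Some v) \<Rightarrow> c / (u - v) | _ \<Rightarrow> 0)"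

definition sinverse :: "csphere \<Rightarrow> csphere" where
  "sinverse z = (case z of None \<Rightarrow> Some 0 | Some w \<Rightarrow> if w = 0 then None else Some (1 / w))"

text \<open>The self-map of the sphere given by \<open>p / q\<close>; it is used only for coprime \<open>p\<close> and \<open>q\<close>.\<close>

definition rat_fun :: "real poly \<Rightarrow> real poly \<Rightarrow> csphere \<Rightarrow> csphere" where
  "rat_fun p q z = (case z of
      Some w \<Rightarrow>
        (let P = poly (map_poly complex_of_real p) w; Q = poly (map_poly complex_of_real q) w
         in if Q = 0 then None else Some (P / Q))
    | None \<Rightarrow>
        (if degree q < degree p then None else sreal (coeff p (degree q) / lead_coeff q)))"

text \<open>
  \<open>R\<close> in local coordinates around \<open>z\<close> and \<open>R z\<close>, where the coordinate at infinity is the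
  reciprocal. A critical point, possibly infinite or a multiple pole, is a point at which the
  derivative in these coordinates vanishes. Only the values of \<open>local_form R z\<close> near the
  coordinate of \<open>z\<close> matter; there the argument of \<open>the\<close> is finite if \<open>R\<close> is continuous.
\<close>

definition local_form :: "(csphere \<Rightarrow> csphere) \<Rightarrow> csphere \<Rightarrow> complex \<Rightarrow> complex" where
  "local_form R z w =
     the ((if R z = None then sinverse else id)
            (R ((if z = None then sinverse else id) (Some w))))"

definition critical_points :: "(csphere \<Rightarrow> csphere) \<Rightarrow> csphere set" where
  "critical_points R =
     {z. (local_form R z has_field_derivative 0) (at (case z of None \<Rightarrow> 0 | Some a \<Rightarrow> a))}"

definition poles :: "(csphere \<Rightarrow> csphere) \<Rightarrow> csphere set" where
  "poles R = {z. R z = None}"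

definition real_locus :: "(csphere \<Rightarrow> csphere) \<Rightarrow> csphere set" where
  "real_locus R = {z. R z \<in> real_sphere}"

definition CRR :: "nat \<Rightarrow> real set \<Rightarrow> (csphere \<Rightarrow> csphere) set" where
  "CRR d X = {R.
     (\<exists>p q. coprime p q \<and> q \<noteq> 0 \<and> max (degree p) (degree q) = d \<and> R = rat_fun p q) \<and>
     critical_points R = sreal ` X}"

text \<open>
  Loewner flows driven by \<open>m\<close> points, indexed by \<open>{1..m}\<close>, on a time interval \<open>[0, T)\<close>.
  The rates \<open>\<nu> j\<close> are merely measurable, so differential equations are understood in the
  sense of Caratheodory, i.e. as integral equations with Lebesgue integrable right-hand side.
  A flow \<open>g\<close> is a function of time and initial point, and \<open>g t z\<close> is unspecified after the
  swallowing time of \<open>z\<close>.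
\<close>

definition swallowing_time ::
  "nat \<Rightarrow> ereal \<Rightarrow> (nat \<Rightarrow> real \<Rightarrow> real) \<Rightarrow> (real \<Rightarrow> complex \<Rightarrow> complex) \<Rightarrow> complex \<Rightarrow> ereal" where
  "swallowing_time m T x g z =
     Inf (ereal ` {s. 0 \<le> s \<and> ereal s < T \<and> (\<exists>j\<in>{1..m}. g s z = complex_of_real (x j s))})"

definition loewner_hull ::
  "nat \<Rightarrow> ereal \<Rightarrow> (nat \<Rightarrow> real \<Rightarrow> real) \<Rightarrow> (real \<Rightarrow> complex \<Rightarrow> complex) \<Rightarrow> real \<Rightarrow> complex set" where
  "loewner_hull m T x g t = {z. 0 \<le> Im z \<and> swallowing_time m T x g z \<le> ereal t}"

text \<open>
  The last clause says that the infimum in \<open>swallowing_time\<close> is attained, and that the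
  trajectory of \<open>z\<close> runs continuously into the driving point that swallows it. (For \<open>s = 0\<close>,
  i.e. for \<open>z\<close> among the starting points, the filter is trivial.) Without it the values of
  \<open>g\<close> after an exit time would be arbitrary and could produce spurious hits.
\<close>

definition loewner_chain ::
  "nat \<Rightarrow> (nat \<Rightarrow> real \<Rightarrow> real) \<Rightarrow> ereal \<Rightarrow> (nat \<Rightarrow> real \<Rightarrow> real) \<Rightarrow>
   (real \<Rightarrow> complex \<Rightarrow> complex) \<Rightarrow> bool" where
  "loewner_chain m \<nu> T x g \<longleftrightarrow>
     (\<forall>z. g 0 z = z) \<and>
     (\<forall>z t. 0 \<le> t \<and> ereal t < T \<and> ereal t < swallowing_time m T x g z \<longrightarrow>
        (let f = (\<lambda>s. \<Sum>j=1..m. complex_of_real (2 * \<nu> j s) / (g s z - complex_of_real (x j s)))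
         in f absolutely_integrable_on {0..t} \<and> g t z = z + integral {0..t} f)) \<and>
     (\<forall>z. swallowing_time m T x g z < T \<longrightarrow>
        (\<exists>s j. swallowing_time m T x g z = ereal s \<and> j \<in> {1..m} \<and>
           g s z = complex_of_real (x j s) \<and>
           ((\<lambda>u. g u z) \<longlongrightarrow> g s z) (at s within {0..<s})))"

text \<open>
  A finite atomic signed measure \<open>\<rho>\<close> on the sphere is given by the masses of its atoms.
  \<open>sle0_drift \<rho> h a\<close> is the integral of \<open>1 / (a - h w)\<close> against \<open>\<rho>\<close>, the drift of
  SLE(0,x,\<open>\<rho>\<close>) at position \<open>a\<close> when the atoms have been transported by \<open>h\<close>.
\<close>

definition sle0_drift :: "(csphere \<Rightarrow> real) \<Rightarrow> (csphere \<Rightarrow> csphere) \<Rightarrow> real \<Rightarrow> complex" where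
  "sle0_drift \<rho> h a = (\<Sum>w | \<rho> w \<noteq> 0. sfrac (complex_of_real (\<rho> w)) (sreal a) (h w))"

text \<open>
  Atoms at a starting point \<open>x k 0\<close> follow the driving function \<open>x k\<close>, all other atoms follow
  the flow, which fixes infinity.
\<close>

definition transport ::
  "nat \<Rightarrow> (nat \<Rightarrow> real \<Rightarrow> real) \<Rightarrow> (real \<Rightarrow> complex \<Rightarrow> complex) \<Rightarrow> real \<Rightarrow> csphere \<Rightarrow> csphere" where
  "transport m x g t w =
     (if \<exists>k\<in>{1..m}. w = sreal (x k 0)
      then sreal (x (THE k. k \<in> {1..m} \<and> w = sreal (x k 0)) t)
      else map_option (g t) w)"

text \<open>
  The superposition, at rates \<open>\<nu> j\<close>, of the \<open>m\<close> Loewner flows SLE(0,\<open>x\<^sub>j\<close>,\<open>\<rho>\<^sub>j\<close>) started from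
  \<open>x0\<close>: under the flow of index \<open>j\<close> the point \<open>x\<^sub>j\<close> moves with its SLE drift and every other
  \<open>x\<^sub>k\<close> moves with the Loewner vector field.
\<close>

definition superposition ::
  "nat \<Rightarrow> (nat \<Rightarrow> real \<Rightarrow> real) \<Rightarrow> (nat \<Rightarrow> real) \<Rightarrow> (nat \<Rightarrow> csphere \<Rightarrow> real) \<Rightarrow> ereal \<Rightarrow>
   (nat \<Rightarrow> real \<Rightarrow> real) \<Rightarrow> (real \<Rightarrow> complex \<Rightarrow> complex) \<Rightarrow> bool" where
  "superposition m \<nu> x0 \<rho> T x g \<longleftrightarrow>
     loewner_chain m \<nu> T x g \<and>
     (\<forall>j\<in>{1..m}. x j 0 = x0 j) \<and>
     (\<forall>j\<in>{1..m}. \<forall>t. 0 \<le> t \<and> ereal t < T \<longrightarrow>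
        (let f = (\<lambda>s. complex_of_real (\<nu> j s) * sle0_drift (\<rho> j) (transport m x g s) (x j s) +
                      (\<Sum>k\<in>{1..m} - {j}. complex_of_real (2 * \<nu> k s / (x j s - x k s))))
         in f absolutely_integrable_on {0..t} \<and>
            complex_of_real (x j t) = complex_of_real (x0 j) + integral {0..t} f))"

definition delta :: "csphere \<Rightarrow> csphere \<Rightarrow> real" where
  "delta a w = (if w = a then 1 else 0)"

definition rho :: "nat \<Rightarrow> (nat \<Rightarrow> real) \<Rightarrow> (nat \<Rightarrow> csphere) \<Rightarrow> nat \<Rightarrow> csphere \<Rightarrow> real" where
  "rho n x0 \<zeta> j w =
     (\<Sum>k\<in>{1..2*n} - {j}. 2 * delta (sreal (x0 k)) w) - (\<Sum>k=1..n+1. 4 * delta (\<zeta> k) w)"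

text \<open>The driving points and the images of the \<open>\<zeta> k\<close> at time \<open>s\<close> are pairwise distinct.\<close>

definition no_collision ::
  "nat \<Rightarrow> (nat \<Rightarrow> csphere) \<Rightarrow> (nat \<Rightarrow> real \<Rightarrow> real) \<Rightarrow> (real \<Rightarrow> complex \<Rightarrow> complex) \<Rightarrow> real \<Rightarrow> bool" where
  "no_collision n \<zeta> x g s \<longleftrightarrow>
     inj_on (\<lambda>j. x j s) {1..2*n} \<and>
     inj_on (\<lambda>k. map_option (g s) (\<zeta> k)) {1..n+1} \<and>
     (\<forall>j\<in>{1..2*n}. \<forall>k\<in>{1..n+1}. sreal (x j s) \<noteq> map_option (g s) (\<zeta> k))"

end

theory Submission
  imports Defs
begin

text \<open>
  Let \<open>P\<close> and \<open>Q\<close> be the monic polynomials with roots the \<open>x\<^sub>j\<close> and the finite \<open>\<zeta>\<^sub>k\<close>. The stationary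
  relation says that \<open>P / Q\<^sup>2\<close> has no residues, so it is the derivative of a rational function
  \<open>R w = e w - \<Sum> A\<^sub>k / (w - \<zeta>\<^sub>k)\<close>, where \<open>A\<^sub>k = P(\<zeta>\<^sub>k) / Q'(\<zeta>\<^sub>k)\<^sup>2\<close> and \<open>e\<close> is \<open>1\<close> or \<open>0\<close> according to
  whether \<open>\<infinity>\<close> is a pole.

  Along the flow the defects \<open>M\<^sub>k\<close> of the stationary relation satisfy
  \<open>M\<^sub>k' = (\<Sum>\<^sub>i 2 \<nu>\<^sub>i / (\<zeta>\<^sub>k - x\<^sub>i)\<^sup>2) M\<^sub>k\<close>, hence stay zero, and \<open>A\<^sub>k' = - (\<Sum>\<^sub>i 2 \<nu>\<^sub>i / (\<zeta>\<^sub>k - x\<^sub>i)\<^sup>2) A\<^sub>k\<close>. This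
  gives \<open>d/dt R\<^sub>t(g\<^sub>t z) = \<Sum>\<^sub>i 2 \<nu>\<^sub>i R\<^sub>t'(x\<^sub>i) / (g\<^sub>t z - x\<^sub>i) = 0\<close>, because the \<open>x\<^sub>i\<close> are critical points of
  \<open>R\<^sub>t\<close>. A swallowed point runs into some \<open>x\<^sub>i\<close>, so \<open>R z\<close> is real. In the same way, a point with
  nonreal \<open>R z\<close> never reaches the real line; its trajectory shows that the \<open>\<nu>\<^sub>i\<close> are integrable, which
  is not assumed. Finally, \<open>g\<^sub>t\<close> maps the \<open>n + 1\<close> solutions of \<open>R = c\<close> injectively to those of \<open>R\<^sub>t = c\<close>
  if \<open>c\<close> is nonreal, and surjectivity of \<open>g\<^sub>t\<close> onto the half-plane follows by approximation.
\<close>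

section \<open>Caratheodory solutions of differential equations\<close>

text \<open>At its double pole \<open>\<zeta>\<^sub>k\<close>, \<open>P / Q^2\<close> has residue
  \<open>A\<^sub>k\<close> times the difference of the two sides of the stationary relation, which
  is why that relation is the exact condition for a rational antiderivative. The shape of the proof
  comes from a circularity. The conservation laws are linear equations whose coefficients contain
  the rates, so they presuppose integrable rates; integrability is read off from a trajectory above
  the real line; and only a conservation law shows that some trajectory stays there. The way out is
  to stop at the first contact with the real line. On every shorter interval the imaginary part is
  bounded below, so the rates are integrable and the laws hold; they pass to the contact time by
  continuity, and there they contradict the nonreal value of \<open>R\<close>. As the rates are
  merely measurable, derivatives exist only as integrands. Hence a calculus of pairs of a primitive
  and its integrand, with its own chain and product rules.\<close>

definition primitive_on :: "real \<Rightarrow> (real \<Rightarrow> complex) \<Rightarrow> (real \<Rightarrow> complex) \<Rightarrow> bool" where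
  "primitive_on t u f \<longleftrightarrow>
     f absolutely_integrable_on {0..t} \<and> (\<forall>s\<in>{0..t}. u s = u 0 + integral {0..s} f)"

lemma abs_int_subinterval:
  fixes f :: "real \<Rightarrow> 'a::euclidean_space"
  shows "f absolutely_integrable_on {0..t} \<Longrightarrow> 0 \<le> a \<Longrightarrow> b \<le> t \<Longrightarrow> f absolutely_integrable_on {a..b}"
  by (rule absolutely_integrable_on_subinterval) auto

lemma primitive_onD:
  assumes "primitive_on t u f"
  shows "f absolutely_integrable_on {0..t}" "s \<in> {0..t} \<Longrightarrow> u s = u 0 + integral {0..s} f"
  using assms unfolding primitive_on_def by blast+

lemma primitive_onI:
  assumes "f absolutely_integrable_on {0..t}"
    "\<And>s. s \<in> {0..t} \<Longrightarrow> u s = u 0 + integral {0..s} f"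
  shows "primitive_on t u f"
  using assms unfolding primitive_on_def by blast

lemma primitive_on_mono: "primitive_on t u f \<Longrightarrow> s \<le> t \<Longrightarrow> primitive_on s u f"
  by (intro primitive_onI) (auto intro: primitive_onD(2) intro: abs_int_subinterval primitive_onD(1))

lemma primitive_on_diff_eq:
  assumes "primitive_on t u f" "0 \<le> a" "a \<le> b" "b \<le> t"
  shows "u b - u a = integral {a..b} f"
proof -
  have "f integrable_on {0..b}"
    using assms(2-) primitive_onD(1)[OF assms(1)] abs_int_subinterval[of t f 0 b]
    by (auto simp: absolutely_integrable_on_def)
  then have "integral {0..a} f + integral {a..b} f = integral {0..b} f"
    using assms by (intro Henstock_Kurzweil_Integration.integral_combine) auto
  moreover have "u b = u 0 + integral {0..b} f" "u a = u 0 + integral {0..a} f"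
    using assms by (auto intro!: primitive_onD(2)[OF assms(1)])
  ultimately show ?thesis by (metis add_diff_cancel_left add_diff_cancel_left')
qed

lemma primitive_on_continuous:
  assumes "primitive_on t u f" shows "continuous_on {0..t} u"
proof -
  have "f integrable_on {0..t}"
    using primitive_onD(1)[OF assms] by (auto simp: absolutely_integrable_on_def)
  then have "continuous_on {0..t} (\<lambda>s. u 0 + integral {0..s} f)"
    by (intro continuous_intros indefinite_integral_continuous_1)
  then show ?thesis
    by (rule continuous_on_eq) (rule primitive_onD(2)[OF assms, symmetric])
qed

lemma primitive_on_cong:
  assumes "primitive_on t u f" "\<And>s. s \<in> {0..t} \<Longrightarrow> u s = v s" "\<And>s. s \<in> {0..t} \<Longrightarrow> f s = h s"
  shows "primitive_on t v h"
proof (rule primitive_onI)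
  show "h absolutely_integrable_on {0..t}"
    using primitive_onD(1)[OF assms(1)] by (rule absolutely_integrable_spike[where S = "{}"]) (auto simp: assms(3))
  show "v s = v 0 + integral {0..s} h" if "s \<in> {0..t}" for s
  proof -
    have "integral {0..s} h = integral {0..s} f"
      using that assms(3) by (intro integral_cong) auto
    moreover have "u s = v s" "u 0 = v 0" using assms(2) that by auto
    ultimately show ?thesis using primitive_onD(2)[OF assms(1) that] by metis
  qed
qed

lemma primitive_on_bounded_linear:
  assumes "primitive_on t u f" "bounded_linear h"
  shows "primitive_on t (\<lambda>s. h (u s)) (\<lambda>s. h (f s))"
proof (rule primitive_onI)
  show "(\<lambda>s. h (f s)) absolutely_integrable_on {0..t}"
    using absolutely_integrable_linear[OF primitive_onD(1)[OF assms(1)] assms(2)]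
    unfolding o_def .
  show "h (u s) = h (u 0) + integral {0..s} (\<lambda>s. h (f s))" if "s \<in> {0..t}" for s
  proof -
    have "integral {0..s} (\<lambda>s. h (f s)) = h (integral {0..s} f)"
      using integral_linear[of f "{0..s}" h] primitive_onD(1)[OF assms(1)] assms(2) that
        abs_int_subinterval[of t f 0 s]
      unfolding o_def by (auto simp: absolutely_integrable_on_def)
    then show ?thesis
      using primitive_onD(2)[OF assms(1) that] linear_add[OF bounded_linear.linear[OF assms(2)]]
      by metis
  qed
qed

lemma primitive_on_add:
  assumes "primitive_on t u f" "primitive_on t v h"
  shows "primitive_on t (\<lambda>s. u s + v s) (\<lambda>s. f s + h s)"
proof (rule primitive_onI)
  show "(\<lambda>s. f s + h s) absolutely_integrable_on {0..t}"
    using primitive_onD(1)[OF assms(1)] primitive_onD(1)[OF assms(2)] by (rule set_integral_add)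
  show "u s + v s = u 0 + v 0 + integral {0..s} (\<lambda>s. f s + h s)" if "s \<in> {0..t}" for s
  proof -
    have "integral {0..s} (\<lambda>s. f s + h s) = integral {0..s} f + integral {0..s} h"
      using primitive_onD(1)[OF assms(1)] primitive_onD(1)[OF assms(2)] that
        abs_int_subinterval[of t f 0 s] abs_int_subinterval[of t h 0 s]
      by (auto simp: absolutely_integrable_on_def intro!: Henstock_Kurzweil_Integration.integral_add)
    then show ?thesis
      by (subst primitive_onD(2)[OF assms(1) that], subst primitive_onD(2)[OF assms(2) that]) simp
  qed
qed

lemma primitive_on_cmult:
  "primitive_on t u f \<Longrightarrow> primitive_on t (\<lambda>s. c * u s) (\<lambda>s. c * f s)"
  by (rule primitive_on_bounded_linear) (auto intro: bounded_linear_mult_right)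

lemma primitive_on_diff:
  assumes "primitive_on t u f" "primitive_on t v h"
  shows "primitive_on t (\<lambda>s. u s - v s) (\<lambda>s. f s - h s)"
  using primitive_on_add[OF assms(1) primitive_on_cmult[OF assms(2), of "-1"]] by simp

lemma primitive_on_const: "primitive_on t (\<lambda>_. c) (\<lambda>_. 0)"
  unfolding primitive_on_def by auto

lemma primitive_on_sum:
  assumes "\<And>i. i \<in> I \<Longrightarrow> primitive_on t (u i) (f i)"
  shows "primitive_on t (\<lambda>s. \<Sum>i\<in>I. u i s) (\<lambda>s. \<Sum>i\<in>I. f i s)"
  using assms
  by (induction I rule: infinite_finite_induct) (auto intro: primitive_on_const primitive_on_add)

lemma abs_int_continuous_mult:
  fixes f h :: "real \<Rightarrow> complex"
  assumes "f absolutely_integrable_on {a..b}" "continuous_on {a..b} h"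
  shows "(\<lambda>s. h s * f s) absolutely_integrable_on {a..b}"
proof (rule absolutely_integrable_bounded_measurable_product[OF bilinear_times _ _ _ assms(1)])
  show "h \<in> borel_measurable (lebesgue_on {a..b})"
    using assms(2) by (intro continuous_imp_measurable_on_sets_lebesgue) auto
  show "bounded (h ` {a..b})"
    using assms(2) by (intro compact_imp_bounded compact_continuous_image) auto
qed auto

text \<open>The \<open>f\<close> below is only integrable, so the chain rule cannot be read off pointwise. The defect
  of the claimed identity is additive in the interval and, on short intervals, at most
  \<open>\<epsilon> \<integral>|f|\<close>.\<close>

lemma primitive_on_chain:
  assumes u: "primitive_on t u f" and S: "open S" "u ` {0..t} \<subseteq> S"
    and der: "\<And>z. z \<in> S \<Longrightarrow> (\<Phi> has_field_derivative \<Phi>' z) (at z)"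
    and cont: "continuous_on S \<Phi>'"
  shows "primitive_on t (\<lambda>s. \<Phi> (u s)) (\<lambda>s. \<Phi>' (u s) * f s)"
proof -
  have cu: "continuous_on {0..t} u" using u by (rule primitive_on_continuous)
  have c': "continuous_on {0..t} (\<lambda>s. \<Phi>' (u s))"
    using continuous_on_compose2[OF cont cu] S(2) by auto
  have fi: "f absolutely_integrable_on {0..t}" using u by (auto simp: primitive_on_def)
  let ?F = "\<lambda>s. \<Phi>' (u s) * f s"
  have Fi: "?F absolutely_integrable_on {0..t}" using abs_int_continuous_mult[OF fi c'] .
  have "\<Phi> (u s) = \<Phi> (u 0) + integral {0..s} ?F" if s: "s \<in> {0..t}" for s
  proof -
    define P where "P e a b \<longleftrightarrow> (0 \<le> a \<and> a \<le> b \<and> b \<le> s \<longrightarrow>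
      norm (\<Phi> (u b) - \<Phi> (u a) - integral {a..b} ?F) \<le> e * integral {a..b} (\<lambda>s. norm (f s)))"
      for e a b
    have sub: "f absolutely_integrable_on {a..b}" "?F absolutely_integrable_on {a..b}"
      if "0 \<le> a" "b \<le> s" for a b
      using that s by (auto intro!: abs_int_subinterval[OF fi] abs_int_subinterval[OF Fi])
    have subi: "f integrable_on {a..b}" "?F integrable_on {a..b}" "(\<lambda>s. norm (f s)) integrable_on {a..b}"
      if "0 \<le> a" "b \<le> s" for a b
      using sub[OF that] by (auto simp: absolutely_integrable_on_def)
    \<comment> \<open>\<open>P e\<close> is inherited by unions of adjacent intervals, so by the
      bisection principle \<open>Bolzano\<close> it suffices to have it on all short intervals
      around each point \<open>r\<close>.\<close>
    have "P e 0 s" if e: "e > 0" for e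
    proof (rule Bolzano[of 0 s "P e"])
      show "0 \<le> s" using s by auto
      show "P e a c" if ab: "P e a b" "P e b c" and "a \<le> b" "b \<le> c" for a b c
      proof -
        {
          assume *: "0 \<le> a" "a \<le> c" "c \<le> s"
          have 1: "integral {a..b} ?F + integral {b..c} ?F = integral {a..c} ?F"
            using * that subi by (intro Henstock_Kurzweil_Integration.integral_combine) auto
          have 2: "integral {a..b} (\<lambda>s. norm (f s)) + integral {b..c} (\<lambda>s. norm (f s)) = integral {a..c} (\<lambda>s. norm (f s))"
            using * that subi by (intro Henstock_Kurzweil_Integration.integral_combine) auto
          have "norm (\<Phi> (u b) - \<Phi> (u a) - integral {a..b} ?F) \<le> e * integral {a..b} (\<lambda>s. norm (f s))"
            using ab(1) * that unfolding P_def by auto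
          moreover have "norm (\<Phi> (u c) - \<Phi> (u b) - integral {b..c} ?F) \<le> e * integral {b..c} (\<lambda>s. norm (f s))"
            using ab(2) * that unfolding P_def by auto
          moreover have "norm (\<Phi> (u c) - \<Phi> (u a) - integral {a..c} ?F) \<le>
             norm (\<Phi> (u b) - \<Phi> (u a) - integral {a..b} ?F) + norm (\<Phi> (u c) - \<Phi> (u b) - integral {b..c} ?F)"
            unfolding 1[symmetric] by (rule order_trans[OF _ norm_triangle_ineq]) (simp add: algebra_simps)
          ultimately have "norm (\<Phi> (u c) - \<Phi> (u a) - integral {a..c} ?F) \<le> e * integral {a..c} (\<lambda>s. norm (f s))"
            unfolding 2[symmetric] by (simp add: distrib_left)
        }
        then show ?thesis unfolding P_def by auto
      qed
      show "\<exists>d>0. \<forall>a b. a \<le> r \<and> r \<le> b \<and> b - a < d \<longrightarrow> P e a b" if r: "0 \<le> r" "r \<le> s" for r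
      proof -
        have ur: "u r \<in> S" using r s S by auto
        obtain d0 where d0: "d0 > 0" "ball (u r) d0 \<subseteq> S" using S(1) ur open_contains_ball by metis
        have "isCont \<Phi>' (u r)" using cont S(1) ur by (simp add: continuous_on_eq_continuous_at)
        then obtain d1 where d1: "d1 > 0" "\<And>z. dist z (u r) < d1 \<Longrightarrow> dist (\<Phi>' z) (\<Phi>' (u r)) < e/2"
          using e unfolding continuous_at_eps_delta by (metis half_gt_zero)
        let ?d = "min d0 d1"
        let ?B = "ball (u r) ?d"
        \<comment> \<open>Without its linear part at \<open>u r\<close>, \<open>\<Phi>\<close> has
          derivative at most \<open>e/2\<close> on the ball. The other \<open>e/2\<close> pays for
          freezing \<open>\<Phi>' (u q)\<close> at \<open>\<Phi>' (u r)\<close> under the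
          integral.\<close>
        have lip: "norm ((\<Phi> z - \<Phi>' (u r) * z) - (\<Phi> w - \<Phi>' (u r) * w)) \<le> e/2 * norm (z - w)"
          if "z \<in> ?B" "w \<in> ?B" for z w
        proof (rule field_differentiable_bound[where S = ?B and f' = "\<lambda>z. \<Phi>' z - \<Phi>' (u r)"])
          fix y assume y: "y \<in> ?B"
          then have "y \<in> S" using d0 by auto
          show "((\<lambda>z. \<Phi> z - \<Phi>' (u r) * z) has_field_derivative \<Phi>' y - \<Phi>' (u r)) (at y within ?B)"
            by (rule DERIV_subset[of _ _ _ UNIV]) (use der[OF \<open>y \<in> S\<close>] in \<open>auto intro!: derivative_eq_intros\<close>)
          show "norm (\<Phi>' y - \<Phi>' (u r)) \<le> e/2"
            using d1(2)[of y] y by (auto simp: dist_norm norm_minus_commute less_imp_le)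
        qed (use that in auto)
        obtain d2 where d2: "d2 > 0" "\<And>q. q \<in> {0..t} \<Longrightarrow> dist q r < d2 \<Longrightarrow> dist (u q) (u r) < ?d"
        proof -
          have "r \<in> {0..t}" "0 < ?d" using r s d0(1) d1(1) by auto
          then show ?thesis using cu that unfolding continuous_on_iff by blast
        qed
        have "P e a b" if ab: "a \<le> r" "r \<le> b" "b - a < d2" for a b
        proof -
          {
            assume *: "0 \<le> a" "b \<le> s"
            have near: "u q \<in> ?B" if "q \<in> {a..b}" for q
              using d2(2)[of q] that ab * s by (auto simp: dist_commute dist_real_def)
            have ba: "u b - u a = integral {a..b} f"
              using primitive_on_diff_eq[OF u] * ab s by auto
            have n1: "norm (u b - u a) \<le> integral {a..b} (\<lambda>s. norm (f s))"
              unfolding ba using subi[OF *] by (intro integral_norm_bound_integral) simp_all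
            have "norm (\<Phi> (u b) - \<Phi> (u a) - \<Phi>' (u r) * (u b - u a)) \<le> e/2 * norm (u b - u a)"
              using lip[OF near near, of b a] ab by (simp add: algebra_simps)
            also have "\<dots> \<le> e/2 * integral {a..b} (\<lambda>s. norm (f s))"
              using n1 e by (intro mult_left_mono) auto
            finally have A: "norm (\<Phi> (u b) - \<Phi> (u a) - \<Phi>' (u r) * (u b - u a)) \<le> e/2 * integral {a..b} (\<lambda>s. norm (f s))" .
            have "\<Phi>' (u r) * (u b - u a) - integral {a..b} ?F = integral {a..b} (\<lambda>q. (\<Phi>' (u r) - \<Phi>' (u q)) * f q)"
              unfolding ba left_diff_distrib
              using subi[OF *] by (subst Henstock_Kurzweil_Integration.integral_diff) (simp_all add: integrable_on_mult_right)
            also have "norm \<dots> \<le> integral {a..b} (\<lambda>q. e/2 * norm (f q))"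
            proof (rule integral_norm_bound_integral)
              have "(\<lambda>q. \<Phi>' (u r) * f q - \<Phi>' (u q) * f q) integrable_on {a..b}"
                using subi[OF *] by (intro integrable_diff integrable_on_mult_right)
              then show "(\<lambda>q. (\<Phi>' (u r) - \<Phi>' (u q)) * f q) integrable_on {a..b}"
                by (simp add: left_diff_distrib)
              show "(\<lambda>q. e/2 * norm (f q)) integrable_on {a..b}" using subi[OF *] by (intro integrable_on_mult_right)
              show "norm ((\<Phi>' (u r) - \<Phi>' (u q)) * f q) \<le> e/2 * norm (f q)" if "q \<in> {a..b}" for q
                unfolding norm_mult using near[OF that] d1(2)[of "u q"]
                by (intro mult_right_mono) (auto simp: dist_norm norm_minus_commute less_imp_le)
            qed
            finally have B: "norm (\<Phi>' (u r) * (u b - u a) - integral {a..b} ?F) \<le> e/2 * integral {a..b} (\<lambda>s. norm (f s))"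
              by simp
            have "norm (\<Phi> (u b) - \<Phi> (u a) - integral {a..b} ?F) \<le> e * integral {a..b} (\<lambda>s. norm (f s))"
              using norm_triangle_mono[OF A B] by (simp add: algebra_simps)
          }
          then show ?thesis unfolding P_def by auto
        qed
        then show ?thesis using d2(1) by blast
      qed
    qed
    then have le: "norm (\<Phi> (u s) - \<Phi> (u 0) - integral {0..s} ?F) \<le> e * integral {0..s} (\<lambda>s. norm (f s))"
      if "e > 0" for e
      using that s unfolding P_def by auto
    let ?I = "integral {0..s} (\<lambda>s. norm (f s))"
    have I0: "?I \<ge> 0" using subi(3)[of 0 s] by (intro integral_nonneg) simp_all
    have "norm (\<Phi> (u s) - \<Phi> (u 0) - integral {0..s} ?F) \<le> 0 + e" if "e > 0" for e
    proof -
      \<comment> \<open>The summand \<open>1\<close> keeps the quotient meaningful when the integral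
        of the norm vanishes.\<close>
      have "e / (?I + 1) * ?I \<le> e" using that I0 by (simp add: field_simps)
      then show ?thesis using le[of "e / (?I + 1)"] that I0 by (auto intro: order_trans)
    qed
    then have "norm (\<Phi> (u s) - \<Phi> (u 0) - integral {0..s} ?F) \<le> 0" by (rule field_le_epsilon)
    then show ?thesis by (simp add: algebra_simps)
  qed
  then show ?thesis using Fi by (rule primitive_onI[rotated])
qed

text \<open>Polarization, \<open>4uv = (u + v)^2 - (u - v)^2\<close>, reduces the product to
  squares, where the chain rule in one variable applies.\<close>

lemma primitive_on_mult:
  assumes u: "primitive_on t u f" and v: "primitive_on t v h"
  shows "primitive_on t (\<lambda>s. u s * v s) (\<lambda>s. f s * v s + u s * h s)"
proof -
  have sq: "primitive_on t (\<lambda>s. (w s)\<^sup>2) (\<lambda>s. (2 * w s) * k s)" if "primitive_on t w k" for w k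
    by (rule primitive_on_chain[OF that open_UNIV, of "\<lambda>z. z\<^sup>2" "\<lambda>z. 2 * z"])
      (auto intro!: derivative_eq_intros continuous_intros)
  show ?thesis
    by (rule primitive_on_cong[OF primitive_on_cmult[of t _ _ "1/4",
        OF primitive_on_diff[OF sq[OF primitive_on_add[OF u v]] sq[OF primitive_on_diff[OF u v]]]]])
      (auto simp: algebra_simps power2_eq_square)
qed

lemma primitive_on_inverse:
  assumes "primitive_on t u f" "\<And>s. s \<in> {0..t} \<Longrightarrow> u s \<noteq> 0"
  shows "primitive_on t (\<lambda>s. inverse (u s)) (\<lambda>s. - f s / (u s)\<^sup>2)"
proof -
  have "primitive_on t (\<lambda>s. inverse (u s)) (\<lambda>s. (- inverse ((u s)\<^sup>2)) * f s)"
    by (rule primitive_on_chain[OF assms(1), of "-{0}" inverse "\<lambda>z. - inverse (z\<^sup>2)"])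
      (use assms(2) in \<open>auto intro!: derivative_eq_intros continuous_intros simp: power2_eq_square\<close>)
  then show ?thesis by (rule primitive_on_cong) (auto simp: field_simps)
qed

text \<open>The integrating factor \<open>exp (- ?C s)\<close> makes the product constant. In the
  applications this means that a solution vanishes at all times or at none.\<close>

lemma primitive_on_linear_ode:
  assumes u: "primitive_on t u (\<lambda>s. c s * u s)" and c: "c absolutely_integrable_on {0..t}"
    and s: "s \<in> {0..t}"
  shows "u s = u 0 * exp (integral {0..s} c)"
proof -
  let ?C = "\<lambda>s. integral {0..s} c"
  have C: "primitive_on t ?C c" using c unfolding primitive_on_def by auto
  have E: "primitive_on t (\<lambda>s. exp (- ?C s)) (\<lambda>s. (- exp (- ?C s)) * c s)"
    by (rule primitive_on_chain[OF C open_UNIV, of "\<lambda>z. exp (-z)"])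
      (auto intro!: derivative_eq_intros continuous_intros)
  have "primitive_on t (\<lambda>s. u s * exp (- ?C s)) (\<lambda>s. 0)"
    by (rule primitive_on_cong[OF primitive_on_mult[OF u E]]) (auto simp: algebra_simps)
  from primitive_onD(2)[OF this s] have "u s * exp (- ?C s) = u 0" by simp
  then show ?thesis by (simp add: exp_minus field_simps)
qed

section \<open>Rational functions with prescribed critical points\<close>

definition root_poly :: "complex set \<Rightarrow> complex poly" where
  "root_poly S = (\<Prod>a\<in>S. [:-a, 1:])"

lemma poly_root_poly: "poly (root_poly S) w = (\<Prod>a\<in>S. w - a)"
  by (simp add: root_poly_def poly_prod)

lemma degree_root_poly: "finite S \<Longrightarrow> degree (root_poly S) = card S"
  unfolding root_poly_def by (subst degree_prod_eq_sum_degree) auto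

lemma monic_root_poly: "lead_coeff (root_poly S) = 1"
  unfolding root_poly_def by (subst lead_coeff_prod) simp

lemma root_poly_nonzero [simp]: "root_poly S \<noteq> 0"
  using monic_root_poly[of S] by auto

lemma root_poly_remove: "finite S \<Longrightarrow> a \<in> S \<Longrightarrow> root_poly S = [:-a, 1:] * root_poly (S - {a})"
  unfolding root_poly_def by (rule prod.remove)

lemma poly_pderiv_root_poly:
  assumes "finite S" "w \<notin> S"
  shows "poly (pderiv (root_poly S)) w = poly (root_poly S) w * (\<Sum>a\<in>S. 1 / (w - a))"
  using assms
proof (induction S rule: finite_induct)
  case empty
  then show ?case by (simp add: root_poly_def)
next
  case (insert a S)
  let ?L = "[:-a, 1:]"
  have L: "poly ?L w = w - a" "poly (pderiv ?L) w = 1" by (simp_all add: pderiv_pCons)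
  have eq: "root_poly (insert a S) = ?L * root_poly S"
    using insert.hyps by (simp add: root_poly_def)
  have IH: "poly (pderiv (root_poly S)) w = poly (root_poly S) w * (\<Sum>a\<in>S. 1 / (w - a))"
    using insert by auto
  show ?case
    unfolding eq pderiv_mult poly_mult poly_add L IH sum.insert[OF insert.hyps]
    using insert.prems by (simp add: field_simps)
qed

lemma double_root_dvd:
  fixes D :: "complex poly"
  assumes "poly D a = 0" "poly (pderiv D) a = 0"
  shows "[:-a, 1:]\<^sup>2 dvd D"
proof -
  obtain E where E: "D = [:-a, 1:] * E" using assms(1) by (auto simp: poly_eq_0_iff_dvd dvd_def)
  have "pderiv D = [:-a, 1:] * pderiv E + E"
    unfolding E pderiv_mult by (simp add: pderiv_pCons)
  then have "poly E a = 0" using assms(2) by simp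
  then obtain G where "E = [:-a, 1:] * G" by (auto simp: poly_eq_0_iff_dvd dvd_def)
  then have "D = [:-a, 1:]\<^sup>2 * G" by (simp only: E power2_eq_square mult.assoc)
  then show ?thesis by (rule dvdI)
qed

text \<open>Dividing out the factor at \<open>a\<close> does not change the multiplicities of the
  other roots, so the induction can continue with the quotient.\<close>

lemma root_poly_power_dvd:
  assumes "finite S" "\<And>a. a \<in> S \<Longrightarrow> [:-a, 1:] ^ k dvd D"
  shows "root_poly S ^ k dvd D"
  using assms
proof (induction S arbitrary: D rule: finite_induct)
  case empty
  then show ?case by (simp add: root_poly_def)
next
  case (insert a S)
  obtain E where E: "D = [:-a, 1:] ^ k * E" using insert.prems by (auto simp: dvd_def)
  have "root_poly S ^ k dvd E"
  proof (rule insert.IH)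
    fix b assume b: "b \<in> S"
    show "[:-b, 1:] ^ k dvd E"
    proof (cases "E = 0")
      case False
      then have "D \<noteq> 0" by (simp add: E)
      have "order b ([:-a, 1:] ^ k) = 0" using b insert.hyps by (intro order_0I) auto
      then have "order b D = order b E" using \<open>D \<noteq> 0\<close> unfolding E by (subst order_mult) auto
      then show ?thesis using insert.prems[of b] b \<open>D \<noteq> 0\<close> False by (simp add: order_divides)
    qed simp
  qed
  then have "[:-a, 1:] ^ k * root_poly S ^ k dvd D" unfolding E by (rule mult_dvd_mono[OF dvd_refl])
  then show ?case
    unfolding root_poly_def prod.insert[OF insert.hyps] power_mult_distrib .
qed

text \<open>Conjugating the coefficients gives a polynomial with the same values, hence the same
  polynomial, so the coefficients are real. This links the complex computations with the real
  polynomials that \<open>CRR\<close> asks for.\<close>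

lemma map_poly_Re_symmetric:
  assumes "\<And>w. poly f (cnj w) = cnj (poly f w)"
  shows "map_poly complex_of_real (map_poly Re f) = f"
proof -
  have "poly (map_poly cnj f) w = poly f w" for w
    using poly_cnj[of f "cnj w"] assms[of w] by (metis complex_cnj_cnj)
  then have "map_poly cnj f = f" by (simp add: poly_eq_poly_eq_iff[symmetric] fun_eq_iff)
  then have "cnj (coeff f i) = coeff f i" for i by (metis coeff_map_poly complex_cnj_zero)
  then have "complex_of_real (Re (coeff f i)) = coeff f i" for i
    by (metis complex_is_Real_iff Reals_cnj_iff of_real_Re)
  then show ?thesis by (intro poly_eqI) (simp add: coeff_map_poly)
qed

text \<open>\<open>X\<close> and \<open>Z\<close> are the critical points and the finite poles; \<open>e = 1\<close> if \<open>\<infinity>\<close> is a pole too, and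
  \<open>e = 0\<close> otherwise.\<close>

definition pole_coeff :: "complex set \<Rightarrow> complex set \<Rightarrow> complex \<Rightarrow> complex" where
  "pole_coeff X Z a = (\<Prod>x\<in>X. a - x) / (\<Prod>b\<in>Z - {a}. a - b)\<^sup>2"

definition rat_val :: "nat \<Rightarrow> complex set \<Rightarrow> complex set \<Rightarrow> complex \<Rightarrow> complex" where
  "rat_val e X Z w = of_nat e * w - (\<Sum>a\<in>Z. pole_coeff X Z a / (w - a))"

text \<open>This is \<open>rat_val\<close> cleared of its denominator \<open>root_poly Z\<close>. It
  stays meaningful at the poles, where the fractions in \<open>rat_val\<close> take default
  values.\<close>

definition num_poly :: "nat \<Rightarrow> complex set \<Rightarrow> complex set \<Rightarrow> complex poly" where
  "num_poly e X Z = smult (of_nat e) ([:0, 1:] * root_poly Z) -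
     (\<Sum>a\<in>Z. smult (pole_coeff X Z a) (root_poly (Z - {a})))"

definition rat_map :: "nat \<Rightarrow> complex set \<Rightarrow> complex set \<Rightarrow> csphere \<Rightarrow> csphere" where
  "rat_map e X Z = rat_fun (map_poly Re (num_poly e X Z)) (map_poly Re (root_poly Z))"

text \<open>\<open>card_eq\<close> is the Riemann-Hurwitz count of \<open>2 * d - 2\<close> critical
  points for degree \<open>d = card Z + e\<close>. A pole at infinity contributes nothing to the
  sums in \<open>stat\<close>.\<close>

locale stationary =
  fixes e :: nat and X Z :: "complex set"
  assumes finX: "finite X" and finZ: "finite Z" and XZ: "X \<inter> Z = {}" and e1: "e \<le> 1"
    and Z0: "Z \<noteq> {}"
    and card_eq: "card X + 2 = 2 * (card Z + e)"
    and stat: "\<And>a. a \<in> Z \<Longrightarrow> (\<Sum>x\<in>X. 1 / (a - x)) = (\<Sum>b\<in>Z - {a}. 2 / (a - b))"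
begin

abbreviation "A \<equiv> pole_coeff X Z"
abbreviation "P \<equiv> root_poly X"
abbreviation "Q \<equiv> root_poly Z"
abbreviation "p \<equiv> num_poly e X Z"
abbreviation "R \<equiv> rat_val e X Z"

section \<open>The Wronskian identity and the derivative of \<open>R\<close>\<close>

lemma poly_Q_nonzero: "w \<notin> Z \<Longrightarrow> poly Q w \<noteq> 0"
  using finZ by (auto simp: poly_root_poly)

lemma poly_Q_remove_nonzero: "poly (root_poly (Z - {a})) a \<noteq> 0"
  using finZ by (auto simp: poly_root_poly)

lemma poly_P_nonzero: "w \<notin> X \<Longrightarrow> poly P w \<noteq> 0"
  using finX by (auto simp: poly_root_poly)

lemma A_eq: "A a = poly P a / (poly (root_poly (Z - {a})) a)\<^sup>2"
  by (simp add: pole_coeff_def poly_root_poly)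

lemma A_nonzero: "a \<in> Z \<Longrightarrow> A a \<noteq> 0"
  using poly_P_nonzero[of a] poly_Q_remove_nonzero[of a] XZ by (auto simp: A_eq)

lemma poly_p_pole: assumes "a \<in> Z" shows "poly p a = - A a * poly (root_poly (Z - {a})) a"
proof -
  have "(\<Sum>b\<in>Z. poly (smult (A b) (root_poly (Z - {b}))) a) =
      (\<Sum>b\<in>Z. if b = a then A a * poly (root_poly (Z - {a})) a else 0)"
    using assms finZ by (intro sum.cong) (auto simp: poly_root_poly)
  moreover have "poly Q a = 0" using assms finZ by (auto simp: poly_root_poly)
  ultimately show ?thesis using assms finZ by (simp add: num_poly_def poly_sum)
qed

lemma poly_p_pole_nonzero: "a \<in> Z \<Longrightarrow> poly p a \<noteq> 0"
  using A_nonzero poly_p_pole poly_Q_remove_nonzero by simp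

lemma poly_p: assumes "w \<notin> Z" shows "poly p w = R w * poly Q w"
proof -
  have "poly (root_poly (Z - {a})) w = poly Q w / (w - a)" if "a \<in> Z" for a
  proof -
    have "poly Q w = (w - a) * poly (root_poly (Z - {a})) w"
      by (subst root_poly_remove[OF finZ that]) (simp add: algebra_simps)
    then show ?thesis using assms that by auto
  qed
  then have "(\<Sum>a\<in>Z. A a * poly (root_poly (Z - {a})) w) = (\<Sum>a\<in>Z. A a / (w - a)) * poly Q w"
    unfolding sum_distrib_right by (intro sum.cong) auto
  then show ?thesis by (simp add: num_poly_def rat_val_def poly_sum left_diff_distrib)
qed

text \<open>The difference \<open>D\<close> of the two sides has a double zero at every pole: its
  value vanishes by the choice of the coefficients \<open>A\<close>, its derivative by the
  stationary relation. Hence \<open>Q^2\<close> divides \<open>D\<close>, whose degree turns out to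
  be too small for that unless \<open>D = 0\<close>.\<close>

lemma wronskian: "pderiv p * Q - p * pderiv Q = P"
proof -
  define p0 where "p0 = (\<Sum>a\<in>Z. smult (A a) (root_poly (Z - {a})))"
  define D where "D = pderiv p * Q - p * pderiv Q - P"
  have p: "p = smult (of_nat e) ([:0, 1:] * Q) - p0" by (simp add: num_poly_def p0_def)
  have "[:-a, 1:]\<^sup>2 dvd D" if a: "a \<in> Z" for a
  proof -
    define q where "q = root_poly (Z - {a})"
    have q0: "poly q a \<noteq> 0" unfolding q_def by (rule poly_Q_remove_nonzero)
    define L :: "complex poly" where "L = [:-a, 1:]"
    have L: "poly L a = 0" "pderiv L = 1" by (simp_all add: L_def pderiv_pCons)
    have Q: "Q = L * q" unfolding L_def q_def by (rule root_poly_remove[OF finZ a])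
    have Q': "pderiv Q = q + L * pderiv q" by (simp add: Q pderiv_mult L)
    have Q'': "pderiv (pderiv Q) = 2 * pderiv q + L * pderiv (pderiv q)"
      by (simp add: Q' pderiv_mult pderiv_add L algebra_simps)
    have pa: "poly p a = - A a * poly q a" using poly_p_pole[OF a] by (simp add: q_def)
    have q': "poly (pderiv q) a = poly q a * (\<Sum>b\<in>Z-{a}. 1 / (a - b))"
      unfolding q_def by (rule poly_pderiv_root_poly) (use finZ in auto)
    have P': "poly (pderiv P) a = poly P a * (\<Sum>b\<in>X. 1 / (a - b))"
      by (rule poly_pderiv_root_poly) (use finX XZ a in auto)
    have Pa: "poly P a = A a * (poly q a)\<^sup>2" using q0 by (simp add: A_eq q_def)
    have "poly D a = 0" by (simp add: D_def Q' pa Pa power2_eq_square) (simp add: Q L)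
    moreover have "poly (pderiv D) a = 0"
    proof -
      \<comment> \<open>The mixed terms \<open>pderiv p * pderiv Q\<close> cancel, so at the root
        \<open>a\<close> of \<open>Q\<close> only the value of \<open>p\<close> enters, which is
        known.\<close>
      have "pderiv D = pderiv (pderiv p) * Q - p * pderiv (pderiv Q) - pderiv P"
        by (simp add: D_def pderiv_diff pderiv_mult)
      then have "poly (pderiv D) a = A a * poly q a * (2 * poly (pderiv q) a) - poly (pderiv P) a"
        by (simp add: Q'' pa L) (simp add: Q L)
      also have "\<dots> = A a * (poly q a)\<^sup>2 * ((\<Sum>b\<in>Z-{a}. 2 / (a - b)) - (\<Sum>b\<in>X. 1 / (a - b)))"
        unfolding q' P' Pa by (simp add: sum_distrib_left[of 2, symmetric, where f = "\<lambda>b. 1 / (a - b)", simplified] algebra_simps power2_eq_square)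
      also have "\<dots> = 0" using stat[OF a] by simp
      finally show ?thesis .
    qed
    ultimately show ?thesis by (rule double_root_dvd)
  qed
  then have dvd: "Q\<^sup>2 dvd D" using finZ by (intro root_poly_power_dvd) auto
  let ?N = "2 * card Z"
  have dQ: "degree Q = card Z" by (rule degree_root_poly[OF finZ])
  have dQ2: "degree (Q\<^sup>2) = ?N" by (simp add: degree_power_eq dQ)
  have cZ: "card Z > 0" using finZ Z0 by (simp add: card_gt_0_iff)
  have dp0: "degree p0 \<le> card Z - 1"
    unfolding p0_def using finZ
    by (intro degree_sum_le) (auto intro!: order_trans[OF degree_smult_le] simp: degree_root_poly)
  define E where "E = p0 * pderiv Q - pderiv p0 * Q"
  have "degree (p0 * pderiv Q) < ?N"
    using degree_mult_le[of p0 "pderiv Q"] dp0 degree_pderiv[of Q] dQ cZ by linarith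
  moreover have "degree (pderiv p0 * Q) < ?N"
    using degree_mult_le[of "pderiv p0" Q] dp0 degree_pderiv[of p0] dQ cZ by linarith
  ultimately have dE: "degree E < ?N" unfolding E_def by (rule degree_diff_less)
  \<comment> \<open>The coefficients of degree \<open>?N\<close> cancel: for \<open>e = 1\<close>
    both \<open>Q\<^sup>2\<close> and \<open>P\<close> are monic of that degree, and for
    \<open>e = 0\<close> the first term is absent while \<open>P\<close> has degree
    \<open>?N - 2\<close>.\<close>
  have D: "D = smult (of_nat e) (Q\<^sup>2) - P + E"
    by (simp add: D_def E_def p pderiv_diff pderiv_mult pderiv_smult pderiv_pCons power2_eq_square algebra_simps smult_add_right)
  have dP: "degree P = card X" by (rule degree_root_poly[OF finX])
  have "coeff P ?N = of_nat e"
  proof (cases "e = 0")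
    case True
    then show ?thesis using dP card_eq by (intro coeff_eq_0[THEN trans]) auto
  next
    case False
    then have "e = 1" using e1 by simp
    then show ?thesis using monic_root_poly[of X] dP card_eq by simp
  qed
  moreover have "coeff (Q\<^sup>2) ?N = 1"
    using lead_coeff_power[of Q 2] monic_root_poly[of Z] dQ2 by simp
  ultimately have "coeff D ?N = 0" using dE by (simp add: D coeff_eq_0)
  moreover have "degree D \<le> ?N"
    unfolding D using dE dQ2 dP card_eq e1
    by (intro degree_add_le degree_diff_le) (auto intro: order_trans[OF degree_smult_le])
  ultimately have "D = 0 \<or> degree D < ?N" by (intro eq_zero_or_degree_less)
  then have "D = 0" using dvd_imp_degree_le[OF dvd] dQ2 by fastforce
  then show ?thesis by (simp add: D_def)
qed

lemma R_deriv:
  assumes w: "w \<notin> Z"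
  shows "(R has_field_derivative poly P w / (poly Q w)\<^sup>2) (at w)"
proof (rule has_field_derivative_transform_within_open)
  show "open (- Z)" using finZ by (simp add: finite_imp_closed open_Compl)
  show "((\<lambda>w. poly p w / poly Q w) has_field_derivative poly P w / (poly Q w)\<^sup>2) (at w)"
    using poly_Q_nonzero[OF w] wronskian[symmetric]
    by (auto intro!: derivative_eq_intros simp: power2_eq_square)
  show "poly p v / poly Q v = R v" if "v \<in> - Z" for v
    using that poly_p poly_Q_nonzero by simp
qed (use w in auto)

lemma R_deriv_explicit:
  assumes w: "w \<notin> Z"
  shows "of_nat e + (\<Sum>a\<in>Z. A a / (w - a)\<^sup>2) = poly P w / (poly Q w)\<^sup>2"
proof -
  have "(R has_field_derivative of_nat e - (\<Sum>a\<in>Z. - (A a / (w - a)\<^sup>2))) (at w)"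
    unfolding rat_val_def[abs_def]
  proof (intro DERIV_diff DERIV_sum)
    show "((*) (of_nat e) has_field_derivative of_nat e) (at w)"
      by (rule DERIV_cmult_Id)
    show "((\<lambda>w. A a / (w - a)) has_field_derivative - (A a / (w - a)\<^sup>2)) (at w)" if "a \<in> Z" for a
      using w that by (auto intro!: derivative_eq_intros simp: power2_eq_square)
  qed
  from DERIV_unique[OF this R_deriv[OF w]] show ?thesis by (simp add: sum_negf)
qed

lemma R_deriv_critical: "x \<in> X \<Longrightarrow>
    of_nat e + (\<Sum>a\<in>Z. A a / (x - a)\<^sup>2) = 0"
proof -
  assume x: "x \<in> X"
  then have "poly P x = 0" using finX by (auto simp: poly_root_poly)
  then show ?thesis using R_deriv_explicit[of x] XZ x by auto
qed

end

lemma map_poly_of_real_mult: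
  "map_poly complex_of_real (f * g) = map_poly complex_of_real f * map_poly complex_of_real g"
  by (intro poly_eqI) (simp add: coeff_map_poly coeff_mult)

section \<open>Degrees, behaviour at infinity, and nonreal values of \<open>R\<close>\<close>

context stationary
begin

lemma degree_Q: "degree Q = card Z"
  by (rule degree_root_poly[OF finZ])

lemma card_Z_pos: "card Z > 0"
  using finZ Z0 by (simp add: card_gt_0_iff)

lemma degree_p_remainder: "degree (\<Sum>a\<in>Z. smult (A a) (root_poly (Z - {a}))) \<le> card Z - 1"
  using finZ by (intro degree_sum_le) (auto intro!: order_trans[OF degree_smult_le] simp: degree_root_poly)

lemma degree_p_0: "e = 0 \<Longrightarrow> degree p < card Z"
  using degree_p_remainder card_Z_pos by (simp add: num_poly_def)

lemma degree_p_1: assumes "e = 1" shows "degree p = card Z + 1"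
proof -
  have "degree (pCons 0 Q) = card Z + 1" by (simp add: degree_Q)
  then show ?thesis
    using degree_p_remainder assms card_Z_pos
    unfolding num_poly_def diff_conv_add_uminus by (subst degree_add_eq_left) auto
qed

lemma max_degree: "max (degree p) (degree Q) = card Z + e"
  using degree_p_0 degree_p_1 degree_Q e1 by (cases "e = 0") auto

text \<open>For \<open>e = 0\<close>, \<open>R\<close> behaves at infinity like minus this sum times
  \<open>1 / w\<close>, so a zero sum would make infinity critical. It would also lower the degree
  of \<open>p\<close> so far that the Wronskian could not reach the degree
  \<open>2 * card Z - 2\<close> of \<open>P\<close>.\<close>

lemma sum_A_nonzero: assumes "e = 0" shows "(\<Sum>a\<in>Z. A a) \<noteq> 0"
proof
  assume *: "(\<Sum>a\<in>Z. A a) = 0"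
  have "coeff (root_poly (Z - {a})) (card Z - 1) = 1" if "a \<in> Z" for a
    using monic_root_poly[of "Z - {a}"] finZ that by (simp add: degree_root_poly)
  then have "coeff p (card Z - 1) = - (\<Sum>a\<in>Z. A a)"
    using assms by (simp add: num_poly_def coeff_sum)
  then have "coeff p (card Z - 1) = 0" using * by simp
  moreover have "degree p \<le> card Z - 1" using degree_p_0[OF assms] by simp
  ultimately have "p = 0 \<or> degree p < card Z - 1" by (intro eq_zero_or_degree_less)
  moreover have "p \<noteq> 0" using wronskian by (metis diff_self mult_zero_left pderiv_0 root_poly_nonzero)
  ultimately have dp: "degree p < card Z - 1" by simp
  have cX: "degree P = 2 * card Z - 2" using degree_root_poly[OF finX] card_eq assms by simp
  have "degree (p * pderiv Q) < 2 * card Z - 2"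
    using degree_mult_le[of p "pderiv Q"] dp degree_pderiv[of Q] degree_Q by linarith
  moreover have "degree (pderiv p * Q) < 2 * card Z - 2"
  proof (cases "degree p = 0")
    case True
    then have "pderiv p = 0" by (simp add: pderiv_eq_0_iff)
    then show ?thesis using dp by simp
  next
    case False
    then show ?thesis
      using degree_mult_le[of "pderiv p" Q] dp degree_pderiv[of p] degree_Q by linarith
  qed
  ultimately have "degree (pderiv p * Q - p * pderiv Q) < 2 * card Z - 2" by (rule degree_diff_less[rotated])
  then show False using wronskian cX by simp
qed

text \<open>Arbitrarily close to \<open>w\<close> there is a point that is neither critical nor a
  pole, and near such a point \<open>R\<close> cannot be real everywhere.\<close>

lemma R_nonreal_near:
  assumes "0 < \<epsilon>"
  shows "\<exists>v. dist v w < \<epsilon> \<and> v \<notin> Z \<and> Im (R v) \<noteq> 0"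
proof -
  have "infinite (ball w \<epsilon>)" using assms using uncountable_ball[of \<epsilon> w] countable_finite by blast
  then obtain w' where w': "w' \<in> ball w \<epsilon>" "w' \<notin> X \<union> Z"
    using finX finZ by (meson finite_UnI finite_subset subsetI)
  define U where "U = ball w \<epsilon> - Z"
  have "open U" unfolding U_def using finZ by (simp add: finite_imp_closed open_Diff)
  define D where "D = poly P w' / (poly Q w')\<^sup>2"
  have D0: "D \<noteq> 0" using w' poly_P_nonzero poly_Q_nonzero by (simp add: D_def)
  have dR: "(R has_field_derivative D) (at w')" unfolding D_def by (rule R_deriv) (use w' in auto)
  \<comment> \<open>In the direction \<open>\<i> / D\<close> the derivative of \<open>R\<close> is
    \<open>\<i>\<close>, so \<open>Im R\<close> grows at unit speed.\<close>
  define l where "l s = w' + of_real s * (\<i> / D)" for s :: real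
  have dl: "(l has_vector_derivative (\<i> / D)) (at 0)"
    unfolding l_def[abs_def] by (auto intro!: derivative_eq_intros)
  have "((R \<circ> l) has_vector_derivative (\<i> / D) * D) (at 0)"
    by (rule field_vector_diff_chain_at[OF dl]) (use dR in \<open>simp add: l_def\<close>)
  then have "((\<lambda>s. Im ((R \<circ> l) s)) has_vector_derivative Im ((\<i> / D) * D)) (at 0)"
    by (rule bounded_linear.has_vector_derivative[OF bounded_linear_Im])
  then have d1: "((\<lambda>s. Im ((R \<circ> l) s)) has_vector_derivative 1) (at 0)" using D0 by simp
  have "\<exists>v\<in>U. Im (R v) \<noteq> 0"
  proof (rule ccontr)
    assume *: "\<not> (\<exists>v\<in>U. Im (R v) \<noteq> 0)"
    have "open (l -` U)" unfolding l_def[abs_def]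
      by (intro open_vimage \<open>open U\<close> continuous_intros)
    moreover have "0 \<in> l -` U" using w' by (simp add: l_def U_def)
    ultimately have "((\<lambda>s::real. 0::real) has_vector_derivative 1) (at 0)"
      using * has_vector_derivative_transform_within_open[OF d1, of "l -` U" "\<lambda>_. 0"] by auto
    then show False using vector_derivative_unique_at[of "\<lambda>_. 0::real" 1 0 0] by auto
  qed
  then show ?thesis by (auto simp: U_def dist_commute)
qed

end

section \<open>Conjugation symmetry, fibres and critical points on the sphere\<close>

locale real_stationary = stationary +
  assumes Xreal: "X \<subseteq> \<real>" and Zcnj: "\<And>a. a \<in> Z \<Longrightarrow> cnj a \<in> Z"
begin

lemma cnj_in_Z_iff [simp]: "cnj a \<in> Z \<longleftrightarrow> a \<in> Z"
  using Zcnj[of a] Zcnj[of "cnj a"] by auto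

lemma bij_cnj: "bij_betw cnj (Z - {a}) (Z - {cnj a})"
  by (rule bij_betw_byWitness[where f' = cnj]) auto

lemma bij_cnj': "bij_betw cnj Z Z"
  by (rule bij_betw_byWitness[where f' = cnj]) auto

lemma poly_root_poly_cnj: "poly (root_poly (Z - {cnj a})) (cnj w) = cnj (poly (root_poly (Z - {a})) w)"
  unfolding poly_root_poly prod.reindex_bij_betw[OF bij_cnj[of a], symmetric] by simp

lemma poly_Q_cnj: "poly Q (cnj w) = cnj (poly Q w)"
  unfolding poly_root_poly by (subst prod.reindex_bij_betw[OF bij_cnj', symmetric]) simp

lemma poly_P_cnj: "poly P (cnj w) = cnj (poly P w)"
proof -
  have "cnj x = x" if "x \<in> X" for x using Xreal that Reals_cnj_iff by blast
  then show ?thesis unfolding poly_root_poly by (auto intro!: prod.cong)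
qed

lemma A_cnj: "A (cnj a) = cnj (A a)"
  by (simp add: A_eq poly_P_cnj poly_root_poly_cnj)

lemma R_cnj: "R (cnj w) = cnj (R w)"
proof -
  have "(\<Sum>a\<in>Z. A a / (cnj w - a)) = (\<Sum>a\<in>Z. A (cnj a) / (cnj w - cnj a))"
    by (rule sum.reindex_bij_betw[OF bij_cnj', symmetric])
  then show ?thesis by (simp add: rat_val_def A_cnj)
qed

lemma poly_p_cnj: "poly p (cnj w) = cnj (poly p w)"
proof (cases "w \<in> Z")
  case True
  then show ?thesis by (simp add: poly_p_pole A_cnj poly_root_poly_cnj)
next
  case False
  then show ?thesis by (simp add: poly_p R_cnj poly_Q_cnj)
qed

abbreviation "pr \<equiv> map_poly Re p"
abbreviation "qr \<equiv> map_poly Re Q"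

lemma of_real_pr: "map_poly complex_of_real pr = p"
  by (rule map_poly_Re_symmetric) (rule poly_p_cnj)

lemma of_real_qr: "map_poly complex_of_real qr = Q"
  by (rule map_poly_Re_symmetric) (rule poly_Q_cnj)

lemma degree_pr: "degree pr = degree p"
  using degree_map_poly[of complex_of_real pr] of_real_pr by simp

lemma degree_qr: "degree qr = degree Q"
  using degree_map_poly[of complex_of_real qr] of_real_qr by simp

text \<open>A complex root of a common divisor would be a root of \<open>Q\<close>, that is, a pole,
  and \<open>p\<close> does not vanish there.\<close>

lemma coprime_pr_qr: "coprime pr qr"
proof (rule coprimeI)
  fix d assume d: "d dvd pr" "d dvd qr"
  let ?d = "map_poly complex_of_real d"
  have "?d dvd p" using d(1) of_real_pr map_poly_of_real_mult by (metis dvd_def)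
  moreover have "?d dvd Q" using d(2) of_real_qr map_poly_of_real_mult by (metis dvd_def)
  ultimately have "poly ?d w \<noteq> 0" for w
    using poly_p_pole_nonzero[of w] poly_Q_nonzero[of w] by (metis dvd_trans poly_eq_0_iff_dvd)
  then have "constant (poly ?d)" using fundamental_theorem_of_algebra by blast
  then have "degree ?d = 0" by (simp add: constant_degree)
  then have "degree d = 0" using degree_map_poly[of complex_of_real d] by simp
  moreover have "d \<noteq> 0" using d(2) degree_qr degree_Q card_Z_pos by auto
  ultimately show "is_unit d" by (simp add: is_unit_iff_degree)
qed

lemma rat_map_Some: "rat_map e X Z (Some w) = (if w \<in> Z then None else Some (R w))"
proof -
  have "w \<in> Z \<Longrightarrow> poly Q w = 0" using finZ by (auto simp: poly_root_poly)
  then show ?thesis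
    using poly_Q_nonzero[of w] poly_p[of w]
    by (simp add: rat_map_def rat_fun_def of_real_pr of_real_qr Let_def)
qed

lemma rat_map_None: "rat_map e X Z None = (if e = 1 then None else Some 0)"
proof (cases "e = 1")
  case True
  then have "degree qr < degree pr" using degree_p_1 degree_Q degree_pr degree_qr by simp
  then show ?thesis using True by (simp add: rat_map_def rat_fun_def)
next
  case False
  then have "degree pr < degree qr" using degree_p_0 degree_Q e1 degree_pr degree_qr by simp
  then show ?thesis using False by (simp add: rat_map_def rat_fun_def coeff_eq_0)
qed

text \<open>A multiple root of \<open>p - c Q\<close> is a zero of the Wronskian, hence one of the
  points of \<open>X\<close>. These are real, and \<open>R\<close> is real there, so all roots are
  simple when \<open>c\<close> is nonreal and the fibre has as many points as the degree.\<close>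

lemma R_nonreal_simple_roots:
  assumes c: "Im c \<noteq> 0"
  shows "finite {w. w \<notin> Z \<and> R w = c}" "card {w. w \<notin> Z \<and> R w = c} = card Z + e"
proof -
  define f where "f = p - smult c Q"
  have f_root: "poly f w = 0 \<longleftrightarrow> w \<notin> Z \<and> R w = c" for w
  proof (cases "w \<in> Z")
    case True
    then have "poly Q w = 0" using finZ by (auto simp: poly_root_poly)
    then show ?thesis using True poly_p_pole_nonzero[of w] by (simp add: f_def)
  next
    case False
    then show ?thesis using poly_p[of w] poly_Q_nonzero[of w] by (simp add: f_def left_diff_distrib[symmetric])
  qed
  have c0: "c \<noteq> 0" using c by auto
  \<comment> \<open>The leading term is that of \<open>smult c Q\<close> if \<open>e = 0\<close>,
    where \<open>c \<noteq> 0\<close> matters, and that of \<open>p\<close> if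
    \<open>e = 1\<close>.\<close>
  have deg: "degree f = card Z + e"
  proof (cases "e = 0")
    case True
    have "degree (p + smult (-c) Q) = degree (smult (-c) Q)"
      using degree_p_0[OF True] c0 degree_Q by (intro degree_add_eq_right) simp
    then show ?thesis using c0 True degree_Q by (simp add: f_def)
  next
    case False
    then have "e = 1" using e1 by simp
    have "degree (p + smult (-c) Q) = degree p"
      using degree_p_1[OF \<open>e = 1\<close>] c0 degree_Q by (intro degree_add_eq_left) simp
    then show ?thesis using degree_p_1 \<open>e = 1\<close> by (simp add: f_def)
  qed
  have "rsquarefree f"
    unfolding rsquarefree_roots
  proof (intro allI notI)
    fix w assume w: "poly f w = 0 \<and> poly (pderiv f) w = 0"
    then have "poly p w = c * poly Q w" "poly (pderiv p) w = c * poly (pderiv Q) w"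
      by (simp_all add: f_def pderiv_diff pderiv_smult)
    then have "poly (pderiv p * Q - p * pderiv Q) w = 0" by simp
    then have "w \<in> X" using poly_P_nonzero wronskian by metis
    then have "cnj w = w" using Xreal Reals_cnj_iff by blast
    then have "cnj (R w) = R w" using R_cnj by metis
    then have "cnj c = c" using w f_root by metis
    then show False using c by (simp add: complex_eq_iff)
  qed
  then have f0: "f \<noteq> 0" and ord: "\<And>a. order a f = 0 \<or> order a f = 1" by (auto simp: rsquarefree_def)
  have "size (proots f) = (\<Sum>a\<in>set_mset (proots f). order a f)"
    by (simp add: size_multiset_overloaded_eq f0)
  also have "set_mset (proots f) = {w. poly f w = 0}" using f0 by simp
  also have "(\<Sum>a | poly f a = 0. order a f) = (\<Sum>a | poly f a = 0. 1)"
  proof (rule sum.cong)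
    show "order a f = 1" if "a \<in> {a. poly f a = 0}" for a
      using ord[of a] f0 that order_root[of f a] by auto
  qed simp
  finally have "card {w. poly f w = 0} = degree f" by (simp add: size_proots_complex)
  moreover have "finite {w. poly f w = 0}" using f0 by (rule poly_roots_finite)
  ultimately show "finite {w. w \<notin> Z \<and> R w = c}" "card {w. w \<notin> Z \<and> R w = c} = card Z + e"
    using deg by (simp_all add: f_root)
qed

text \<open>One Wronskian serves both charts: \<open>p / Q\<close> has derivative
  \<open>P / Q^2\<close>, and \<open>Q / p\<close>, the local form at a pole, has derivative
  \<open>- P / p^2\<close>.\<close>

lemma critical_points_finite: "Some a \<in> critical_points (rat_map e X Z) \<longleftrightarrow> a \<in> X"
proof (cases "a \<in> Z")
  case False
  let ?F = "local_form (rat_map e X Z) (Some a)"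
  have F: "?F w = R w" if "w \<in> - Z" for w
    using that False by (simp add: local_form_def rat_map_Some)
  have "(?F has_field_derivative poly P a / (poly Q a)\<^sup>2) (at a)"
    by (rule has_field_derivative_transform_within_open[OF R_deriv[OF False], of "- Z"])
      (use finZ False F in \<open>auto simp: finite_imp_closed open_Compl\<close>)
  then have "(?F has_field_derivative 0) (at a) \<longleftrightarrow> poly P a / (poly Q a)\<^sup>2 = 0"
    using DERIV_unique by metis
  also have "\<dots> \<longleftrightarrow> a \<in> X"
    using poly_Q_nonzero[OF False] poly_P_nonzero[of a] finX by (auto simp: poly_root_poly)
  finally show ?thesis by (simp add: critical_points_def)
next
  case True
  let ?F = "local_form (rat_map e X Z) (Some a)"
  have Qa: "poly Q a = 0" using True finZ by (auto simp: poly_root_poly)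
  have F: "poly Q w / poly p w = ?F w" if "w \<in> {w. poly p w \<noteq> 0}" for w
    using that True poly_p[of w] finZ
    by (auto simp: local_form_def rat_map_Some sinverse_def poly_root_poly)
  have op: "open {w. poly p w \<noteq> 0}"
    by (intro open_Collect_neq continuous_intros)
  have "((\<lambda>w. poly Q w / poly p w) has_field_derivative - poly P a / (poly p a)\<^sup>2) (at a)"
    using poly_p_pole_nonzero[OF True] wronskian[symmetric] Qa
    by (auto intro!: derivative_eq_intros simp: power2_eq_square)
  then have "(?F has_field_derivative - poly P a / (poly p a)\<^sup>2) (at a)"
    by (rule has_field_derivative_transform_within_open[OF _ op _ F])
      (use poly_p_pole_nonzero[OF True] in auto)
  moreover have "- poly P a / (poly p a)\<^sup>2 \<noteq> 0"
    using poly_P_nonzero[of a] poly_p_pole_nonzero[OF True] True XZ by auto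
  ultimately have "\<not> (?F has_field_derivative 0) (at a)" using DERIV_unique by metis
  then show ?thesis using True XZ by (auto simp: critical_points_def)
qed

text \<open>In the coordinate \<open>1 / w\<close>, the function is \<open>- S w\<close> if
  \<open>e = 0\<close>, with derivative minus the sum of the \<open>A a\<close>, and its reciprocal
  is \<open>w / (1 - w * S w)\<close> if \<open>e = 1\<close>, with derivative \<open>1\<close>.
  Neither derivative is zero.\<close>

lemma critical_points_infinite: "None \<notin> critical_points (rat_map e X Z)"
proof -
  let ?F = "local_form (rat_map e X Z) None"
  define S where "S w = (\<Sum>a\<in>Z. A a * w / (1 - a * w))" for w
  define U where "U = (\<Inter>a\<in>Z. {w. 1 - a * w \<noteq> 0})"
  have opU: "open U" unfolding U_def
    by (intro open_INT finZ ballI open_Collect_neq continuous_intros)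
  have U0: "0 \<in> U" by (simp add: U_def)
  have R_inv: "1 / w \<notin> Z" "R (1 / w) = of_nat e / w - S w" if "w \<in> U" "w \<noteq> 0" for w
  proof -
    show nz: "1 / w \<notin> Z" using that by (auto simp: U_def)
    have "A a / (1 / w - a) = A a * w / (1 - a * w)" if "a \<in> Z" for a
      using \<open>w \<noteq> 0\<close> by (simp add: field_simps)
    then show "R (1 / w) = of_nat e / w - S w" by (simp add: rat_val_def S_def)
  qed
  have dS: "(S has_field_derivative (\<Sum>a\<in>Z. A a)) (at 0)"
    unfolding S_def[abs_def] by (intro DERIV_sum) (auto intro!: derivative_eq_intros)
  have S0: "S 0 = 0" by (simp add: S_def)
  have "\<exists>d. d \<noteq> 0 \<and> (?F has_field_derivative d) (at 0)"
  proof (cases "e = 0")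
    case True
    have RN: "rat_map e X Z None = Some 0" using True rat_map_None by simp
    have "(?F has_field_derivative - (\<Sum>a\<in>Z. A a)) (at 0)"
    proof (rule has_field_derivative_transform_within_open[OF DERIV_minus[OF dS] opU U0])
      show "- S w = ?F w" if "w \<in> U" for w
      proof (cases "w = 0")
        case True
        then show ?thesis by (simp add: local_form_def RN sinverse_def S0)
      next
        case False
        then have "1 / w \<notin> Z" "R (1 / w) = - S w" using \<open>e = 0\<close> R_inv[OF that False] by simp_all
        then show ?thesis using False by (simp add: local_form_def RN rat_map_Some sinverse_def)
      qed
    qed
    then show ?thesis using sum_A_nonzero[OF True] by (intro exI[of _ "- (\<Sum>a\<in>Z. A a)"]) simp
  next
    case False
    then have e: "e = 1" using e1 by simp
    have RN: "rat_map e X Z None = None" using e rat_map_None by simp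
    \<comment> \<open>Zeros of \<open>1 - w * S w\<close> are excluded because there
      \<open>R (1 / w) = 0\<close>, and the reciprocal would be infinite.\<close>
    define V where "V = U \<inter> {w. 1 - w * S w \<noteq> 0}"
    have "continuous_on U S" unfolding S_def[abs_def] U_def by (intro continuous_intros) auto
    then have "continuous_on U (\<lambda>w. 1 - w * S w)" by (intro continuous_intros)
    then have "open (U \<inter> (\<lambda>w. 1 - w * S w) -` (- {0}))"
      using opU by (intro continuous_open_preimage) auto
    then have opV: "open V" by (simp add: V_def vimage_def)
    have V0: "0 \<in> V" using U0 by (simp add: V_def)
    have "((\<lambda>w. w / (1 - w * S w)) has_field_derivative 1) (at 0)"
      using dS by (auto intro!: derivative_eq_intros simp: S0)
    then have "(?F has_field_derivative 1) (at 0)"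
    proof (rule has_field_derivative_transform_within_open[OF _ opV V0])
      show "w / (1 - w * S w) = ?F w" if "w \<in> V" for w
      proof (cases "w = 0")
        case True
        then show ?thesis by (simp add: local_form_def RN sinverse_def)
      next
        case False
        have "w \<in> U" "1 - w * S w \<noteq> 0" using that by (auto simp: V_def)
        moreover have "1 / w - S w = (1 - w * S w) / w" using False by (simp add: field_simps)
        moreover have "1 / w \<notin> Z" "R (1 / w) = 1 / w - S w"
          using e R_inv[OF \<open>w \<in> U\<close> False] by simp_all
        ultimately show ?thesis using False by (simp add: local_form_def RN rat_map_Some sinverse_def)
      qed
    qed
    then show ?thesis by (intro exI[of _ 1]) simp
  qed
  then obtain d where "d \<noteq> 0" "(?F has_field_derivative d) (at 0)" by blast
  then show ?thesis using DERIV_unique[of ?F d 0 0] by (auto simp: critical_points_def)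
qed

lemma rat_map_in_CRR:
  assumes "X = complex_of_real ` X'"
  shows "rat_map e X Z \<in> CRR (card Z + e) X'"
proof -
  have "z \<in> critical_points (rat_map e X Z) \<longleftrightarrow> z \<in> sreal ` X'" for z
    using critical_points_finite critical_points_infinite assms by (cases z) auto
  then have "critical_points (rat_map e X Z) = sreal ` X'" by blast
  moreover have "qr \<noteq> 0" using degree_qr degree_Q card_Z_pos by auto
  ultimately show ?thesis
    using coprime_pr_qr max_degree degree_pr degree_qr unfolding CRR_def rat_map_def
    by (intro CollectI conjI exI[of _ pr] exI[of _ qr]) simp_all
qed

lemma R_real: "w \<in> \<real> \<Longrightarrow> R w \<in> \<real>"
  using R_cnj Reals_cnj_iff by metis

lemma poles_rat_map: "poles (rat_map e X Z) = Some ` Z \<union> (if e = 1 then {None} else {})"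
proof -
  have "z \<in> poles (rat_map e X Z) \<longleftrightarrow> z \<in> Some ` Z \<union> (if e = 1 then {None} else {})" for z
    by (cases z) (auto simp: poles_def rat_map_Some rat_map_None)
  then show ?thesis by blast
qed

end

section \<open>The vector field of the superposition\<close>

lemma primitive_on_log_prod:
  assumes "\<And>i. i \<in> I \<Longrightarrow> primitive_on t (u i) (\<lambda>s. u i s * d i s)"
  shows "primitive_on t (\<lambda>s. \<Prod>i\<in>I. u i s) (\<lambda>s. (\<Prod>i\<in>I. u i s) * (\<Sum>i\<in>I. d i s))"
  using assms
proof (induction I rule: infinite_finite_induct)
  case (insert i I)
  have "primitive_on t (\<lambda>s. u i s * (\<Prod>i\<in>I. u i s))
     (\<lambda>s. (u i s * d i s) * (\<Prod>i\<in>I. u i s) + u i s * ((\<Prod>i\<in>I. u i s) * (\<Sum>i\<in>I. d i s)))"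
    using insert by (intro primitive_on_mult) auto
  then show ?case
    by (rule primitive_on_cong) (use insert.hyps in \<open>auto simp: algebra_simps\<close>)
qed (auto intro: primitive_on_const)

text \<open>With integrands written as the function times its logarithmic derivative, products add
  and inverses negate. This is how the quotient of products \<open>residue_at\<close> is
  differentiated.\<close>

lemma primitive_on_log_inverse:
  assumes "primitive_on t u (\<lambda>s. u s * d s)" "\<And>s. s \<in> {0..t} \<Longrightarrow> u s \<noteq> 0"
  shows "primitive_on t (\<lambda>s. inverse (u s)) (\<lambda>s. inverse (u s) * (- d s))"
  by (rule primitive_on_cong[OF primitive_on_inverse[OF assms]])
    (use assms(2) in \<open>auto simp: field_simps power2_eq_square\<close>)

lemma primitive_on_log_mult:
  assumes "primitive_on t u (\<lambda>s. u s * d s)" "primitive_on t v (\<lambda>s. v s * c s)"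
  shows "primitive_on t (\<lambda>s. u s * v s) (\<lambda>s. (u s * v s) * (d s + c s))"
  by (rule primitive_on_cong[OF primitive_on_mult[OF assms]]) (auto simp: algebra_simps)

lemma primitive_on_constant: "primitive_on t u (\<lambda>_. 0) \<Longrightarrow> s \<in> {0..t} \<Longrightarrow> u s = u 0"
  using primitive_onD(2)[of t u "\<lambda>_. 0" s] by simp

text \<open>This carries identities to a final time at which integrability of the rates is not yet
  known.\<close>

lemma continuous_on_eq_right_end:
  fixes f h :: "real \<Rightarrow> complex"
  assumes r: "0 < r" and f: "continuous_on {0..r} f" and h: "continuous_on {0..r} h"
    and eq: "\<And>s. s \<in> {0..<r} \<Longrightarrow> f s = h s"
  shows "f r = h r"
proof -
  have cl: "closure {0..<r} = {0..r}" using r by simp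
  have "continuous_on (closure {0..<r}) (\<lambda>s. f s - h s)"
    unfolding cl by (intro continuous_on_diff f h)
  then have "f r - h r = 0"
    by (rule continuous_constant_on_closure[of "{0..<r}"]) (use eq r in \<open>auto simp: cl\<close>)
  then show ?thesis by simp
qed

definition loewner_field ::
  "nat set \<Rightarrow> (nat \<Rightarrow> complex) \<Rightarrow> (nat \<Rightarrow> complex) \<Rightarrow> complex \<Rightarrow> complex" where
  "loewner_field J \<nu> x w = (\<Sum>j\<in>J. 2 * \<nu> j / (w - x j))"

definition driving_field ::
  "nat set \<Rightarrow> nat set \<Rightarrow> (nat \<Rightarrow> complex) \<Rightarrow> (nat \<Rightarrow> complex) \<Rightarrow> (nat \<Rightarrow> complex) \<Rightarrow> nat \<Rightarrow> complex" where
  "driving_field J F \<nu> x z j =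
     \<nu> j * ((\<Sum>k\<in>J - {j}. 2 / (x j - x k)) - (\<Sum>k\<in>F. 4 / (x j - z k))) +
     (\<Sum>k\<in>J - {j}. 2 * \<nu> k / (x j - x k))"

definition defect ::
  "nat set \<Rightarrow> nat set \<Rightarrow> (nat \<Rightarrow> complex) \<Rightarrow> (nat \<Rightarrow> complex) \<Rightarrow> nat \<Rightarrow> complex" where
  "defect J F x z k = (\<Sum>j\<in>J. 1 / (z k - x j)) - (\<Sum>l\<in>F - {k}. 2 / (z k - z l))"

text \<open>The coefficient of the double pole of \<open>P / Q^2\<close> at \<open>z k\<close>, that
  is, \<open>pole_coeff\<close> for labelled points. The antiderivative \<open>R\<close> has minus
  this number as its residue there.\<close>

definition residue_at ::
  "nat set \<Rightarrow> nat set \<Rightarrow> (nat \<Rightarrow> complex) \<Rightarrow> (nat \<Rightarrow> complex) \<Rightarrow> nat \<Rightarrow> complex" where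
  "residue_at J F x z k = (\<Prod>j\<in>J. z k - x j) / (\<Prod>l\<in>F - {k}. z k - z l)\<^sup>2"

text \<open>The factor \<open>w - v\<close> turns the difference of two trajectories into the
  solution of a linear equation.\<close>

lemma loewner_field_diff:
  assumes "\<And>j. j \<in> J \<Longrightarrow> w \<noteq> x j" "\<And>j. j \<in> J \<Longrightarrow> v \<noteq> x j"
  shows "loewner_field J \<nu> x w - loewner_field J \<nu> x v =
    - (\<Sum>j\<in>J. 2 * \<nu> j / ((w - x j) * (v - x j))) * (w - v)"
  unfolding loewner_field_def sum_subtractf[symmetric] sum_negf[symmetric] sum_distrib_right
proof (rule sum.cong[OF refl])
  fix j assume "j \<in> J"
  then have "w - x j \<noteq> 0" "v - x j \<noteq> 0" using assms by auto
  then have "2 * \<nu> j / (w - x j) - 2 * \<nu> j / (v - x j) =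
      (2 * \<nu> j * (v - x j) - 2 * \<nu> j * (w - x j)) / ((w - x j) * (v - x j))"
    by (subst diff_frac_eq) auto
  also have "2 * \<nu> j * (v - x j) - 2 * \<nu> j * (w - x j) = - (2 * \<nu> j) * (w - v)"
    by (simp add: algebra_simps)
  finally show "2 * \<nu> j / (w - x j) - 2 * \<nu> j / (v - x j) =
      - (2 * \<nu> j / ((w - x j) * (v - x j))) * (w - v)"
    by simp
qed

section \<open>Algebraic identities for a single configuration of points\<close>

context
  fixes J F :: "nat set" and x z \<nu> :: "nat \<Rightarrow> complex"
  assumes finJ: "finite J" and finF: "finite F"
    and xx: "inj_on x J" and zz: "inj_on z F" and zx: "\<And>j k. j \<in> J \<Longrightarrow> k \<in> F \<Longrightarrow> z k \<noteq> x j"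
begin

text \<open>The velocity of \<open>x j\<close> under the flow of index \<open>i\<close> at unit rate.\<close>

definition "unit_velocity i j =
  (if i = j then (\<Sum>k\<in>J - {i}. 2 / (x i - x k)) - (\<Sum>k\<in>F. 4 / (x i - z k)) else 2 / (x j - x i))"

text \<open>Since all velocities are linear in the rates, the identities below need checking only
  when a single index \<open>i\<close> moves, at unit rate.\<close>

lemma driving_field_sum:
  assumes "j \<in> J"
  shows "driving_field J F \<nu> x z j = (\<Sum>i\<in>J. \<nu> i * unit_velocity i j)"
proof -
  have "(\<Sum>i\<in>J. \<nu> i * unit_velocity i j) =
      \<nu> j * unit_velocity j j + (\<Sum>i\<in>J - {j}. \<nu> i * unit_velocity i j)"
    using finJ assms by (rule sum.remove)
  also have "(\<Sum>i\<in>J - {j}. \<nu> i * unit_velocity i j) = (\<Sum>i\<in>J - {j}. 2 * \<nu> i / (x j - x i))"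
    by (intro sum.cong) (auto simp: unit_velocity_def)
  finally show ?thesis by (simp add: driving_field_def unit_velocity_def)
qed

lemma loewner_field_sum: "loewner_field J \<nu> x w = (\<Sum>i\<in>J. \<nu> i * (2 / (w - x i)))"
  by (simp add: loewner_field_def mult.commute)

lemma unit_split:
  assumes k: "k \<in> F" and i: "i \<in> J"
  shows "unit_velocity i i = - (\<Sum>j\<in>J - {i}. 2 / (x j - x i)) +
    (\<Sum>l\<in>F - {k}. 4 / (z l - x i)) + 4 / (z k - x i)"
proof -
  have "(\<Sum>l\<in>F. 4 / (x i - z l)) = 4 / (x i - z k) + (\<Sum>l\<in>F - {k}. 4 / (x i - z l))"
    using finF k by (rule sum.remove)
  moreover have "(\<Sum>j\<in>J - {i}. 2 / (x i - x j)) = - (\<Sum>j\<in>J - {i}. 2 / (x j - x i))"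
    unfolding sum_negf[symmetric] by (intro sum.cong) (auto simp: divide_simps)
  moreover have "(\<Sum>l\<in>F - {k}. 4 / (x i - z l)) = - (\<Sum>l\<in>F - {k}. 4 / (z l - x i))"
    unfolding sum_negf[symmetric] by (intro sum.cong) (auto simp: divide_simps)
  moreover have "4 / (x i - z k) = - (4 / (z k - x i))" by (auto simp: divide_simps)
  ultimately show ?thesis by (simp add: unit_velocity_def)
qed

lemma unit_velocity_ratio:
  assumes k: "k \<in> F" and i: "i \<in> J" and j: "j \<in> J" and "i \<noteq> j"
  shows "(2 / (z k - x i) - unit_velocity i j) / (z k - x j) = - (2 / (x j - x i)) / (z k - x i)"
proof -
  have "x i \<noteq> x j" using xx i j \<open>i \<noteq> j\<close> by (auto dest: inj_onD)
  moreover have "z k \<noteq> x i" "z k \<noteq> x j" using zx k i j by auto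
  ultimately show ?thesis using \<open>i \<noteq> j\<close> by (simp add: unit_velocity_def divide_simps)
qed

lemma unit_pole_ratio:
  assumes k: "k \<in> F" and i: "i \<in> J" and l: "l \<in> F - {k}"
  shows "(2 / (z k - x i) - 2 / (z l - x i)) / (z k - z l) = - (2 / (z l - x i)) / (z k - x i)"
proof -
  have "z k \<noteq> z l" using zz k l by (auto dest: inj_onD)
  moreover have "z k \<noteq> x i" "z l \<noteq> x i" using zx k i l by auto
  ultimately show ?thesis by (simp add: divide_simps)
qed

lemma partial_fraction_split:
  fixes a b c :: complex
  assumes "a \<noteq> c" "b \<noteq> c" "a \<noteq> b"
  shows "1 / ((b - c) * (a - b)) = (1 / (a - b) + 1 / (b - c)) / (a - c)"
  using assms by (simp add: divide_simps)

text \<open>This is where the masses 2 and -4 matter. The terms with \<open>j \<noteq> i\<close> and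
  \<open>l \<noteq> k\<close> cancel against the two sums inside \<open>unit_velocity i i\<close>;
  there remain \<open>2 / a^2\<close> from the motion of \<open>z k\<close> and
  \<open>- 4 / a^2\<close> from the repulsion by \<open>z k\<close>, where
  \<open>a = z k - x i\<close>.\<close>

lemma log_deriv_unit:
  assumes k: "k \<in> F" and i: "i \<in> J"
  shows "(\<Sum>j\<in>J. (2 / (z k - x i) - unit_velocity i j) / (z k - x j)) -
    2 * (\<Sum>l\<in>F - {k}. (2 / (z k - x i) - 2 / (z l - x i)) / (z k - z l)) = - 2 / (z k - x i)\<^sup>2"
proof -
  let ?a = "z k - x i"
  have a: "?a \<noteq> 0" using zx k i by auto
  have "(\<Sum>j\<in>J - {i}. (2 / ?a - unit_velocity i j) / (z k - x j)) =
      (\<Sum>j\<in>J - {i}. - (2 / (x j - x i)) / ?a)"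
    by (intro sum.cong refl unit_velocity_ratio[OF k i]) auto
  also have "\<dots> = - (\<Sum>j\<in>J - {i}. 2 / (x j - x i)) / ?a"
    by (simp only: sum_divide_distrib[symmetric] sum_negf)
  finally have 1: "(\<Sum>j\<in>J. (2 / ?a - unit_velocity i j) / (z k - x j)) =
      (2 / ?a - unit_velocity i i) / ?a + - (\<Sum>j\<in>J - {i}. 2 / (x j - x i)) / ?a"
    by (simp only: sum.remove[OF finJ i])
  have "(\<Sum>l\<in>F - {k}. (2 / ?a - 2 / (z l - x i)) / (z k - z l)) =
      (\<Sum>l\<in>F - {k}. - (1/2) * (4 / (z l - x i)) / ?a)"
    using unit_pole_ratio[OF k i] by (intro sum.cong refl) simp
  also have "\<dots> = - (1/2) * (\<Sum>l\<in>F - {k}. 4 / (z l - x i)) / ?a"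
    by (simp only: sum_divide_distrib[symmetric] sum_distrib_left[symmetric])
  finally have "2 * (\<Sum>l\<in>F - {k}. (2 / ?a - 2 / (z l - x i)) / (z k - z l)) =
      2 * (- (1/2) * (\<Sum>l\<in>F - {k}. 4 / (z l - x i)) / ?a)"
    by (rule arg_cong)
  moreover have "2 * (- (1/2) * S / c) = - S / c" for S c :: complex by simp
  ultimately have 2: "2 * (\<Sum>l\<in>F - {k}. (2 / ?a - 2 / (z l - x i)) / (z k - z l)) =
      - (\<Sum>l\<in>F - {k}. 4 / (z l - x i)) / ?a"
    by metis
  have final: "(2 / c - (- r + s + 4 / c)) / c + - r / c - - s / c = - 2 / c\<^sup>2"
    if "c \<noteq> 0" for c r s :: complex
    using that by (simp add: field_simps power2_eq_square)
  show ?thesis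
    unfolding 1 2 unit_split[OF k i] using final[OF a] .
qed

text \<open>Partial fractions split every off-diagonal term into \<open>2 / a^2\<close> times a term
  of the defect, up to sign, and a remainder without \<open>z k\<close> apart from the factor
  \<open>1 / a^2\<close>, where \<open>a = z k - x i\<close>. The remainders cancel against the sums
  inside \<open>unit_velocity i i\<close>.\<close>

lemma defect_deriv_unit:
  assumes k: "k \<in> F" and i: "i \<in> J"
  shows "- (\<Sum>j\<in>J. (2 / (z k - x i) - unit_velocity i j) / (z k - x j)\<^sup>2) +
    2 * (\<Sum>l\<in>F - {k}. (2 / (z k - x i) - 2 / (z l - x i)) / (z k - z l)\<^sup>2) =
    2 / (z k - x i)\<^sup>2 * defect J F x z k"
proof -
  let ?a = "z k - x i"
  have a: "?a \<noteq> 0" using zx k i by auto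
  define s1 where "s1 = (\<Sum>j\<in>J - {i}. 1 / (z k - x j))"
  define s2 where "s2 = (\<Sum>j\<in>J - {i}. 2 / (x j - x i))"
  define s3 where "s3 = (\<Sum>l\<in>F - {k}. 2 / (z k - z l))"
  define s4 where "s4 = (\<Sum>l\<in>F - {k}. 4 / (z l - x i))"
  have j: "(2 / ?a - unit_velocity i j) / (z k - x j)\<^sup>2 =
      - (2 / ?a\<^sup>2) * (1 / (z k - x j)) - (2 / (x j - x i)) / ?a\<^sup>2" if "j \<in> J - {i}" for j
  proof -
    have "x i \<noteq> x j" using xx i that by (auto dest: inj_onD)
    moreover have "z k \<noteq> x i" "z k \<noteq> x j" using zx k i that by auto
    ultimately have pf: "1 / ((x j - x i) * (z k - x j)) = (1 / (z k - x j) + 1 / (x j - x i)) / ?a"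
      by (intro partial_fraction_split) auto
    have "(2 / ?a - unit_velocity i j) / (z k - x j)\<^sup>2 =
        (2 / ?a - unit_velocity i j) / (z k - x j) / (z k - x j)"
      by (simp add: power2_eq_square)
    also have "\<dots> = - (2 / (x j - x i)) / ?a / (z k - x j)"
      using unit_velocity_ratio[OF k i, of j] that by auto
    also have "\<dots> = - (2 / ?a) * (1 / ((x j - x i) * (z k - x j)))" by simp
    also have "\<dots> = - (2 / ?a\<^sup>2) * (1 / (z k - x j)) - (2 / (x j - x i)) / ?a\<^sup>2"
      unfolding pf by (simp add: power2_eq_square add_divide_distrib algebra_simps)
    finally show ?thesis .
  qed
  have l: "2 * ((2 / ?a - 2 / (z l - x i)) / (z k - z l)\<^sup>2) =
      - (2 / ?a\<^sup>2) * (2 / (z k - z l)) - (4 / (z l - x i)) / ?a\<^sup>2" if "l \<in> F - {k}" for l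
  proof -
    have "z k \<noteq> z l" using zz k that by (auto dest: inj_onD)
    moreover have "z k \<noteq> x i" "z l \<noteq> x i" using zx k i that by auto
    ultimately have pf: "1 / ((z l - x i) * (z k - z l)) = (1 / (z k - z l) + 1 / (z l - x i)) / ?a"
      by (intro partial_fraction_split) auto
    have "2 * ((2 / ?a - 2 / (z l - x i)) / (z k - z l)\<^sup>2) =
        2 * ((2 / ?a - 2 / (z l - x i)) / (z k - z l) / (z k - z l))"
      by (simp add: power2_eq_square)
    also have "\<dots> = 2 * (- (2 / (z l - x i)) / ?a / (z k - z l))"
      unfolding unit_pole_ratio[OF k i that] ..
    also have "\<dots> = - (4 / ?a) * (1 / ((z l - x i) * (z k - z l)))" by simp
    also have "\<dots> = - (2 / ?a\<^sup>2) * (2 / (z k - z l)) - (4 / (z l - x i)) / ?a\<^sup>2"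
      unfolding pf by (simp add: power2_eq_square add_divide_distrib algebra_simps)
    finally show ?thesis .
  qed
  have 1: "(\<Sum>j\<in>J. (2 / ?a - unit_velocity i j) / (z k - x j)\<^sup>2) =
      (2 / ?a - unit_velocity i i) / ?a\<^sup>2 + (- (2 / ?a\<^sup>2) * s1 - s2 / ?a\<^sup>2)"
    unfolding sum.remove[OF finJ i] s1_def s2_def sum_distrib_left sum_divide_distrib sum_subtractf[symmetric]
    using j by (intro arg_cong2[where f = "(+)"] refl sum.cong) auto
  have 2: "2 * (\<Sum>l\<in>F - {k}. (2 / ?a - 2 / (z l - x i)) / (z k - z l)\<^sup>2) =
      - (2 / ?a\<^sup>2) * s3 - s4 / ?a\<^sup>2"
    unfolding s3_def s4_def sum_distrib_left sum_divide_distrib sum_subtractf[symmetric]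
    using l by (intro sum.cong) auto
  have 3: "defect J F x z k = 1 / ?a + s1 - s3"
    unfolding defect_def s1_def s3_def by (simp only: sum.remove[OF finJ i])
  have 4: "unit_velocity i i = - s2 + s4 + 4 / ?a"
    unfolding s2_def s4_def by (rule unit_split[OF k i])
  have final: "- ((2 / c - (- r2 + r4 + 4 / c)) / c\<^sup>2 + (- (2 / c\<^sup>2) * r1 - r2 / c\<^sup>2)) +
      (- (2 / c\<^sup>2) * r3 - r4 / c\<^sup>2) = 2 / c\<^sup>2 * (1 / c + r1 - r3)"
    if "c \<noteq> 0" for c r1 r2 r3 r4 :: complex
    using that by (simp add: field_simps power2_eq_square)
  show ?thesis
    unfolding 1 2 3 4 using final[OF a] .
qed

lemma loewner_minus_driving:
  "j \<in> J \<Longrightarrow> loewner_field J \<nu> x w - driving_field J F \<nu> x z j =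
    (\<Sum>i\<in>J. \<nu> i * (2 / (w - x i) - unit_velocity i j))"
  unfolding loewner_field_sum driving_field_sum by (simp add: sum_subtractf[symmetric] right_diff_distrib)

lemma loewner_minus_loewner:
  "loewner_field J \<nu> x w - loewner_field J \<nu> x v = (\<Sum>i\<in>J. \<nu> i * (2 / (w - x i) - 2 / (v - x i)))"
  unfolding loewner_field_sum by (simp add: sum_subtractf[symmetric] right_diff_distrib)

lemma log_deriv_residue:
  assumes k: "k \<in> F"
  shows "(\<Sum>j\<in>J. (loewner_field J \<nu> x (z k) - driving_field J F \<nu> x z j) / (z k - x j)) -
    2 * (\<Sum>l\<in>F - {k}. (loewner_field J \<nu> x (z k) - loewner_field J \<nu> x (z l)) / (z k - z l)) =
    - (\<Sum>i\<in>J. 2 * \<nu> i / (z k - x i)\<^sup>2)"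
proof -
  have 1: "(\<Sum>j\<in>J. (loewner_field J \<nu> x (z k) - driving_field J F \<nu> x z j) / (z k - x j)) =
     (\<Sum>i\<in>J. \<nu> i * (\<Sum>j\<in>J. (2 / (z k - x i) - unit_velocity i j) / (z k - x j)))"
    unfolding sum_distrib_left
    by (subst sum.swap) (auto intro!: sum.cong simp: loewner_minus_driving sum_divide_distrib)
  have 2: "(\<Sum>l\<in>F - {k}. (loewner_field J \<nu> x (z k) - loewner_field J \<nu> x (z l)) / (z k - z l)) =
     (\<Sum>i\<in>J. \<nu> i * (\<Sum>l\<in>F - {k}. (2 / (z k - x i) - 2 / (z l - x i)) / (z k - z l)))"
    unfolding sum_distrib_left
    by (subst sum.swap) (auto intro!: sum.cong simp: loewner_minus_loewner sum_divide_distrib)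
  show ?thesis
    unfolding 1 2 sum_distrib_left[of 2] sum_subtractf[symmetric] sum_negf[symmetric]
  proof (rule sum.cong[OF refl])
    fix i assume i: "i \<in> J"
    have "\<nu> i * (\<Sum>j\<in>J. (2 / (z k - x i) - unit_velocity i j) / (z k - x j)) -
      2 * (\<nu> i * (\<Sum>l\<in>F - {k}. (2 / (z k - x i) - 2 / (z l - x i)) / (z k - z l))) =
      \<nu> i * ((\<Sum>j\<in>J. (2 / (z k - x i) - unit_velocity i j) / (z k - x j)) -
      2 * (\<Sum>l\<in>F - {k}. (2 / (z k - x i) - 2 / (z l - x i)) / (z k - z l)))"
      by (simp only: right_diff_distrib mult.left_commute)
    also have "\<dots> = - (2 * \<nu> i / (z k - x i)\<^sup>2)"
      unfolding log_deriv_unit[OF k i] by simp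
    finally show "\<nu> i * (\<Sum>j\<in>J. (2 / (z k - x i) - unit_velocity i j) / (z k - x j)) -
      2 * (\<nu> i * (\<Sum>l\<in>F - {k}. (2 / (z k - x i) - 2 / (z l - x i)) / (z k - z l))) =
      - (2 * \<nu> i / (z k - x i)\<^sup>2)" .
  qed
qed

lemma deriv_defect:
  assumes k: "k \<in> F"
  shows "- (\<Sum>j\<in>J. (loewner_field J \<nu> x (z k) - driving_field J F \<nu> x z j) / (z k - x j)\<^sup>2) +
    2 * (\<Sum>l\<in>F - {k}. (loewner_field J \<nu> x (z k) - loewner_field J \<nu> x (z l)) / (z k - z l)\<^sup>2) =
    (\<Sum>i\<in>J. 2 * \<nu> i / (z k - x i)\<^sup>2) * defect J F x z k"
proof -
  have 1: "(\<Sum>j\<in>J. (loewner_field J \<nu> x (z k) - driving_field J F \<nu> x z j) / (z k - x j)\<^sup>2) =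
     (\<Sum>i\<in>J. \<nu> i * (\<Sum>j\<in>J. (2 / (z k - x i) - unit_velocity i j) / (z k - x j)\<^sup>2))"
    unfolding sum_distrib_left
    by (subst sum.swap) (auto intro!: sum.cong simp: loewner_minus_driving sum_divide_distrib)
  have 2: "(\<Sum>l\<in>F - {k}. (loewner_field J \<nu> x (z k) - loewner_field J \<nu> x (z l)) / (z k - z l)\<^sup>2) =
     (\<Sum>i\<in>J. \<nu> i * (\<Sum>l\<in>F - {k}. (2 / (z k - x i) - 2 / (z l - x i)) / (z k - z l)\<^sup>2))"
    unfolding sum_distrib_left
    by (subst sum.swap) (auto intro!: sum.cong simp: loewner_minus_loewner sum_divide_distrib)
  show ?thesis
    unfolding 1 2 sum_distrib_left[of 2] sum_negf[symmetric] sum.distrib[symmetric] sum_distrib_right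
  proof (rule sum.cong[OF refl])
    fix i assume i: "i \<in> J"
    have "- (\<nu> i * (\<Sum>j\<in>J. (2 / (z k - x i) - unit_velocity i j) / (z k - x j)\<^sup>2)) +
      2 * (\<nu> i * (\<Sum>l\<in>F - {k}. (2 / (z k - x i) - 2 / (z l - x i)) / (z k - z l)\<^sup>2)) =
      \<nu> i * (- (\<Sum>j\<in>J. (2 / (z k - x i) - unit_velocity i j) / (z k - x j)\<^sup>2) +
      2 * (\<Sum>l\<in>F - {k}. (2 / (z k - x i) - 2 / (z l - x i)) / (z k - z l)\<^sup>2))"
      by (simp only: distrib_left mult.left_commute mult_minus_right)
    also have "\<dots> = 2 * \<nu> i / (z k - x i)\<^sup>2 * defect J F x z k"
      unfolding defect_deriv_unit[OF k i] by simp
    finally show "- (\<nu> i * (\<Sum>j\<in>J. (2 / (z k - x i) - unit_velocity i j) / (z k - x j)\<^sup>2)) +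
      2 * (\<nu> i * (\<Sum>l\<in>F - {k}. (2 / (z k - x i) - 2 / (z l - x i)) / (z k - z l)\<^sup>2)) =
      2 * \<nu> i / (z k - x i)\<^sup>2 * defect J F x z k" .
  qed
qed

text \<open>The left side is the logarithmic derivative of \<open>A / (w - z k)\<close>. Its factor
  \<open>w - z k\<close> removes the pole at \<open>z k\<close>, so only poles in \<open>w\<close>
  at the driving points survive, where the contributions of all \<open>k\<close> can be added
  up.\<close>

lemma deriv_polar_part:
  assumes k: "k \<in> F" and w: "w \<noteq> z k" "\<And>j. j \<in> J \<Longrightarrow> w \<noteq> x j"
  shows "(- (\<Sum>i\<in>J. 2 * \<nu> i / (z k - x i)\<^sup>2)) -
    (loewner_field J \<nu> x w - loewner_field J \<nu> x (z k)) / (w - z k) =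
    - (w - z k) * (\<Sum>i\<in>J. 2 * \<nu> i / ((w - x i) * (z k - x i)\<^sup>2))"
proof -
  have *: "(loewner_field J \<nu> x w - loewner_field J \<nu> x (z k)) / (w - z k) =
    - (\<Sum>i\<in>J. 2 * \<nu> i / ((w - x i) * (z k - x i)))"
    using loewner_field_diff[of J w x "z k" \<nu>] w zx k by simp
  show ?thesis
    unfolding * sum_distrib_left sum_negf[symmetric] sum_subtractf[symmetric]
  proof (rule sum.cong[OF refl])
    fix i assume i: "i \<in> J"
    have "w \<noteq> x i" "z k \<noteq> x i" using w zx k i by auto
    then show "- (2 * \<nu> i / (z k - x i)\<^sup>2) - - (2 * \<nu> i / ((w - x i) * (z k - x i))) =
      - (w - z k) * (2 * \<nu> i / ((w - x i) * (z k - x i)\<^sup>2))"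
      by (simp add: divide_simps power2_eq_square) (simp add: algebra_simps)
  qed
qed

end

section \<open>Conservation along the flow\<close>

lemma image_minus_point: "inj_on z F \<Longrightarrow> k \<in> F \<Longrightarrow> z ` F - {z k} = z ` (F - {k})"
  by (auto dest: inj_onD)

lemma pole_coeff_image:
  assumes "inj_on x J" "inj_on z F" "k \<in> F"
  shows "pole_coeff (x ` J) (z ` F) (z k) = residue_at J F x z k"
  using assms inj_on_subset[OF assms(2), of "F - {k}"]
  by (simp add: pole_coeff_def residue_at_def image_minus_point prod.reindex)

lemma rat_val_image:
  assumes "inj_on x J" "inj_on z F"
  shows "rat_val e (x ` J) (z ` F) w = of_nat e * w - (\<Sum>k\<in>F. residue_at J F x z k / (w - z k))"
  using assms by (simp add: rat_val_def sum.reindex pole_coeff_image)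

text \<open>In this form the value of the numerator along a trajectory is visibly continuous in
  time.\<close>

lemma num_poly_image:
  assumes "inj_on x J" "inj_on z F"
  shows "poly (num_poly e (x ` J) (z ` F)) w = of_nat e * (w * (\<Prod>k\<in>F. w - z k)) -
    (\<Sum>k\<in>F. residue_at J F x z k * (\<Prod>l\<in>F - {k}. w - z l))"
proof -
  have "(\<Prod>b\<in>z ` F - {z k}. w - b) = (\<Prod>l\<in>F - {k}. w - z l)" if "k \<in> F" for k
    using inj_on_subset[OF assms(2), of "F - {k}"] by (simp add: image_minus_point assms(2) that prod.reindex)
  then show ?thesis
    using assms
    by (simp add: num_poly_def poly_sum poly_root_poly sum.reindex prod.reindex pole_coeff_image)
qed

lemma defect_image:
  assumes "inj_on x J" "inj_on z F" "k \<in> F"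
  shows "(\<Sum>a\<in>x ` J. 1 / (z k - a)) = (\<Sum>b\<in>z ` F - {z k}. 2 / (z k - b)) \<longleftrightarrow> defect J F x z k = 0"
  using assms inj_on_subset[OF assms(2), of "F - {k}"]
  by (simp add: defect_def image_minus_point sum.reindex)

lemma real_stationary_image:
  fixes x :: "nat \<Rightarrow> real"
  assumes J: "finite J" and F: "finite F" "F \<noteq> {}" and e: "e \<le> 1" "card J + 2 = 2 * (card F + e)"
    and inj: "inj_on x J" "inj_on z F"
    and zx: "\<And>j k. j \<in> J \<Longrightarrow> k \<in> F \<Longrightarrow> z k \<noteq> of_real (x j)"
    and defect: "\<And>k. k \<in> F \<Longrightarrow> defect J F (\<lambda>j. of_real (x j)) z k = 0"
    and sym: "\<And>k. k \<in> F \<Longrightarrow> \<exists>l\<in>F. z l = cnj (z k)"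
  shows "real_stationary e ((\<lambda>j. complex_of_real (x j)) ` J) (z ` F)"
proof
  have inj': "inj_on (\<lambda>j. complex_of_real (x j)) J" using inj(1) by (auto simp: inj_on_def)
  show "(\<Sum>a\<in>(\<lambda>j. complex_of_real (x j)) ` J. 1 / (b - a)) = (\<Sum>c\<in>z ` F - {b}. 2 / (b - c))"
    if b: "b \<in> z ` F" for b
  proof -
    obtain k where "k \<in> F" "b = z k" using b by blast
    then show ?thesis using defect_image[OF inj' inj(2)] defect by blast
  qed
  show "cnj b \<in> z ` F" if b: "b \<in> z ` F" for b
  proof -
    obtain k where "k \<in> F" "b = z k" using b by blast
    then obtain l where "l \<in> F" "z l = cnj b" using sym by blast
    then show ?thesis by (metis imageI)
  qed
  show "(\<lambda>j. complex_of_real (x j)) ` J \<inter> z ` F = {}" using zx by fastforce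
  show "card ((\<lambda>j. complex_of_real (x j)) ` J) + 2 = 2 * (card (z ` F) + e)"
    using e card_image[OF inj'] card_image[OF inj(2)] by simp
qed (use J F e in auto)

text \<open>The second clause has to be stated: at a collision the fraction in the field takes the
  default value 0, so the integral equation would not notice it.\<close>

definition trajectory :: "nat set \<Rightarrow> (nat \<Rightarrow> real \<Rightarrow> real) \<Rightarrow> (nat \<Rightarrow> real \<Rightarrow> real) \<Rightarrow> real \<Rightarrow>
    (real \<Rightarrow> complex) \<Rightarrow> bool" where
  "trajectory J \<nu> x t u \<longleftrightarrow>
     primitive_on t u (\<lambda>s. loewner_field J (\<lambda>j. of_real (\<nu> j s)) (\<lambda>j. of_real (x j s)) (u s)) \<and>
     (\<forall>s\<in>{0..t}. \<forall>j\<in>J. u s \<noteq> of_real (x j s))"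

lemma trajectory_mono: "trajectory J \<nu> x t u \<Longrightarrow> s \<le> t \<Longrightarrow> trajectory J \<nu> x s u"
  unfolding trajectory_def by (auto intro: primitive_on_mono)

lemma trajectory_continuous: "trajectory J \<nu> x t u \<Longrightarrow> continuous_on {0..t} u"
  unfolding trajectory_def by (auto intro: primitive_on_continuous)

lemma trajectory_cnj:
  assumes "trajectory J \<nu> x t u"
  shows "trajectory J \<nu> x t (\<lambda>s. cnj (u s))"
proof -
  have "primitive_on t (\<lambda>s. cnj (u s))
      (\<lambda>s. cnj (loewner_field J (\<lambda>j. of_real (\<nu> j s)) (\<lambda>j. of_real (x j s)) (u s)))"
    by (rule primitive_on_bounded_linear[OF assms[unfolded trajectory_def, THEN conjunct1] bounded_linear_cnj])
  moreover have "cnj (u s) \<noteq> of_real (x j s)" if "s \<in> {0..t}" "j \<in> J" for s j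
  proof -
    have "u s \<noteq> of_real (x j s)" using assms that unfolding trajectory_def by blast
    then show ?thesis using complex_cnj_cancel_iff[of "u s" "of_real (x j s)"] by simp
  qed
  ultimately show ?thesis by (simp add: trajectory_def loewner_field_def)
qed

text \<open>\<open>F\<close> labels the finite poles only; a pole at infinity is recorded by
  \<open>e\<close>. The rates are not assumed integrable, only the velocities of the points
  are.\<close>

locale flow =
  fixes e :: nat and J F :: "nat set" and \<nu> x :: "nat \<Rightarrow> real \<Rightarrow> real" and z :: "nat \<Rightarrow> real \<Rightarrow> complex"
    and t :: real
  assumes finJ: "finite J" and finF: "finite F" and F0: "F \<noteq> {}" and e1: "e \<le> 1"
    and card_eq: "card J + 2 = 2 * (card F + e)" and t0: "0 \<le> t"
    and inj_x: "\<And>s. s \<in> {0..t} \<Longrightarrow> inj_on (\<lambda>j. x j s) J"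
    and inj_z: "\<And>s. s \<in> {0..t} \<Longrightarrow> inj_on (\<lambda>k. z k s) F"
    and z_x: "\<And>s j k. s \<in> {0..t} \<Longrightarrow> j \<in> J \<Longrightarrow> k \<in> F \<Longrightarrow> z k s \<noteq> of_real (x j s)"
    and x_prim: "\<And>j. j \<in> J \<Longrightarrow> primitive_on t (\<lambda>s. of_real (x j s))
      (\<lambda>s. driving_field J F (\<lambda>j. of_real (\<nu> j s)) (\<lambda>j. of_real (x j s)) (\<lambda>k. z k s) j)"
    and z_prim: "\<And>k. k \<in> F \<Longrightarrow> primitive_on t (z k)
      (\<lambda>s. loewner_field J (\<lambda>j. of_real (\<nu> j s)) (\<lambda>j. of_real (x j s)) (z k s))"
    and defect_0: "\<And>k. k \<in> F \<Longrightarrow> defect J F (\<lambda>j. of_real (x j 0)) (\<lambda>k. z k 0) k = 0"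
    and sym_0: "\<And>k. k \<in> F \<Longrightarrow> \<exists>l\<in>F. z l 0 = cnj (z k 0)"
begin

abbreviation "cnu s \<equiv> \<lambda>j. complex_of_real (\<nu> j s)"
abbreviation "cx s \<equiv> \<lambda>j. complex_of_real (x j s)"
abbreviation "cz s \<equiv> \<lambda>k. z k s"
abbreviation "crit s \<equiv> cx s ` J"
abbreviation "pol s \<equiv> cz s ` F"

lemma flow_mono: "0 \<le> s \<Longrightarrow> s \<le> t \<Longrightarrow> flow e J F \<nu> x z s"
  using finJ finF F0 e1 card_eq inj_x inj_z z_x defect_0 sym_0
  by (intro flow.intro primitive_on_mono[OF x_prim] primitive_on_mono[OF z_prim]) auto

lemma inj_cx: "s \<in> {0..t} \<Longrightarrow> inj_on (cx s) J"
  using inj_x[of s] by (auto simp: inj_on_def)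

lemma cont_cx: "j \<in> J \<Longrightarrow> continuous_on {0..t} (\<lambda>s. complex_of_real (x j s))"
  using x_prim primitive_on_continuous by blast

lemma cont_z: "k \<in> F \<Longrightarrow> continuous_on {0..t} (z k)"
  using z_prim primitive_on_continuous by blast

lemma z_z: "s \<in> {0..t} \<Longrightarrow> k \<in> F \<Longrightarrow> l \<in> F - {k} \<Longrightarrow> z k s \<noteq> z l s"
  using inj_z[of s] by (auto dest: inj_onD)

lemma trajectory_z: "k \<in> F \<Longrightarrow> trajectory J \<nu> x t (z k)"
  unfolding trajectory_def using z_prim z_x by auto

lemma cont_residue:
  assumes "k \<in> F"
  shows "continuous_on {0..t} (\<lambda>s. residue_at J F (cx s) (cz s) k)"
  unfolding residue_at_def using assms finF z_z[OF _ assms]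
  by (intro continuous_intros cont_cx cont_z) auto

lemma cont_defect:
  assumes "k \<in> F"
  shows "continuous_on {0..t} (\<lambda>s. defect J F (cx s) (cz s) k)"
  unfolding defect_def using assms z_z[OF _ assms] z_x
  by (intro continuous_intros cont_cx cont_z) auto

lemma real_stationary_at:
  assumes s: "s \<in> {0..t}"
    and defect: "\<And>k. k \<in> F \<Longrightarrow> defect J F (cx s) (cz s) k = 0"
    and sym: "\<And>k. k \<in> F \<Longrightarrow> \<exists>l\<in>F. z l s = cnj (z k s)"
  shows "real_stationary e (crit s) (pol s)"
  by (rule real_stationary_image[OF finJ finF F0 e1 card_eq inj_x[OF s] inj_z[OF s] z_x[OF s] defect sym])

lemma stationary_0: "real_stationary e (crit 0) (pol 0)"
  using t0 by (intro real_stationary_at defect_0 sym_0) auto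

text \<open>Above the real line all summands of the imaginary part of the field have the same sign,
  so no cancellation is possible and each rate is bounded by a continuous factor times the norm of
  the field, which is integrable along a trajectory.\<close>

lemma integrable_of_Im_pos:
  assumes u: "trajectory J \<nu> x q u" and q: "0 \<le> q" "q \<le> t"
    and pos: "\<And>s. s \<in> {0..q} \<Longrightarrow> 0 < Im (u s)"
    and meas: "\<And>j. j \<in> J \<Longrightarrow> \<nu> j \<in> borel_measurable (lebesgue_on {0..})"
    and nonneg: "\<And>j s. j \<in> J \<Longrightarrow> 0 \<le> s \<Longrightarrow> 0 \<le> \<nu> j s"
    and j: "j \<in> J"
  shows "(\<lambda>s. complex_of_real (\<nu> j s)) absolutely_integrable_on {0..q}"
proof -
  let ?f = "\<lambda>s. loewner_field J (cnu s) (cx s) (u s)"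
  have f: "?f absolutely_integrable_on {0..q}" using u primitive_onD(1) unfolding trajectory_def by blast
  have cu: "continuous_on {0..q} u" using u by (rule trajectory_continuous)
  have "continuous_on {0..q} (\<lambda>s. (cmod (u s - of_real (x j s)))\<^sup>2 / (2 * Im (u s)))"
  proof (intro continuous_on_divide continuous_on_power continuous_on_norm continuous_on_diff
      continuous_on_mult continuous_on_const continuous_on_Im cu ballI)
    show "continuous_on {0..q} (\<lambda>s. complex_of_real (x j s))"
      by (rule continuous_on_subset[OF cont_cx[OF j]]) (use q in auto)
    show "2 * Im (u s) \<noteq> 0" if "s \<in> {0..q}" for s using pos[OF that] by simp
  qed
  then have "bounded ((\<lambda>s. (cmod (u s - of_real (x j s)))\<^sup>2 / (2 * Im (u s))) ` {0..q})"
    by (intro compact_imp_bounded compact_continuous_image) auto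
  then obtain B where "\<forall>y\<in>(\<lambda>s. (cmod (u s - of_real (x j s)))\<^sup>2 / (2 * Im (u s))) ` {0..q}. norm y \<le> B"
    unfolding bounded_iff by blast
  then have B: "(cmod (u s - of_real (x j s)))\<^sup>2 / (2 * Im (u s)) \<le> B" if "s \<in> {0..q}" for s
    using that by (auto intro: order_trans[OF abs_ge_self])
  have bound: "\<nu> j s \<le> B * norm (?f s)" if s: "s \<in> {0..q}" for s
  proof -
    have im: "Im (2 * of_real c / w) = - (2 * c * Im w / (cmod w)\<^sup>2)" for c w
      by (simp add: Im_divide cmod_power2)
    have "- Im (?f s) = (\<Sum>i\<in>J. 2 * \<nu> i s * Im (u s) / (cmod (u s - of_real (x i s)))\<^sup>2)"
      unfolding loewner_field_def Im_sum im sum_negf by simp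
    also have "\<dots> \<ge> 2 * \<nu> j s * Im (u s) / (cmod (u s - of_real (x j s)))\<^sup>2"
      using j finJ pos[OF s] nonneg s by (intro member_le_sum) auto
    finally have le: "2 * \<nu> j s * Im (u s) / (cmod (u s - of_real (x j s)))\<^sup>2 \<le> norm (?f s)"
      using abs_Im_le_cmod[of "?f s"] by linarith
    have "u s \<noteq> of_real (x j s)" using u s j unfolding trajectory_def by blast
    then have "\<nu> j s = (cmod (u s - of_real (x j s)))\<^sup>2 / (2 * Im (u s)) *
        (2 * \<nu> j s * Im (u s) / (cmod (u s - of_real (x j s)))\<^sup>2)"
      using pos[OF s] by simp
    also have "\<dots> \<le> (cmod (u s - of_real (x j s)))\<^sup>2 / (2 * Im (u s)) * norm (?f s)"
      using le pos[OF s] by (intro mult_left_mono) auto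
    also have "\<dots> \<le> B * norm (?f s)" using B[OF s] by (intro mult_right_mono) auto
    finally show ?thesis .
  qed
  have "(\<lambda>s. B * norm (?f s)) integrable_on {0..q}"
    using f by (intro integrable_on_mult_right) (auto simp: absolutely_integrable_on_def)
  moreover have "(\<lambda>s. complex_of_real (\<nu> j s)) \<in> borel_measurable (lebesgue_on {0..q})"
  proof -
    have "\<nu> j \<in> borel_measurable (lebesgue_on {0..q})"
      using meas[OF j] by (rule measurable_restrict_mono) auto
    then show ?thesis by simp
  qed
  ultimately show ?thesis
    using bound nonneg[OF j]
    by (intro measurable_bounded_by_integrable_imp_absolutely_integrable) auto
qed

end

section \<open>Conservation laws when the rates are integrable\<close>

locale integrable_flow = flow +
  assumes nu_int: "\<And>j. j \<in> J \<Longrightarrow> (\<lambda>s. complex_of_real (\<nu> j s)) absolutely_integrable_on {0..t}"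
begin

text \<open>The coefficients of the linear equations below are rates divided by continuous functions
  without zeros.\<close>

lemma weighted_integrable:
  assumes "\<And>j. j \<in> J \<Longrightarrow> continuous_on {0..t} (d j)" "\<And>j s. j \<in> J \<Longrightarrow> s \<in> {0..t} \<Longrightarrow> d j s \<noteq> 0"
  shows "(\<lambda>s. \<Sum>j\<in>J. 2 * cnu s j / d j s) absolutely_integrable_on {0..t}"
proof (rule absolutely_integrable_sum[OF finJ])
  fix j assume j: "j \<in> J"
  have "(\<lambda>s. (2 / d j s) * cnu s j) absolutely_integrable_on {0..t}"
    using assms j by (intro abs_int_continuous_mult nu_int continuous_intros) auto
  then show "(\<lambda>s. 2 * cnu s j / d j s) absolutely_integrable_on {0..t}" by simp
qed

text \<open>An explicit solution rather than an estimate: it yields uniqueness, injectivity of the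
  flow, avoidance of the poles, the monotonicity of imaginary parts and Lipschitz bounds in both
  directions of time.\<close>

lemma trajectory_diff:
  assumes u: "trajectory J \<nu> x t u" and v: "trajectory J \<nu> x t v" and s: "s \<in> {0..t}"
  shows "u s - v s = (u 0 - v 0) *
    exp (integral {0..s} (\<lambda>r. - (\<Sum>j\<in>J. 2 * cnu r j / ((u r - cx r j) * (v r - cx r j)))))"
proof -
  let ?c = "\<lambda>r. - (\<Sum>j\<in>J. 2 * cnu r j / ((u r - cx r j) * (v r - cx r j)))"
  have ne: "u r \<noteq> cx r j" "v r \<noteq> cx r j" if "r \<in> {0..t}" "j \<in> J" for r j
    using u v that unfolding trajectory_def by auto
  have "(\<lambda>r. \<Sum>j\<in>J. 2 * cnu r j / ((u r - cx r j) * (v r - cx r j))) absolutely_integrable_on {0..t}"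
    using ne trajectory_continuous[OF u] trajectory_continuous[OF v]
    by (intro weighted_integrable continuous_intros cont_cx) auto
  from abs_int_continuous_mult[OF this, of "\<lambda>_. -1"]
  have c: "?c absolutely_integrable_on {0..t}" by simp
  have "primitive_on t (\<lambda>r. u r - v r) (\<lambda>r. ?c r * (u r - v r))"
  proof (rule primitive_on_cong[OF primitive_on_diff, OF
        u[unfolded trajectory_def, THEN conjunct1] v[unfolded trajectory_def, THEN conjunct1]])
    show "loewner_field J (cnu r) (cx r) (u r) - loewner_field J (cnu r) (cx r) (v r) =
        ?c r * (u r - v r)" if "r \<in> {0..t}" for r
      by (rule loewner_field_diff) (use ne that in auto)
  qed simp
  from primitive_on_linear_ode[OF this c s] show ?thesis .
qed

lemma trajectory_unique:
  assumes "trajectory J \<nu> x t u" "trajectory J \<nu> x t v" "s \<in> {0..t}"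
  shows "u s = v s \<longleftrightarrow> u 0 = v 0"
proof -
  have "u s - v s = 0 \<longleftrightarrow> u 0 - v 0 = 0" by (subst trajectory_diff[OF assms]) simp
  then show ?thesis by simp
qed

text \<open>Driving points and rates are real, so the conjugate of a trajectory is a trajectory, and
  it is determined by its starting point.\<close>

lemma sym_preserved:
  assumes "k \<in> F" "l \<in> F" "z l 0 = cnj (z k 0)" "s \<in> {0..t}"
  shows "z l s = cnj (z k s)"
  using trajectory_unique[OF trajectory_z[OF assms(2)] trajectory_cnj[OF trajectory_z[OF assms(1)]] assms(4)]
    assms(3) by simp

lemma prim_z_minus_x:
  assumes "k \<in> F" "j \<in> J"
  shows "primitive_on t (\<lambda>s. z k s - cx s j) (\<lambda>s. (z k s - cx s j) *
    ((loewner_field J (cnu s) (cx s) (z k s) - driving_field J F (cnu s) (cx s) (cz s) j) / (z k s - cx s j)))"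
  by (rule primitive_on_cong[OF primitive_on_diff[OF z_prim[OF assms(1)] x_prim[OF assms(2)]]])
    (use z_x assms in auto)

lemma prim_z_minus_z:
  assumes "k \<in> F" "l \<in> F - {k}"
  shows "primitive_on t (\<lambda>s. z k s - z l s) (\<lambda>s. (z k s - z l s) *
    ((loewner_field J (cnu s) (cx s) (z k s) - loewner_field J (cnu s) (cx s) (z l s)) / (z k s - z l s)))"
  by (rule primitive_on_cong[OF primitive_on_diff[OF z_prim z_prim]])
    (use z_z assms in auto)

lemma inverse_log_eq: "u \<noteq> 0 \<Longrightarrow> inverse u * - (d / u) = - (d / u\<^sup>2)" for u d :: complex
  by (simp add: field_simps power2_eq_square)

lemma defect_zero:
  assumes k: "k \<in> F" and s: "s \<in> {0..t}"
  shows "defect J F (cx s) (cz s) k = 0"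
proof -
  let ?v = "\<lambda>s. loewner_field J (cnu s) (cx s)" and ?d = "\<lambda>s. driving_field J F (cnu s) (cx s) (cz s)"
  let ?c = "\<lambda>s. \<Sum>i\<in>J. 2 * cnu s i / (z k s - cx s i)\<^sup>2"
  have c: "?c absolutely_integrable_on {0..t}"
    using z_x k by (intro weighted_integrable continuous_intros cont_cx cont_z) auto
  have 1: "primitive_on t (\<lambda>s. 1 / (z k s - cx s j))
      (\<lambda>s. - ((?v s (z k s) - ?d s j) / (z k s - cx s j)\<^sup>2))" if j: "j \<in> J" for j
  proof (rule primitive_on_cong[OF primitive_on_log_inverse[OF prim_z_minus_x[OF k j]]])
    fix s assume "s \<in> {0..t}"
    then have ne: "z k s - cx s j \<noteq> 0" using z_x k j by auto
    show "z k s - cx s j \<noteq> 0" by (rule ne)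
    show "inverse (z k s - cx s j) * - ((?v s (z k s) - ?d s j) / (z k s - cx s j)) =
        - ((?v s (z k s) - ?d s j) / (z k s - cx s j)\<^sup>2)"
      by (rule inverse_log_eq[OF ne])
  qed (simp add: inverse_eq_divide)
  have 2: "primitive_on t (\<lambda>s. 2 / (z k s - z l s))
      (\<lambda>s. 2 * - ((?v s (z k s) - ?v s (z l s)) / (z k s - z l s)\<^sup>2))" if l: "l \<in> F - {k}" for l
  proof (rule primitive_on_cong[OF primitive_on_cmult[OF primitive_on_log_inverse[OF prim_z_minus_z[OF k l]], of 2]])
    fix s assume "s \<in> {0..t}"
    then have ne: "z k s - z l s \<noteq> 0" using z_z k l by auto
    show "z k s - z l s \<noteq> 0" by (rule ne)
    show "2 * (inverse (z k s - z l s) * - ((?v s (z k s) - ?v s (z l s)) / (z k s - z l s))) =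
        2 * - ((?v s (z k s) - ?v s (z l s)) / (z k s - z l s)\<^sup>2)"
      unfolding inverse_log_eq[OF ne] ..
  qed (simp add: divide_inverse)
  have "primitive_on t (\<lambda>s. defect J F (cx s) (cz s) k) (\<lambda>s. ?c s * defect J F (cx s) (cz s) k)"
  proof (rule primitive_on_cong)
    show "primitive_on t (\<lambda>s. (\<Sum>j\<in>J. 1 / (z k s - cx s j)) - (\<Sum>l\<in>F - {k}. 2 / (z k s - z l s)))
        (\<lambda>s. (\<Sum>j\<in>J. - ((?v s (z k s) - ?d s j) / (z k s - cx s j)\<^sup>2)) -
             (\<Sum>l\<in>F - {k}. 2 * - ((?v s (z k s) - ?v s (z l s)) / (z k s - z l s)\<^sup>2)))"
      by (intro primitive_on_diff primitive_on_sum 1 2)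
    show "(\<Sum>j\<in>J. - ((?v s (z k s) - ?d s j) / (z k s - cx s j)\<^sup>2)) -
        (\<Sum>l\<in>F - {k}. 2 * - ((?v s (z k s) - ?v s (z l s)) / (z k s - z l s)\<^sup>2)) =
        ?c s * defect J F (cx s) (cz s) k" if s: "s \<in> {0..t}" for s
      using deriv_defect[OF finJ finF inj_cx[OF s] inj_z[OF s], of k "cnu s"] z_x[OF s] k
      by (simp add: sum_negf sum_distrib_left)
  qed (simp add: defect_def)
  from primitive_on_linear_ode[OF this c s] show ?thesis using defect_0[OF k] by simp
qed

lemma stationary_s: "s \<in> {0..t} \<Longrightarrow> real_stationary e (crit s) (pol s)"
  using sym_0 sym_preserved by (intro real_stationary_at defect_zero) blast+

lemma residue_prim:
  assumes k: "k \<in> F"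
  shows "primitive_on t (\<lambda>s. residue_at J F (cx s) (cz s) k)
    (\<lambda>s. residue_at J F (cx s) (cz s) k * - (\<Sum>i\<in>J. 2 * cnu s i / (z k s - cx s i)\<^sup>2))"
proof -
  let ?v = "\<lambda>s. loewner_field J (cnu s) (cx s)" and ?d = "\<lambda>s. driving_field J F (cnu s) (cx s) (cz s)"
  let ?a = "\<lambda>s. \<Sum>j\<in>J. (?v s (z k s) - ?d s j) / (z k s - cx s j)"
  let ?b = "\<lambda>s. \<Sum>l\<in>F - {k}. (?v s (z k s) - ?v s (z l s)) / (z k s - z l s)"
  let ?N = "\<lambda>s. \<Prod>j\<in>J. z k s - cx s j" and ?B = "\<lambda>s. \<Prod>l\<in>F - {k}. z k s - z l s"
  have N: "primitive_on t ?N (\<lambda>s. ?N s * ?a s)"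
    by (intro primitive_on_log_prod prim_z_minus_x k)
  have "primitive_on t ?B (\<lambda>s. ?B s * ?b s)"
    by (intro primitive_on_log_prod prim_z_minus_z k)
  moreover have "?B s \<noteq> 0" if "s \<in> {0..t}" for s
    using z_z[OF that k] finF by auto
  ultimately have B: "primitive_on t (\<lambda>s. inverse (?B s)) (\<lambda>s. inverse (?B s) * - ?b s)"
    by (rule primitive_on_log_inverse)
  show ?thesis
  proof (rule primitive_on_cong[OF primitive_on_log_mult[OF N primitive_on_log_mult[OF B B]]])
    show eq: "?N s * (inverse (?B s) * inverse (?B s)) = residue_at J F (cx s) (cz s) k"
      if "s \<in> {0..t}" for s
      by (simp add: residue_at_def divide_inverse power2_eq_square)
    show "?N s * (inverse (?B s) * inverse (?B s)) * (?a s + (- ?b s + - ?b s)) =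
      residue_at J F (cx s) (cz s) k * - (\<Sum>i\<in>J. 2 * cnu s i / (z k s - cx s i)\<^sup>2)"
      if s: "s \<in> {0..t}" for s
    proof -
      have "?a s + (- ?b s + - ?b s) = ?a s - 2 * ?b s" by simp
      also have "\<dots> = - (\<Sum>i\<in>J. 2 * cnu s i / (z k s - cx s i)\<^sup>2)"
        by (rule log_deriv_residue[OF finJ finF inj_cx[OF s] inj_z[OF s] _ k]) (use z_x[OF s] in auto)
      finally show ?thesis unfolding eq[OF s] by simp
    qed
  qed
qed

lemma rat_val_conserved:
  assumes u: "trajectory J \<nu> x t u" and u0: "u 0 \<notin> pol 0" and s: "s \<in> {0..t}"
  shows "u s \<notin> pol s" "rat_val e (crit s) (pol s) (u s) = rat_val e (crit 0) (pol 0) (u 0)"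
proof -
  \<comment> \<open>The poles are trajectories themselves, so one that starts off the poles never
    meets them.\<close>
  have uz: "u r \<noteq> z k r" if "r \<in> {0..t}" "k \<in> F" for r k
    using trajectory_unique[OF u trajectory_z[OF that(2)] that(1)] u0 that by auto
  then show "u s \<notin> pol s" using s by auto
  have ux: "u r \<noteq> cx r j" if "r \<in> {0..t}" "j \<in> J" for r j
    using u that unfolding trajectory_def by auto
  let ?v = "\<lambda>s. loewner_field J (cnu s) (cx s)"
  let ?A = "\<lambda>s. residue_at J F (cx s) (cz s)"
  have pu: "primitive_on t u (\<lambda>s. ?v s (u s))" using u unfolding trajectory_def by blast
  have polar: "primitive_on t (\<lambda>s. ?A s k / (u s - z k s))
      (\<lambda>s. - (\<Sum>i\<in>J. 2 * cnu s i / (u s - cx s i) * (?A s k / (cx s i - z k s)\<^sup>2)))" if k: "k \<in> F" for k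
  proof -
    have "primitive_on t (\<lambda>s. u s - z k s)
        (\<lambda>s. (u s - z k s) * ((?v s (u s) - ?v s (z k s)) / (u s - z k s)))"
      by (rule primitive_on_cong[OF primitive_on_diff[OF pu z_prim[OF k]]]) (use uz k in auto)
    then have inv: "primitive_on t (\<lambda>s. inverse (u s - z k s))
        (\<lambda>s. inverse (u s - z k s) * - ((?v s (u s) - ?v s (z k s)) / (u s - z k s)))"
      by (rule primitive_on_log_inverse) (use uz k in auto)
    show ?thesis
    proof (rule primitive_on_cong[OF primitive_on_log_mult[OF residue_prim[OF k] inv]])
      fix s assume s: "s \<in> {0..t}"
      show "?A s k * inverse (u s - z k s) = ?A s k / (u s - z k s)" by (simp add: divide_inverse)
      have "?A s k * inverse (u s - z k s) * (- (\<Sum>i\<in>J. 2 * cnu s i / (z k s - cx s i)\<^sup>2) +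
          - ((?v s (u s) - ?v s (z k s)) / (u s - z k s))) =
          ?A s k * inverse (u s - z k s) *
          (- (u s - z k s) * (\<Sum>i\<in>J. 2 * cnu s i / ((u s - cx s i) * (z k s - cx s i)\<^sup>2)))"
        using deriv_polar_part[OF finJ finF inj_cx[OF s] inj_z[OF s], of k "u s" "cnu s"] z_x[OF s] k
          uz[OF s] ux[OF s] by simp
      also have "\<dots> = - (?A s k * (\<Sum>i\<in>J. 2 * cnu s i / ((u s - cx s i) * (z k s - cx s i)\<^sup>2)))"
      proof -
        have "a * inverse w * (- w * S) = - (a * S)" if "w \<noteq> 0" for a w S :: complex
          using that by simp
        moreover have "u s - z k s \<noteq> 0" using uz[OF s k] by simp
        ultimately show ?thesis .
      qed
      also have "\<dots> = - (\<Sum>i\<in>J. 2 * cnu s i / (u s - cx s i) * (?A s k / (cx s i - z k s)\<^sup>2))"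
        unfolding sum_distrib_left power2_commute[of "z k s"] by (simp add: mult.commute)
      finally show "?A s k * inverse (u s - z k s) * (- (\<Sum>i\<in>J. 2 * cnu s i / (z k s - cx s i)\<^sup>2) +
          - ((?v s (u s) - ?v s (z k s)) / (u s - z k s))) =
          - (\<Sum>i\<in>J. 2 * cnu s i / (u s - cx s i) * (?A s k / (cx s i - z k s)\<^sup>2))" .
    qed
  qed
  have "primitive_on t (\<lambda>s. rat_val e (crit s) (pol s) (u s)) (\<lambda>s. 0)"
  proof (rule primitive_on_cong)
    show "primitive_on t (\<lambda>s. of_nat e * u s - (\<Sum>k\<in>F. ?A s k / (u s - z k s)))
       (\<lambda>s. of_nat e * ?v s (u s) -
          (\<Sum>k\<in>F. - (\<Sum>i\<in>J. 2 * cnu s i / (u s - cx s i) * (?A s k / (cx s i - z k s)\<^sup>2))))"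
      by (intro primitive_on_diff primitive_on_cmult pu primitive_on_sum polar)
    fix s assume s: "s \<in> {0..t}"
    show "of_nat e * u s - (\<Sum>k\<in>F. ?A s k / (u s - z k s)) = rat_val e (crit s) (pol s) (u s)"
      by (rule rat_val_image[OF inj_cx[OF s] inj_z[OF s], symmetric])
    interpret S: real_stationary e "crit s" "pol s" by (rule stationary_s[OF s])
    have R': "of_nat e + (\<Sum>k\<in>F. ?A s k / (cx s i - z k s)\<^sup>2) = 0" if "i \<in> J" for i
      using S.R_deriv_critical[of "cx s i"] that inj_z[OF s]
      by (simp add: sum.reindex pole_coeff_image[OF inj_cx[OF s] inj_z[OF s]])
    have "of_nat e * ?v s (u s) -
          (\<Sum>k\<in>F. - (\<Sum>i\<in>J. 2 * cnu s i / (u s - cx s i) * (?A s k / (cx s i - z k s)\<^sup>2))) =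
        (\<Sum>i\<in>J. 2 * cnu s i / (u s - cx s i) * (of_nat e + (\<Sum>k\<in>F. ?A s k / (cx s i - z k s)\<^sup>2)))"
      unfolding distrib_left sum.distrib sum_negf sum_distrib_left loewner_field_def
      by (subst (2) sum.swap) (simp add: mult.commute)
    also have "\<dots> = 0" using R' by simp
    finally show "of_nat e * ?v s (u s) -
          (\<Sum>k\<in>F. - (\<Sum>i\<in>J. 2 * cnu s i / (u s - cx s i) * (?A s k / (cx s i - z k s)\<^sup>2))) = 0" .
  qed
  from primitive_on_constant[OF this s]
  show "rat_val e (crit s) (pol s) (u s) = rat_val e (crit 0) (pol 0) (u 0)" .
qed

end

context flow
begin

text \<open>Multiplying by the denominator avoids a case distinction on whether the limit point of the
  trajectory is a pole.\<close>

lemma rat_val_real_of_limit_real: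
  assumes r: "0 < r" "r \<le> t" and cu: "continuous_on {0..r} u"
    and traj: "\<And>q. 0 \<le> q \<Longrightarrow> q < r \<Longrightarrow> trajectory J \<nu> x q u"
    and int: "\<And>q j. 0 \<le> q \<Longrightarrow> q < r \<Longrightarrow> j \<in> J \<Longrightarrow> (\<lambda>s. complex_of_real (\<nu> j s)) absolutely_integrable_on {0..q}"
    and u0: "u 0 \<notin> pol 0" and ur: "Im (u r) = 0"
  shows "Im (rat_val e (crit 0) (pol 0) (u 0)) = 0"
proof -
  define c where "c = rat_val e (crit 0) (pol 0) (u 0)"
  have IF: "integrable_flow e J F \<nu> x z q" if "0 \<le> q" "q < r" for q
    using flow_mono[of q] int[OF that] that r
    by (intro integrable_flow.intro integrable_flow_axioms.intro) auto
  have sub: "{0..r} \<subseteq> {0..t}" "r \<in> {0..t}" using r by auto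
  note cz = continuous_on_subset[OF cont_z sub(1)]
  \<comment> \<open>The rates are known to be integrable only on \<open>{0..q}\<close> with
    \<open>q < r\<close>, so everything at time \<open>r\<close> is obtained as a limit.\<close>
  have defect: "defect J F (cx r) (cz r) k = 0" if k: "k \<in> F" for k
  proof (rule continuous_on_eq_right_end[OF r(1), where f = "\<lambda>s. defect J F (cx s) (cz s) k"])
    show "continuous_on {0..r} (\<lambda>s. defect J F (cx s) (cz s) k)"
      using cont_defect[OF k] sub(1) continuous_on_subset by blast
    show "defect J F (cx q) (cz q) k = 0" if "q \<in> {0..<r}" for q
      using integrable_flow.defect_zero[OF IF k, of q q] that by auto
  qed auto
  have sym: "\<exists>l\<in>F. z l r = cnj (z k r)" if k: "k \<in> F" for k
  proof -
    obtain l where l: "l \<in> F" "z l 0 = cnj (z k 0)" using sym_0 k by blast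
    have "z l r = cnj (z k r)"
    proof (rule continuous_on_eq_right_end[OF r(1), where f = "z l" and h = "\<lambda>s. cnj (z k s)"])
      show "continuous_on {0..r} (\<lambda>s. cnj (z k s))" by (intro continuous_intros cz k)
      show "z l q = cnj (z k q)" if "q \<in> {0..<r}" for q
        using integrable_flow.sym_preserved[OF IF k l(1) l(2), of q q] that by auto
    qed (rule cz[OF l(1)])
    then show ?thesis using l by blast
  qed
  interpret S: real_stationary e "crit r" "pol r" by (rule real_stationary_at[OF sub(2) defect sym])
  let ?N = "\<lambda>s. of_nat e * (u s * (\<Prod>k\<in>F. u s - z k s)) -
    (\<Sum>k\<in>F. residue_at J F (cx s) (cz s) k * (\<Prod>l\<in>F - {k}. u s - z l s))"
  let ?D = "\<lambda>s. \<Prod>k\<in>F. u s - z k s"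
  have NP: "poly (num_poly e (crit s) (pol s)) (u s) = ?N s" if "s \<in> {0..t}" for s
    by (rule num_poly_image[OF inj_cx[OF that] inj_z[OF that]])
  have DP: "poly (root_poly (pol s)) (u s) = ?D s" if "s \<in> {0..t}" for s
    by (simp add: poly_root_poly prod.reindex[OF inj_z[OF that]])
  have "?N r = c * ?D r"
  proof (rule continuous_on_eq_right_end[OF r(1), where f = ?N and h = "\<lambda>s. c * ?D s"])
    show "continuous_on {0..r} ?N"
      by (intro continuous_intros cu cz continuous_on_subset[OF cont_residue sub(1)]) auto
    show "continuous_on {0..r} (\<lambda>s. c * ?D s)" by (intro continuous_intros cu cz)
    fix q assume q: "q \<in> {0..<r}"
    then have qt: "q \<in> {0..t}" using r by auto
    interpret I: integrable_flow e J F \<nu> x z q using IF q by auto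
    interpret Sq: real_stationary e "crit q" "pol q" by (rule I.stationary_s) (use q in auto)
    have "trajectory J \<nu> x q u" using traj q by auto
    from I.rat_val_conserved[OF this u0, of q] q
    have "u q \<notin> pol q" "rat_val e (crit q) (pol q) (u q) = c" by (auto simp: c_def)
    then show "?N q = c * ?D q" using Sq.poly_p[of "u q"] NP[OF qt] DP[OF qt] by simp
  qed
  then have eq: "poly (num_poly e (crit r) (pol r)) (u r) = c * poly (root_poly (pol r)) (u r)"
    using NP[OF sub(2)] DP[OF sub(2)] by simp
  have cr: "cnj (u r) = u r" using ur by (simp add: complex_eq_iff)
  \<comment> \<open>At a pole the right side of \<open>eq\<close> would be zero and the left side
    would not.\<close>
  have "u r \<notin> pol r" using eq S.poly_p_pole_nonzero[of "u r"] S.finZ by (auto simp: poly_root_poly)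
  then have "rat_val e (crit r) (pol r) (u r) = c"
    using eq S.poly_p[of "u r"] S.poly_Q_nonzero[of "u r"] by simp
  then have "cnj c = c" using S.R_cnj[of "u r"] cr by simp
  then show ?thesis unfolding c_def by (simp add: complex_eq_iff)
qed

end

section \<open>Swallowed points and surjectivity\<close>

lemma continuous_on_left_limit:
  fixes u :: "real \<Rightarrow> complex"
  assumes c: "\<And>q. 0 \<le> q \<Longrightarrow> q < s \<Longrightarrow> continuous_on {0..q} u"
    and lim: "(u \<longlongrightarrow> u s) (at s within {0..<s})"
  shows "continuous_on {0..s} u"
  unfolding continuous_on_def
proof
  fix p assume p: "p \<in> {0..s}"
  show "(u \<longlongrightarrow> u p) (at p within {0..s})"
  proof (cases "p = s")
    case True
    have "at s within {0..s} = at s within {0..<s}"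
      by (rule at_within_nhd[of s UNIV]) auto
    then show ?thesis using lim True by simp
  next
    case False
    define q where "q = (p + s) / 2"
    have q: "p < q" "q < s" "0 \<le> q" using p False by (auto simp: q_def)
    have "(u \<longlongrightarrow> u p) (at p within {0..q})"
      using c[OF q(3,2)] p q unfolding continuous_on_def by auto
    moreover have "at p within {0..s} = at p within {0..q}"
      by (rule at_within_nhd[of p "{..<q}"]) (use q in auto)
    ultimately show ?thesis by simp
  qed
qed

section \<open>Height and stability of trajectories\<close>

context integrable_flow
begin

lemma cont_x: "j \<in> J \<Longrightarrow> continuous_on {0..t} (x j)"
  using continuous_on_Re[OF cont_cx[of j]] by simp

lemma weighted_nu_integrable: "(\<lambda>s. \<Sum>j\<in>J. 2 * \<nu> j s) absolutely_integrable_on {0..t}"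
proof -
  have "(\<lambda>s. \<Sum>j\<in>J. 2 * cnu s j / 1) absolutely_integrable_on {0..t}"
    by (rule weighted_integrable) auto
  from absolutely_integrable_linear[OF this bounded_linear_Re] show ?thesis by (simp add: o_def)
qed

text \<open>This is \<open>trajectory_diff\<close> applied to \<open>u\<close> and its conjugate:
  the weights become the nonnegative numbers \<open>2 \<nu> / |u - x|^2\<close>, so \<open>E\<close>
  is a decreasing exponential. In particular the sign of the imaginary part is preserved.\<close>

lemma Im_trajectory:
  assumes u: "trajectory J \<nu> x t u" and nonneg: "\<And>j s. j \<in> J \<Longrightarrow> 0 \<le> s \<Longrightarrow> 0 \<le> \<nu> j s"
  shows "\<exists>E :: real \<Rightarrow> real. \<forall>s\<in>{0..t}. 0 < E s \<and> Im (u s) = Im (u 0) * E s \<and> E t \<le> E s"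
proof -
  define h where "h r = (\<Sum>j\<in>J. 2 * \<nu> j r / (cmod (u r - cx r j))\<^sup>2)" for r
  let ?E = "\<lambda>s. exp (- integral {0..s} h)"
  have ux: "u r \<noteq> cx r j" if "r \<in> {0..t}" "j \<in> J" for r j
    using u that unfolding trajectory_def by auto
  have cu: "continuous_on {0..t} u" using u by (rule trajectory_continuous)
  have sq: "(w - of_real a) * (cnj w - of_real a) = of_real ((cmod (w - of_real a))\<^sup>2)" for w a
    using complex_norm_square[of "w - of_real a"] by simp
  have hc: "(\<Sum>j\<in>J. 2 * cnu r j / ((u r - cx r j) * (cnj (u r) - cx r j))) = of_real (h r)" for r
    unfolding sq h_def by simp
  have "(\<lambda>r. \<Sum>j\<in>J. 2 * cnu r j / ((u r - cx r j) * (cnj (u r) - cx r j))) absolutely_integrable_on {0..t}"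
  proof -
    have "(u r - cx r j) * (cnj (u r) - cx r j) \<noteq> 0" if "j \<in> J" "r \<in> {0..t}" for j r
      unfolding sq using ux[OF that(2,1)] by simp
    then show ?thesis by (intro weighted_integrable continuous_intros cu cont_x) blast+
  qed
  from absolutely_integrable_linear[OF this[unfolded hc] bounded_linear_Re]
  have h: "h absolutely_integrable_on {0..t}" by (simp add: o_def)
  have hi: "h integrable_on {0..s}" if "s \<in> {0..t}" for s
    using abs_int_subinterval[OF h, of 0 s] that by (auto simp: absolutely_integrable_on_def)
  have "Im (u s) = Im (u 0) * ?E s" if s: "s \<in> {0..t}" for s
  proof -
    have "((\<lambda>r. complex_of_real (- h r)) has_integral of_real (- integral {0..s} h)) {0..s}"
      using has_integral_linear[OF has_integral_neg[OF integrable_integral[OF hi[OF s]]] bounded_linear_of_real]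
      by (simp add: o_def)
    then have "integral {0..s} (\<lambda>r. - complex_of_real (h r)) = of_real (- integral {0..s} h)"
      by (intro integral_unique) simp
    then have "u s - cnj (u s) = (u 0 - cnj (u 0)) * of_real (?E s)"
      using trajectory_diff[OF u trajectory_cnj[OF u] s, unfolded hc]
      by (simp only: exp_of_real)
    then have "Im (u s - cnj (u s)) = Im ((u 0 - cnj (u 0)) * of_real (?E s))" by (rule arg_cong)
    then show ?thesis by simp
  qed
  moreover have "?E t \<le> ?E s" if s: "s \<in> {0..t}" for s
  proof -
    have "integral {0..s} h \<le> integral {0..t} h"
    proof (rule integral_subset_le)
      show "\<forall>r\<in>{0..t}. 0 \<le> h r"
        unfolding h_def using nonneg by (auto intro!: sum_nonneg)
    qed (use s hi t0 in auto)
    then show ?thesis by simp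
  qed
  ultimately have "\<forall>s\<in>{0..t}. 0 < ?E s \<and> Im (u s) = Im (u 0) * ?E s \<and> ?E t \<le> ?E s"
    using exp_gt_zero by blast
  then show ?thesis by (rule exI[of _ ?E])
qed

text \<open>The distance to a driving point is at least the height, so the exponent in
  \<open>trajectory_diff\<close> is at most the integral of the rates divided by
  \<open>a * b\<close>. The two heights are kept apart because later one trajectory is a limit whose
  height is controlled separately. The backward bound gives convergence of preimages, the forward
  bound convergence of their trajectories.\<close>

lemma trajectory_stable:
  assumes u: "trajectory J \<nu> x t u" and v: "trajectory J \<nu> x t v"
    and nonneg: "\<And>j s. j \<in> J \<Longrightarrow> 0 \<le> s \<Longrightarrow> 0 \<le> \<nu> j s"
    and ab: "0 < a" "0 < b" "\<And>s. s \<in> {0..t} \<Longrightarrow> a \<le> Im (u s)" "\<And>s. s \<in> {0..t} \<Longrightarrow> b \<le> Im (v s)"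
  defines "C \<equiv> exp (integral {0..t} (\<lambda>s. \<Sum>j\<in>J. 2 * \<nu> j s) / (a * b))"
  shows "cmod (u t - v t) \<le> C * cmod (u 0 - v 0)" "cmod (u 0 - v 0) \<le> C * cmod (u t - v t)"
proof -
  let ?c = "\<lambda>r. - (\<Sum>j\<in>J. 2 * cnu r j / ((u r - cx r j) * (v r - cx r j)))"
  let ?n = "\<lambda>s. \<Sum>j\<in>J. 2 * \<nu> j s"
  have ne: "u r \<noteq> cx r j" "v r \<noteq> cx r j" if "r \<in> {0..t}" "j \<in> J" for r j
    using u v that unfolding trajectory_def by auto
  have "(\<lambda>r. \<Sum>j\<in>J. 2 * cnu r j / ((u r - cx r j) * (v r - cx r j))) absolutely_integrable_on {0..t}"
    using ne trajectory_continuous[OF u] trajectory_continuous[OF v]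
    by (intro weighted_integrable continuous_intros cont_cx) auto
  from abs_int_continuous_mult[OF this, of "\<lambda>_. -1"]
  have c: "?c integrable_on {0..t}" by (simp add: absolutely_integrable_on_def)
  have n: "(\<lambda>s. ?n s / (a * b)) integrable_on {0..t}"
    using weighted_nu_integrable unfolding absolutely_integrable_on_def divide_inverse
    by (intro integrable_on_mult_left) blast
  have "norm (integral {0..t} ?c) \<le> integral {0..t} (\<lambda>s. ?n s / (a * b))"
  proof (rule integral_norm_bound_integral[OF c n])
    fix r assume r: "r \<in> {0..t}"
    have "norm (?c r) \<le> (\<Sum>j\<in>J. norm (2 * cnu r j / ((u r - cx r j) * (v r - cx r j))))"
      by (simp add: norm_sum)
    also have "\<dots> \<le> (\<Sum>j\<in>J. 2 * \<nu> j r / (a * b))"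
    proof (rule sum_mono)
      fix j assume j: "j \<in> J"
      have "a \<le> cmod (u r - cx r j)" "b \<le> cmod (v r - cx r j)"
        using ab(3,4)[OF r] abs_Im_le_cmod[of "u r - cx r j"] abs_Im_le_cmod[of "v r - cx r j"] by auto
      then have "a * b \<le> cmod (u r - cx r j) * cmod (v r - cx r j)"
        using ab(1,2) by (intro mult_mono) auto
      moreover have "0 \<le> \<nu> j r" using nonneg[OF j] r by auto
      ultimately show "norm (2 * cnu r j / ((u r - cx r j) * (v r - cx r j))) \<le> 2 * \<nu> j r / (a * b)"
        using ab(1,2) by (simp add: norm_divide norm_mult frac_le)
    qed
    finally show "norm (?c r) \<le> ?n r / (a * b)" by (simp add: sum_divide_distrib)
  qed
  then have "\<bar>Re (integral {0..t} ?c)\<bar> \<le> integral {0..t} ?n / (a * b)"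
    using abs_Re_le_cmod[of "integral {0..t} ?c"] by simp
  then have E: "exp (Re (integral {0..t} ?c)) \<le> C" "exp (- Re (integral {0..t} ?c)) \<le> C"
    unfolding C_def by (simp_all add: abs_le_iff)
  have "u t - v t = (u 0 - v 0) * exp (integral {0..t} ?c)"
    by (rule trajectory_diff[OF u v]) (use t0 in auto)
  then have *: "cmod (u t - v t) = cmod (u 0 - v 0) * exp (Re (integral {0..t} ?c))"
    by (simp add: norm_mult)
  then show "cmod (u t - v t) \<le> C * cmod (u 0 - v 0)"
    using E(1) by (simp add: mult.commute[of C] mult_left_mono)
  have "cmod (u 0 - v 0) = cmod (u t - v t) * exp (- Re (integral {0..t} ?c))"
    unfolding * by (simp add: exp_minus)
  then show "cmod (u 0 - v 0) \<le> C * cmod (u t - v t)"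
    using E(2) by (simp add: mult.commute[of C] mult_left_mono)
qed

end

section \<open>Integrability of the rates and swallowed points\<close>

locale loewner_flow = flow +
  fixes g :: "real \<Rightarrow> complex \<Rightarrow> complex" and \<tau> :: "complex \<Rightarrow> ereal"
  assumes meas: "\<And>j. j \<in> J \<Longrightarrow> \<nu> j \<in> borel_measurable (lebesgue_on {0..})"
    and nonneg: "\<And>j s. j \<in> J \<Longrightarrow> 0 \<le> s \<Longrightarrow> 0 \<le> \<nu> j s"
    and g0: "\<And>w. g 0 w = w"
    and trajectory_g: "\<And>q w. 0 \<le> q \<Longrightarrow> q \<le> t \<Longrightarrow> ereal q < \<tau> w \<Longrightarrow> trajectory J \<nu> x q (\<lambda>s. g s w)"
    and swallowed: "\<And>w. \<tau> w \<le> ereal t \<Longrightarrow> \<exists>s j. \<tau> w = ereal s \<and> 0 \<le> s \<and> j \<in> J \<and>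
      g s w = of_real (x j s) \<and> ((\<lambda>u. g u w) \<longlongrightarrow> g s w) (at s within {0..<s})"
    and z_g: "\<And>k s. k \<in> F \<Longrightarrow> z k s = g s (z k 0)"
begin

abbreviation "R0 \<equiv> rat_val e (crit 0) (pol 0)"
abbreviation "Rt \<equiv> rat_val e (crit t) (pol t)"

lemma swallowedE:
  assumes "\<tau> w \<le> ereal t"
  obtains s j where "\<tau> w = ereal s" "0 \<le> s" "s \<le> t" "j \<in> J" "g s w = of_real (x j s)"
    "continuous_on {0..s} (\<lambda>q. g q w)" "\<And>q. 0 \<le> q \<Longrightarrow> q < s \<Longrightarrow> trajectory J \<nu> x q (\<lambda>s. g s w)"
proof -
  obtain s j where s: "\<tau> w = ereal s" "0 \<le> s" "j \<in> J" "g s w = of_real (x j s)"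
      "((\<lambda>u. g u w) \<longlongrightarrow> g s w) (at s within {0..<s})"
    using swallowed[OF assms] by blast
  have st: "s \<le> t" using assms s(1) by simp
  have tr: "trajectory J \<nu> x q (\<lambda>s. g s w)" if "0 \<le> q" "q < s" for q
    using trajectory_g[of q w] that st s(1) by simp
  have "continuous_on {0..s} (\<lambda>q. g q w)"
    by (rule continuous_on_left_limit[OF _ s(5)]) (rule trajectory_continuous[OF tr])
  then show ?thesis using that s st tr by blast
qed

text \<open>A point \<open>w\<close> near \<open>\<i>\<close> with nonreal \<open>R0 w\<close>
  serves as a test point. Were \<open>r\<close> the first time its trajectory has height 0, the
  rates would be integrable on all shorter intervals, and \<open>rat_val_real_of_limit_real\<close>
  would make \<open>R0 w\<close> real. So \<open>w\<close> stays above the real line up to time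
  \<open>t\<close>.\<close>

lemma nu_integrable:
  assumes j: "j \<in> J"
  shows "(\<lambda>s. complex_of_real (\<nu> j s)) absolutely_integrable_on {0..t}"
proof -
  interpret S0: real_stationary e "crit 0" "pol 0" by (rule stationary_0)
  obtain w where w: "dist w \<i> < 1" "w \<notin> pol 0" "Im (R0 w) \<noteq> 0"
    using S0.R_nonreal_near[of 1 \<i>] by auto
  have "\<bar>Im (w - \<i>)\<bar> < 1" using w(1) abs_Im_le_cmod[of "w - \<i>"] by (simp add: dist_norm)
  then have w0: "0 < Im w" by auto
  let ?u = "\<lambda>s. g s w"
  \<comment> \<open>\<open>c\<close> is the swallowing time of \<open>w\<close> if that is at most
    \<open>t\<close>, and \<open>t\<close> otherwise. Only in the second case does the equation hold
    up to \<open>c\<close> itself.\<close>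
  have "\<exists>c. 0 \<le> c \<and> c \<le> t \<and> continuous_on {0..c} ?u \<and> (\<forall>q. 0 \<le> q \<longrightarrow> q < c \<longrightarrow> trajectory J \<nu> x q ?u) \<and>
      (Im (?u c) = 0 \<or> c = t \<and> trajectory J \<nu> x t ?u)"
  proof (cases "\<tau> w \<le> ereal t")
    case True
    then obtain s i where "0 \<le> s" "s \<le> t" "g s w = of_real (x i s)" "continuous_on {0..s} ?u"
        "\<And>q. 0 \<le> q \<Longrightarrow> q < s \<Longrightarrow> trajectory J \<nu> x q ?u"
      by (elim swallowedE) blast
    then show ?thesis by (intro exI[of _ s]) auto
  next
    case False
    then have "trajectory J \<nu> x t ?u" using trajectory_g[of t w] t0 by simp
    then show ?thesis using t0 trajectory_mono trajectory_continuous by (intro exI[of _ t]) auto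
  qed
  then obtain c where c: "0 \<le> c" "c \<le> t" "continuous_on {0..c} ?u"
      "\<And>q. 0 \<le> q \<Longrightarrow> q < c \<Longrightarrow> trajectory J \<nu> x q ?u"
      "Im (?u c) = 0 \<or> c = t \<and> trajectory J \<nu> x t ?u"
    by blast
  define B where "B = {q \<in> {0..c}. Im (?u q) \<le> 0}"
  have B: "B = {}"
  proof (rule ccontr)
    assume "B \<noteq> {}"
    have cI: "continuous_on {0..c} (\<lambda>q. Im (?u q))" using c(3) by (intro continuous_intros)
    have "compact B"
    proof -
      have "closed ({0..c} \<inter> (\<lambda>q. Im (?u q)) -` {..0})"
        by (intro continuous_closed_preimage[OF cI]) auto
      moreover have "B = {0..c} \<inter> (\<lambda>q. Im (?u q)) -` {..0}" by (auto simp: B_def)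
      moreover have "bounded B" by (rule bounded_subset[of "{0..c}"]) (auto simp: B_def)
      ultimately show ?thesis by (simp add: compact_eq_bounded_closed)
    qed
    then obtain r where r: "r \<in> B" "\<And>q. q \<in> B \<Longrightarrow> r \<le> q"
      using compact_attains_inf[of B] \<open>B \<noteq> {}\<close> by blast
    have rc: "0 \<le> r" "r \<le> c" "Im (?u r) \<le> 0" using r(1) by (auto simp: B_def)
    have r0: "0 < r" using rc w0 g0[of w] by (cases "r = 0") auto
    have pos: "0 < Im (?u q)" if "0 \<le> q" "q < r" for q
    proof (rule ccontr)
      assume "\<not> 0 < Im (?u q)"
      then have "q \<in> B" using that rc by (auto simp: B_def)
      then show False using r(2)[of q] that by simp
    qed
    have "\<not> Im (?u r) < 0"
    proof
      assume "Im (?u r) < 0"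
      then obtain q where "0 \<le> q" "q \<le> r" "Im (?u q) = 0"
        using IVT2'[of "\<lambda>q. Im (?u q)" r 0 0] r0 w0 g0[of w] continuous_on_subset[OF cI, of "{0..r}"] rc by auto
      then show False using pos[of q] \<open>Im (?u r) < 0\<close> by (cases "q = r") auto
    qed
    then have Ir: "Im (?u r) = 0" using rc by simp
    have "Im (R0 (?u 0)) = 0"
    proof (rule rat_val_real_of_limit_real[OF r0])
      show "r \<le> t" using rc c by simp
      show "continuous_on {0..r} ?u" using c(3) rc by (rule_tac continuous_on_subset) auto
      show tq: "trajectory J \<nu> x q ?u" if "0 \<le> q" "q < r" for q using c(4) that rc by auto
      show "(\<lambda>s. complex_of_real (\<nu> j s)) absolutely_integrable_on {0..q}"
        if "0 \<le> q" "q < r" "j \<in> J" for q j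
        by (rule integrable_of_Im_pos[OF tq[OF that(1,2)]]) (use that pos rc c meas nonneg in auto)
    qed (use w g0 Ir in auto)
    then show False using w g0 by simp
  qed
  have "c \<in> {0..c}" using c by simp
  then have "Im (?u c) \<noteq> 0" using B unfolding B_def by force
  then have ct: "c = t" "trajectory J \<nu> x t ?u" using c(5) by auto
  have "0 < Im (?u q)" if "q \<in> {0..t}" for q
  proof (rule ccontr)
    assume "\<not> 0 < Im (?u q)"
    then have "q \<in> B" using that ct by (auto simp: B_def)
    then show False using B by simp
  qed
  then show ?thesis by (intro integrable_of_Im_pos[OF ct(2) t0 order_refl _ meas nonneg j])
qed

end

sublocale loewner_flow \<subseteq> integrable_flow
  by unfold_locales (rule nu_integrable)

context loewner_flow
begin

sublocale S0: real_stationary e "crit 0" "pol 0" by (rule stationary_0)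
sublocale St: real_stationary e "crit t" "pol t" by (rule stationary_s) (use t0 in auto)

lemma integrable_flow_mono: "0 \<le> s \<Longrightarrow> s \<le> t \<Longrightarrow> integrable_flow e J F \<nu> x z s"
  using flow_mono[of s] abs_int_subinterval[OF nu_integrable, of _ 0 s]
  by (intro integrable_flow.intro integrable_flow_axioms.intro) auto

lemma not_swallowed:
  assumes "w \<notin> pol 0" "Im (R0 w) \<noteq> 0"
  shows "ereal t < \<tau> w"
proof (rule ccontr)
  assume "\<not> ereal t < \<tau> w"
  then have "\<tau> w \<le> ereal t" by simp
  then obtain s j where s: "0 \<le> s" "s \<le> t" "j \<in> J" "g s w = of_real (x j s)"
      "continuous_on {0..s} (\<lambda>q. g q w)" "\<And>q. 0 \<le> q \<Longrightarrow> q < s \<Longrightarrow> trajectory J \<nu> x q (\<lambda>s. g s w)"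
    by (elim swallowedE) blast
  show False
  proof (cases "s = 0")
    \<comment> \<open>A point swallowed at time 0 is a starting point of the driving functions; the
      limit argument of the other case needs a positive time.\<close>
    case True
    then have "w \<in> \<real>" using s g0[of w] by simp
    then have "R0 w \<in> \<real>" by (rule S0.R_real)
    then show False using assms complex_is_Real_iff by blast
  next
    case False
    have "Im (R0 (g 0 w)) = 0"
    proof (rule rat_val_real_of_limit_real[where r = s])
      show "(\<lambda>s. complex_of_real (\<nu> j s)) absolutely_integrable_on {0..q}"
        if "0 \<le> q" "q < s" "j \<in> J" for q j
        using abs_int_subinterval[OF nu_integrable[OF that(3)], of 0 q] that s by auto
    qed (use s False assms g0 in auto)
    then show False using assms g0 by simp
  qed
qed

lemma rat_val_t:
  assumes "ereal t < \<tau> w" "w \<notin> pol 0"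
  shows "g t w \<notin> pol t" "Rt (g t w) = R0 w"
  using rat_val_conserved[OF trajectory_g[OF t0 order_refl assms(1)], of t] assms g0 t0 by auto

lemma pole_t: assumes "w \<in> pol 0" shows "g t w \<in> pol t"
proof -
  obtain k where "k \<in> F" "w = z k 0" using assms by blast
  then show ?thesis using z_g[of k t] by (intro image_eqI[of _ _ k]) simp_all
qed

lemma rat_map_t:
  assumes "ereal t < \<tau> w"
  shows "rat_map e (crit 0) (pol 0) (Some w) = rat_map e (crit t) (pol t) (Some (g t w))"
  using rat_val_t[OF assms] pole_t[of w] by (simp add: S0.rat_map_Some St.rat_map_Some)

lemma hull_real:
  assumes "\<tau> w \<le> ereal t"
  shows "Some w \<in> real_locus (rat_map e (crit 0) (pol 0))"
proof (cases "w \<in> pol 0")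
  case True
  then show ?thesis by (simp add: real_locus_def real_sphere_def S0.rat_map_Some)
next
  case False
  then have "Im (R0 w) = 0" using not_swallowed[of w] assms by force
  then have "R0 w = of_real (Re (R0 w))" by (simp add: complex_eq_iff)
  then have "Some (R0 w) \<in> range sreal" by (metis rangeI)
  then show ?thesis using False by (simp add: real_locus_def real_sphere_def S0.rat_map_Some)
qed

section \<open>Surjectivity onto the half-plane\<close>

lemma Im_g:
  assumes "ereal q < \<tau> v" "0 \<le> q" "q \<le> t" "s \<in> {0..q}"
  shows "0 < Im v \<longleftrightarrow> 0 < Im (g q v)" "0 < Im v \<Longrightarrow> Im (g q v) \<le> Im (g s v)"
proof -
  interpret I: integrable_flow e J F \<nu> x z q using integrable_flow_mono assms by auto
  have tr: "trajectory J \<nu> x q (\<lambda>s. g s v)" using trajectory_g assms by auto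
  obtain E where E: "\<And>s. s \<in> {0..q} \<Longrightarrow> 0 < E s" "\<And>s. s \<in> {0..q} \<Longrightarrow> Im (g s v) = Im (g 0 v) * E s"
    "\<And>s. s \<in> {0..q} \<Longrightarrow> E q \<le> (E s :: real)"
    using I.Im_trajectory[OF tr nonneg] by blast
  have q: "q \<in> {0..q}" using assms by auto
  show "0 < Im v \<longleftrightarrow> 0 < Im (g q v)"
    using E(1)[OF q] E(2)[OF q] g0[of v] by (simp add: zero_less_mult_iff)
  show "Im (g q v) \<le> Im (g s v)" if "0 < Im v"
    unfolding E(2)[OF q] E(2)[OF assms(4)] using E(3)[OF assms(4)] that g0[of v] by simp
qed

text \<open>\<open>g t\<close> injects the \<open>card F + e\<close> solutions of \<open>R0 = c\<close>, for nonreal \<open>c\<close>, into the equally many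
  solutions of \<open>Rt = c\<close>.\<close>

lemma surj_nonreal:
  assumes w: "0 < Im w" "w \<notin> pol t" "Im (Rt w) \<noteq> 0"
  obtains v where "0 < Im v" "ereal t < \<tau> v" "g t v = w"
proof -
  define c where "c = Rt w"
  define A where "A = {v. v \<notin> pol 0 \<and> R0 v = c}"
  define B where "B = {v. v \<notin> pol t \<and> Rt v = c}"
  have c: "Im c \<noteq> 0" using w by (simp add: c_def)
  have cardp: "card (pol 0) = card F" "card (pol t) = card F"
    using card_image[OF inj_z[of 0]] card_image[OF inj_z[of t]] t0 by auto
  have AB: "finite B" "card A = card B"
    using S0.R_nonreal_simple_roots[OF c] St.R_nonreal_simple_roots[OF c] cardp by (simp_all add: A_def B_def)
  have A: "ereal t < \<tau> v" "v \<notin> pol 0" if "v \<in> A" for v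
    using not_swallowed[of v] that c by (auto simp: A_def)
  have "g t ` A \<subseteq> B"
  proof (rule image_subsetI)
    fix v assume v: "v \<in> A"
    then have "R0 v = c" by (simp add: A_def)
    then show "g t v \<in> B" using rat_val_t[OF A[OF v]] by (simp add: B_def)
  qed
  moreover have "inj_on (g t) A"
  proof (rule inj_onI)
    fix v v' assume v: "v \<in> A" "v' \<in> A" "g t v = g t v'"
    have "trajectory J \<nu> x t (\<lambda>s. g s v)" "trajectory J \<nu> x t (\<lambda>s. g s v')"
      using trajectory_g[of t] t0 A v by auto
    from trajectory_unique[OF this, of t] show "v = v'" using v t0 g0 by simp
  qed
  ultimately have "g t ` A = B"
    using AB by (intro card_subset_eq) (auto simp: card_image)
  moreover have "w \<in> B" using w by (simp add: B_def c_def)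
  ultimately obtain v where v: "v \<in> A" "g t v = w" by blast
  then have "0 < Im v" using Im_g(1)[of t v t] A t0 w by auto
  then show ?thesis using that v A by blast
qed

text \<open>Points near \<open>w\<close> with nonreal value of \<open>Rt\<close> have preimages.
  Their trajectories keep a common height, so the backward bound makes the preimages a Cauchy
  sequence; what remains is to see that the limit point is not swallowed.\<close>

lemma surj:
  assumes w: "0 < Im w"
  obtains v where "0 < Im v" "ereal t < \<tau> v" "g t v = w"
proof -
  \<comment> \<open>Half the height of \<open>w\<close>: approximating points within
    \<open>\<eta>\<close> of \<open>w\<close> have height at least \<open>\<eta>\<close>, and as
    heights decrease in time, so have their whole trajectories.\<close>
  define \<eta> where "\<eta> = Im w / 2"
  have \<eta>: "0 < \<eta>" using w by (simp add: \<eta>_def)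
  have "\<exists>v. 0 < Im v \<and> ereal t < \<tau> v \<and> \<eta> \<le> Im (g t v) \<and> dist (g t v) w < inverse (real (Suc m))" for m
  proof -
    obtain w' where w': "dist w' w < min \<eta> (inverse (real (Suc m)))" "w' \<notin> pol t" "Im (Rt w') \<noteq> 0"
      using St.R_nonreal_near[of "min \<eta> (inverse (real (Suc m)))" w] \<eta> by auto
    have "\<bar>Im (w' - w)\<bar> < \<eta>" using w'(1) abs_Im_le_cmod[of "w' - w"] by (simp add: dist_norm)
    then have "\<eta> \<le> Im w'" unfolding \<eta>_def by (simp add: abs_if split: if_splits)
    moreover obtain v where "0 < Im v" "ereal t < \<tau> v" "g t v = w'"
      using surj_nonreal[of w'] w' \<open>\<eta> \<le> Im w'\<close> \<eta> by auto
    ultimately show ?thesis using w' by auto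
  qed
  then obtain V where V: "\<And>m. 0 < Im (V m)" "\<And>m. ereal t < \<tau> (V m)" "\<And>m. \<eta> \<le> Im (g t (V m))"
      "\<And>m. dist (g t (V m)) w < inverse (real (Suc m))"
    by metis
  have gw: "(\<lambda>m. g t (V m)) \<longlonglongrightarrow> w"
  proof (rule tendstoI)
    fix \<epsilon> :: real assume "0 < \<epsilon>"
    then obtain m0 where m0: "inverse (real (Suc m0)) < \<epsilon>" using reals_Archimedean by blast
    have "dist (g t (V m)) w < \<epsilon>" if "m \<ge> m0" for m
    proof -
      have "inverse (real (Suc m)) \<le> inverse (real (Suc m0))" using that by (simp add: le_imp_inverse_le)
      then show ?thesis using V(4)[of m] m0 by linarith
    qed
    then show "eventually (\<lambda>m. dist (g t (V m)) w < \<epsilon>) sequentially"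
      unfolding eventually_sequentially by blast
  qed
  have ImV: "\<eta> \<le> Im (g s (V m))" if "s \<in> {0..t}" for s m
    using Im_g(2)[OF V(2) t0 order_refl that V(1)] V(3) by (rule order_trans[rotated])
  have trV: "trajectory J \<nu> x t (\<lambda>s. g s (V m))" for m
    using trajectory_g[OF t0 order_refl V(2)] .
  define C where "C = exp (integral {0..t} (\<lambda>s. \<Sum>j\<in>J. 2 * \<nu> j s) / (\<eta> * \<eta>))"
  have CV: "dist (V m) (V l) \<le> C * dist (g t (V m)) (g t (V l))" for m l
    using trajectory_stable(2)[OF trV[of m] trV[of l] nonneg \<eta> \<eta> ImV ImV] g0 by (simp add: dist_norm C_def)
  have "Cauchy V"
    unfolding Cauchy_def
  proof (intro allI impI)
    fix \<epsilon> :: real assume "0 < \<epsilon>"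
    have C0: "0 < C" by (simp add: C_def)
    obtain M where M: "\<And>m l. m \<ge> M \<Longrightarrow> l \<ge> M \<Longrightarrow> dist (g t (V m)) (g t (V l)) < \<epsilon> / C"
      using LIMSEQ_imp_Cauchy[OF gw] \<open>0 < \<epsilon>\<close> C0 unfolding Cauchy_def by (metis divide_pos_pos)
    have "dist (V m) (V l) < \<epsilon>" if "m \<ge> M" "l \<ge> M" for m l
    proof -
      have "C * dist (g t (V m)) (g t (V l)) < \<epsilon>" using M[OF that] C0 by (simp add: field_simps)
      then show ?thesis using CV[of m l] by linarith
    qed
    then show "\<exists>M. \<forall>m\<ge>M. \<forall>l\<ge>M. dist (V m) (V l) < \<epsilon>" by blast
  qed
  then obtain v where v: "V \<longlonglongrightarrow> v" using Cauchy_convergent convergent_def by blast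
  have "\<eta> \<le> Im (V m)" for m using ImV[of 0 m] t0 g0 by simp
  then have Iv: "\<eta> \<le> Im v" by (intro LIMSEQ_le_const[OF tendsto_Im[OF v]]) auto
  \<comment> \<open>The height \<open>b\<close> of the limit trajectory depends on \<open>q\<close>
    and might degenerate at the swallowing time of \<open>v\<close>; hence the claim is confined to
    earlier times.\<close>
  have conv: "(\<lambda>m. g q (V m)) \<longlonglongrightarrow> g q v" if q: "0 \<le> q" "q \<le> t" "ereal q < \<tau> v" for q
  proof -
    interpret I: integrable_flow e J F \<nu> x z q using integrable_flow_mono q by auto
    have tr: "trajectory J \<nu> x q (\<lambda>s. g s v)" using trajectory_g q by auto
    define b where "b = Im (g q v)"
    have b: "0 < b" using Im_g(1)[OF q(3) q(1,2), of q] q Iv \<eta> by (simp add: b_def)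
    have bs: "b \<le> Im (g s v)" if "s \<in> {0..q}" for s
      unfolding b_def by (rule Im_g(2)[OF q(3) q(1,2) that]) (use Iv \<eta> in auto)
    define K where "K = exp (integral {0..q} (\<lambda>s. \<Sum>j\<in>J. 2 * \<nu> j s) / (\<eta> * b))"
    have le: "norm (g q (V m) - g q v) \<le> K * norm (V m - v)" for m
      using I.trajectory_stable(1)[OF trajectory_mono[OF trV[of m] q(2)] tr nonneg \<eta> b ImV bs] q g0
      by (auto simp: K_def)
    have "(\<lambda>m. K * norm (V m - v)) \<longlonglongrightarrow> 0"
      using v by (intro tendsto_mult_right_zero tendsto_norm_zero) (simp add: LIM_zero)
    then have "(\<lambda>m. g q (V m) - g q v) \<longlonglongrightarrow> 0"
      by (rule Lim_null_comparison[rotated]) (use le in auto)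
    then show ?thesis by (simp add: LIM_zero_cancel)
  qed
  have tv: "ereal t < \<tau> v"
  proof (rule ccontr)
    assume "\<not> ereal t < \<tau> v"
    then have "\<tau> v \<le> ereal t" by simp
    then obtain s j where s: "\<tau> v = ereal s" "0 \<le> s" "s \<le> t" "j \<in> J" "g s v = of_real (x j s)"
        "continuous_on {0..s} (\<lambda>q. g q v)"
      by (elim swallowedE) blast
    have "s \<noteq> 0" using s Iv \<eta> g0[of v] by auto
    then have s0: "0 < s" using s by simp
    have "s \<in> {0..s}" "0 < \<eta>" using s0 \<eta> by auto
    then obtain \<delta> where \<delta>: "0 < \<delta>" "\<And>q. q \<in> {0..s} \<Longrightarrow> dist q s < \<delta> \<Longrightarrow> dist (g q v) (g s v) < \<eta>"
      using s(6) unfolding continuous_on_iff by blast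
    \<comment> \<open>Shortly before being swallowed, \<open>v\<close> would have sunk below height
      \<open>\<eta>\<close>, yet at that time its position is a limit of points of height at least
      \<open>\<eta>\<close>.\<close>
    define q where "q = max 0 (s - \<delta> / 2)"
    have q: "0 \<le> q" "q < s" "dist q s < \<delta>" using \<delta>(1) s0 by (auto simp: q_def dist_real_def)
    have "dist (g q v) (g s v) < \<eta>" using \<delta>(2)[of q] q by auto
    then have "\<bar>Im (g q v - g s v)\<bar> < \<eta>" using abs_Im_le_cmod[of "g q v - g s v"] by (simp add: dist_norm)
    then have small: "Im (g q v) < \<eta>" using s(5) by simp
    have "(\<lambda>m. g q (V m)) \<longlonglongrightarrow> g q v" using conv[of q] q s by auto
    then have "\<eta> \<le> Im (g q v)"
      using ImV[of q] q s by (intro LIMSEQ_le_const[OF tendsto_Im]) auto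
    then show False using small by simp
  qed
  have "g t v = w" using conv[OF t0 order_refl tv] gw LIMSEQ_unique by blast
  moreover have "0 < Im v" using Iv \<eta> by linarith
  ultimately show ?thesis using that tv by blast
qed

end

section \<open>Superpositions of SLE(0) flows\<close>

lemma sfrac_scale: "sfrac c a b = c * sfrac 1 a b"
  by (cases a; cases b) (simp_all add: sfrac_def)

lemma swallowing_time_nonneg: "0 \<le> swallowing_time m T x g w"
  unfolding swallowing_time_def by (rule Inf_greatest) auto

lemma not_hit_before_swallowing:
  assumes "ereal s < swallowing_time m T x g w" "0 \<le> s" "ereal s < T" "j \<in> {1..m}"
  shows "g s w \<noteq> of_real (x j s)"
proof
  assume "g s w = of_real (x j s)"
  then have "swallowing_time m T x g w \<le> ereal s"
    unfolding swallowing_time_def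
    by (intro Inf_lower imageI CollectI conjI bexI[of _ j]) (use assms in auto)
  then show False using assms(1) by simp
qed

lemma loewner_chain_trajectory:
  assumes ch: "loewner_chain m \<nu> T x g"
    and q: "0 \<le> q" "ereal q < T" "ereal q < swallowing_time m T x g w"
  shows "trajectory {1..m} \<nu> x q (\<lambda>s. g s w)"
proof -
  let ?f = "\<lambda>s. \<Sum>j=1..m. complex_of_real (2 * \<nu> j s) / (g s w - complex_of_real (x j s))"
  have eq: "?f = (\<lambda>s. loewner_field {1..m} (\<lambda>j. of_real (\<nu> j s)) (\<lambda>j. of_real (x j s)) (g s w))"
    by (simp add: loewner_field_def)
  have st: "ereal s < T" "ereal s < swallowing_time m T x g w" if "s \<in> {0..q}" for s
    using that q by (auto intro: le_less_trans[of "ereal s" "ereal q"])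
  have "?f absolutely_integrable_on {0..s} \<and> g s w = w + integral {0..s} ?f" if s: "s \<in> {0..q}" for s
    using ch st[OF s] s unfolding loewner_chain_def Let_def by auto
  moreover have "g 0 w = w" using ch unfolding loewner_chain_def by auto
  ultimately have "primitive_on q (\<lambda>s. g s w) ?f"
    using q(1) by (intro primitive_onI) auto
  then show ?thesis
    unfolding trajectory_def eq using not_hit_before_swallowing[OF st(2) _ st(1)] by auto
qed

text \<open>By distinctness no atoms merge or cancel, so the support of \<open>rho\<close> splits
  into starting points of mass 2 and poles of mass -4, and the description operator in
  \<open>transport\<close> finds the right index.\<close>

lemma driving_field_eq_superposition:
  fixes x :: "nat \<Rightarrow> real \<Rightarrow> real"
  assumes inj0: "inj_on x0 {1..2*n}" and inj\<zeta>: "inj_on \<zeta> {1..n+1}"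
    and \<zeta>x: "\<forall>j\<in>{1..2*n}. \<forall>k\<in>{1..n+1}. \<zeta> k \<noteq> sreal (x0 j)"
    and x0: "\<And>j. j \<in> {1..2*n} \<Longrightarrow> x j 0 = x0 j"
    and j: "j \<in> {1..2*n}"
  shows "complex_of_real (\<nu> j s) * sle0_drift (rho n x0 \<zeta> j) (transport (2*n) x g s) (x j s) +
      (\<Sum>k\<in>{1..2*n} - {j}. complex_of_real (2 * \<nu> k s / (x j s - x k s))) =
    driving_field {1..2*n} {k\<in>{1..n+1}. \<zeta> k \<noteq> None} (\<lambda>j. of_real (\<nu> j s)) (\<lambda>j. of_real (x j s))
      (\<lambda>k. g s (the (\<zeta> k))) j"
proof -
  let ?J = "{1..2*n} - {j}" and ?K = "{1..n+1}" and ?h = "transport (2*n) x g s" and ?a = "sreal (x j s)"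
  let ?\<rho> = "rho n x0 \<zeta> j" and ?s = "\<lambda>w. sfrac 1 ?a (?h w)"
  define U where "U = (\<lambda>k. sreal (x0 k)) ` ?J"
  define V where "V = \<zeta> ` ?K"
  have injU: "inj_on (\<lambda>k. sreal (x0 k)) ?J"
    by (rule inj_onI) (use inj0 in \<open>auto dest: inj_onD\<close>)
  have UV: "U \<inter> V = {}"
  proof (rule equals0I)
    fix w assume "w \<in> U \<inter> V"
    then have "w \<in> U" "w \<in> V" by blast+
    from \<open>w \<in> U\<close> obtain k where k: "k \<in> ?J" "w = sreal (x0 k)" unfolding U_def by (rule imageE)
    from \<open>w \<in> V\<close> obtain l where l: "l \<in> ?K" "w = \<zeta> l" unfolding V_def by (rule imageE)
    have "\<zeta> l \<noteq> sreal (x0 k)" using \<zeta>x k(1) l(1) by blast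
    then show False using k(2) l(2) by simp
  qed
  have \<rho>U: "?\<rho> (sreal (x0 k)) = 2" if k: "k \<in> ?J" for k
  proof -
    have "(\<Sum>l\<in>?J. 2 * delta (sreal (x0 l)) (sreal (x0 k))) = (\<Sum>l\<in>?J. if l = k then 2 else 0)"
      using k inj0 by (intro sum.cong) (auto simp: delta_def dest: inj_onD)
    moreover have "(\<Sum>l=1..n+1. 4 * delta (\<zeta> l) (sreal (x0 k))) = 0"
      using \<zeta>x k by (intro sum.neutral) (fastforce simp: delta_def)
    ultimately show ?thesis using k by (simp add: rho_def)
  qed
  have \<rho>V: "?\<rho> (\<zeta> k) = - 4" if k: "k \<in> ?K" for k
  proof -
    have "(\<Sum>l\<in>?J. 2 * delta (sreal (x0 l)) (\<zeta> k)) = 0"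
      using \<zeta>x k by (intro sum.neutral) (auto simp: delta_def)
    moreover have "(\<Sum>l=1..n+1. 4 * delta (\<zeta> l) (\<zeta> k)) = (\<Sum>l=1..n+1. if l = k then 4 else 0)"
      using k inj\<zeta> by (intro sum.cong) (auto simp: delta_def dest: inj_onD)
    ultimately show ?thesis using k by (simp add: rho_def)
  qed
  have \<rho>0: "?\<rho> w = 0" if "w \<notin> U \<union> V" for w
  proof -
    have "delta (sreal (x0 l)) w = 0" if "l \<in> ?J" for l
    proof -
      have "sreal (x0 l) \<in> U" unfolding U_def using that by (rule imageI)
      then show ?thesis using \<open>w \<notin> U \<union> V\<close> by (auto simp: delta_def)
    qed
    moreover have "delta (\<zeta> l) w = 0" if "l \<in> ?K" for l
    proof -
      have "\<zeta> l \<in> V" unfolding V_def using that by (rule imageI)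
      then show ?thesis using \<open>w \<notin> U \<union> V\<close> by (auto simp: delta_def)
    qed
    ultimately show ?thesis by (simp add: rho_def)
  qed
  have hU: "?h (sreal (x0 k)) = sreal (x k s)" if k: "k \<in> ?J" for k
  proof -
    have "(THE l. l \<in> {1..2*n} \<and> sreal (x0 k) = sreal (x l 0)) = k"
    proof (rule the_equality)
      show "k \<in> {1..2*n} \<and> sreal (x0 k) = sreal (x k 0)" using k x0 by simp
      fix l assume l: "l \<in> {1..2*n} \<and> sreal (x0 k) = sreal (x l 0)"
      then have "x0 l = x0 k" using x0[of l] by simp
      then show "l = k" using inj_onD[OF inj0] k l by blast
    qed
    moreover have "\<exists>l\<in>{1..2*n}. sreal (x0 k) = sreal (x l 0)" using k x0 by auto
    ultimately show ?thesis by (simp add: transport_def)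
  qed
  have hV: "?h (\<zeta> k) = map_option (g s) (\<zeta> k)" if k: "k \<in> ?K" for k
  proof -
    have "\<not> (\<exists>l\<in>{1..2*n}. \<zeta> k = sreal (x l 0))" using k \<zeta>x x0 by auto
    then show ?thesis by (simp add: transport_def)
  qed
  have "sle0_drift ?\<rho> ?h (x j s) = (\<Sum>w | ?\<rho> w \<noteq> 0. complex_of_real (?\<rho> w) * ?s w)"
    unfolding sle0_drift_def by (intro sum.cong refl sfrac_scale)
  also have "\<dots> = (\<Sum>w\<in>U \<union> V. complex_of_real (?\<rho> w) * ?s w)"
    by (rule sum.mono_neutral_left) (use \<rho>0 in \<open>auto simp: U_def V_def\<close>)
  also have "\<dots> = (\<Sum>w\<in>U. complex_of_real (?\<rho> w) * ?s w) + (\<Sum>w\<in>V. complex_of_real (?\<rho> w) * ?s w)"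
    by (rule sum.union_disjoint) (use UV in \<open>auto simp: U_def V_def\<close>)
  also have "(\<Sum>w\<in>U. complex_of_real (?\<rho> w) * ?s w) = (\<Sum>k\<in>?J. 2 / (of_real (x j s) - of_real (x k s)))"
    unfolding U_def sum.reindex[OF injU] using \<rho>U hU by (intro sum.cong) (auto simp: sfrac_def)
  also have "(\<Sum>w\<in>V. complex_of_real (?\<rho> w) * ?s w) = (\<Sum>k\<in>?K. - 4 * sfrac 1 ?a (map_option (g s) (\<zeta> k)))"
    unfolding V_def sum.reindex[OF inj\<zeta>] using \<rho>V hV by (intro sum.cong) auto
  \<comment> \<open>An infinite atom stays at infinity, where \<open>sfrac\<close> is 0.\<close>
  also have "\<dots> = (\<Sum>k\<in>{k\<in>?K. \<zeta> k \<noteq> None}. - 4 * sfrac 1 ?a (map_option (g s) (\<zeta> k)))"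
    by (rule sum.mono_neutral_right) (auto simp: sfrac_def)
  also have "\<dots> = (\<Sum>k\<in>{k\<in>?K. \<zeta> k \<noteq> None}. - (4 / (of_real (x j s) - g s (the (\<zeta> k)))))"
    by (intro sum.cong) (auto simp: sfrac_def)
  finally show ?thesis by (simp add: driving_field_def sum_negf)
qed

theorem theorem2p2:
  fixes n :: nat and x0 :: "nat \<Rightarrow> real" and \<zeta> :: "nat \<Rightarrow> csphere"
  assumes "n \<ge> 1"
    and "inj_on x0 {1..2*n}"
    and "inj_on \<zeta> {1..n+1}"
    and "\<forall>j\<in>{1..2*n}. \<forall>k\<in>{1..n+1}. \<zeta> k \<noteq> sreal (x0 j)"
    and "\<forall>k\<in>{1..n+1}. map_option cnj (\<zeta> k) \<in> \<zeta> ` {1..n+1}"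
    and "\<forall>k\<in>{1..n+1}. (\<Sum>j=1..2*n. sfrac 1 (\<zeta> k) (sreal (x0 j))) =
                       (\<Sum>l\<in>{1..n+1} - {k}. sfrac 2 (\<zeta> k) (\<zeta> l))"
  shows "\<exists>R \<in> CRR (n+1) (x0 ` {1..2*n}).
    poles R = \<zeta> ` {1..n+1} \<and>
    (\<forall>(\<nu> :: nat \<Rightarrow> real \<Rightarrow> real) (T :: ereal) (x :: nat \<Rightarrow> real \<Rightarrow> real)
       (g :: real \<Rightarrow> complex \<Rightarrow> complex) (t :: real).
       (\<forall>j\<in>{1..2*n}. \<nu> j \<in> borel_measurable (lebesgue_on {0..}) \<and> (\<forall>s\<ge>0. 0 \<le> \<nu> j s)) \<longrightarrow>
       superposition (2*n) \<nu> x0 (rho n x0 \<zeta>) T x g \<longrightarrow>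
       0 \<le> t \<longrightarrow> ereal t < T \<longrightarrow>
       (\<forall>s\<in>{0..t}. no_collision n \<zeta> x g s) \<longrightarrow>
       Some ` loewner_hull (2*n) T x g t \<subseteq> real_locus R \<and>
       (\<exists>S \<in> CRR (n+1) ((\<lambda>j. x j t) ` {1..2*n}).
          \<forall>w\<in>upper_half.
            R (Some (inv_into (upper_half - loewner_hull (2*n) T x g t) (g t) w)) = S (Some w)))"
proof -
  let ?J = "{1..2*n}" and ?K = "{1..n+1}"
  define F where "F = {k\<in>?K. \<zeta> k \<noteq> None}"
  define e :: nat where "e = (if None \<in> \<zeta> ` ?K then 1 else 0)"
  define z0 where "z0 k = the (\<zeta> k)" for k
  have \<zeta>F: "\<zeta> k = Some (z0 k)" if "k \<in> F" for k using that by (auto simp: F_def z0_def)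
  have FK: "F \<subseteq> ?K" by (auto simp: F_def)
  \<comment> \<open>Injectivity of \<open>\<zeta>\<close> allows at most one infinite pole, and
    \<open>e\<close> counts it.\<close>
  have cF: "card F + e = n + 1"
  proof (cases "None \<in> \<zeta> ` ?K")
    case True
    then obtain k0 where k0: "k0 \<in> ?K" "\<zeta> k0 = None" by auto
    have "\<zeta> k \<noteq> None" if "k \<in> ?K" "k \<noteq> k0" for k
      using assms(3) k0 that by (metis inj_onD)
    then have "F = ?K - {k0}" using k0 by (auto simp: F_def)
    then show ?thesis using k0 True by (simp add: e_def)
  next
    case False
    then have "F = ?K" by (force simp: F_def)
    then show ?thesis using False by (simp add: e_def)
  qed
  have e1: "e \<le> 1" by (simp add: e_def)
  \<comment> \<open>At most one of the \<open>n + 1 \<ge> 2\<close> poles is infinite.\<close>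
  have F: "finite F" "F \<noteq> {}" using cF e1 assms(1) by (auto simp: F_def[symmetric] intro: finite_subset[OF FK])
  have ceq: "card ?J + 2 = 2 * (card F + e)" using cF by simp
  have injz: "inj_on z0 F" using assms(3) \<zeta>F FK by (metis inj_on_def inj_on_subset)
  have zx: "z0 k \<noteq> of_real (x0 j)" if "j \<in> ?J" "k \<in> F" for j k
    using assms(4) \<zeta>F[OF that(2)] that FK by fastforce
  have sym: "\<exists>l\<in>F. z0 l = cnj (z0 k)" if k: "k \<in> F" for k
  proof -
    obtain l where l: "l \<in> ?K" "\<zeta> l = map_option cnj (\<zeta> k)" using assms(5) k FK by force
    then have \<zeta>l: "\<zeta> l = Some (cnj (z0 k))" using \<zeta>F[OF k] by simp
    then have "l \<in> F" using l by (simp add: F_def)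
    moreover have "z0 l = cnj (z0 k)" unfolding z0_def[of l] \<zeta>l by simp
    ultimately show ?thesis by blast
  qed
  have defect: "defect ?J F (\<lambda>j. of_real (x0 j)) z0 k = 0" if k: "k \<in> F" for k
  proof -
    have "(\<Sum>j=1..2*n. sfrac 1 (\<zeta> k) (sreal (x0 j))) = (\<Sum>j\<in>?J. 1 / (z0 k - of_real (x0 j)))"
      by (simp add: \<zeta>F[OF k] sfrac_def)
    \<comment> \<open>The term of an infinite pole is 0 by convention, so the relation at a finite
      pole involves finite poles only.\<close>
    moreover have "(\<Sum>l\<in>?K - {k}. sfrac 2 (\<zeta> k) (\<zeta> l)) = (\<Sum>l\<in>F - {k}. sfrac 2 (\<zeta> k) (\<zeta> l))"
      by (rule sum.mono_neutral_right) (auto simp: F_def sfrac_def split: option.splits)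
    moreover have "\<dots> = (\<Sum>l\<in>F - {k}. 2 / (z0 k - z0 l))"
      by (intro sum.cong) (auto simp: \<zeta>F k sfrac_def)
    ultimately show ?thesis using assms(6) k FK by (auto simp: defect_def)
  qed
  let ?X = "(\<lambda>j. complex_of_real (x0 j)) ` ?J" and ?Z = "z0 ` F"
  interpret S: real_stationary e ?X ?Z
    by (rule real_stationary_image[OF _ F e1 ceq assms(2) injz zx defect sym]) simp
  let ?R = "rat_map e ?X ?Z"
  have cZ: "card ?Z + e = n + 1" using cF card_image[OF injz] by simp
  have R: "?R \<in> CRR (n+1) (x0 ` ?J)"
    using S.rat_map_in_CRR[of "x0 ` ?J"] unfolding cZ by (simp add: image_image)
  have poles: "poles ?R = \<zeta> ` ?K"
  proof -
    have "Some ` ?Z = \<zeta> ` F" using \<zeta>F by (auto simp: image_image intro!: image_cong)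
    moreover have "\<zeta> ` ?K = \<zeta> ` F \<union> (if e = 1 then {None} else {})"
    proof -
      have "\<zeta> ` ?K \<subseteq> \<zeta> ` F \<union> (if e = 1 then {None} else {})"
      proof (rule image_subsetI)
        fix k assume k: "k \<in> ?K"
        show "\<zeta> k \<in> \<zeta> ` F \<union> (if e = 1 then {None} else {})"
        proof (cases "\<zeta> k")
          case None
          then have "e = 1" using k unfolding e_def by (metis imageI)
          then show ?thesis using None by simp
        next
          case (Some a)
          then have "k \<in> F" using k by (simp add: F_def)
          then show ?thesis by simp
        qed
      qed
      moreover have "(if e = 1 then {None} else {}) \<subseteq> \<zeta> ` ?K" by (simp add: e_def)
      ultimately show ?thesis using image_mono[OF FK, of \<zeta>] by blast
    qed
    ultimately show ?thesis by (simp only: S.poles_rat_map)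
  qed
  have "Some ` loewner_hull (2*n) T x g t \<subseteq> real_locus ?R \<and>
       (\<exists>S \<in> CRR (n+1) ((\<lambda>j. x j t) ` ?J).
          \<forall>w\<in>upper_half.
            ?R (Some (inv_into (upper_half - loewner_hull (2*n) T x g t) (g t) w)) = S (Some w))"
    if \<nu>: "\<forall>j\<in>?J. \<nu> j \<in> borel_measurable (lebesgue_on {0..}) \<and> (\<forall>s\<ge>0. 0 \<le> \<nu> j s)"
      and sup: "superposition (2*n) \<nu> x0 (rho n x0 \<zeta>) T x g"
      and t: "0 \<le> t" "ereal t < T" and nc: "\<forall>s\<in>{0..t}. no_collision n \<zeta> x g s"
    for \<nu> T x g t
  proof -
    let ?\<tau> = "swallowing_time (2*n) T x g" and ?z = "\<lambda>k s. g s (z0 k)"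
    have ch: "loewner_chain (2*n) \<nu> T x g" and x_init: "\<And>j. j \<in> ?J \<Longrightarrow> x j 0 = x0 j"
      using sup unfolding superposition_def by auto
    have g0: "g 0 w = w" for w using ch unfolding loewner_chain_def by auto
    have sT: "ereal s < T" if "s \<le> t" for s
      using that t(2) by (auto intro: le_less_trans[of "ereal s" "ereal t"])
    have swallowed: "\<exists>s j. ?\<tau> w = ereal s \<and> 0 \<le> s \<and> j \<in> ?J \<and> g s w = of_real (x j s) \<and>
        ((\<lambda>u. g u w) \<longlongrightarrow> g s w) (at s within {0..<s})" if w: "?\<tau> w \<le> ereal t" for w
    proof -
      have "?\<tau> w < T" using w t(2) by (rule le_less_trans)
      then obtain s j where "?\<tau> w = ereal s" "j \<in> ?J" "g s w = of_real (x j s)"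
          "((\<lambda>u. g u w) \<longlongrightarrow> g s w) (at s within {0..<s})"
        using ch unfolding loewner_chain_def by blast
      moreover from this have "0 \<le> s" using swallowing_time_nonneg[of "2*n" T x g w] by simp
      ultimately show ?thesis by blast
    qed
    have z_ne_x: "?z k s \<noteq> of_real (x j s)" if "s \<in> {0..t}" "j \<in> ?J" "k \<in> F" for s j k
      using nc that \<zeta>F[OF that(3)] FK unfolding no_collision_def by fastforce
    \<comment> \<open>The swallowing time is attained at a hit of a driving point, which up to time
      \<open>t\<close> would be a collision.\<close>
    have z_alive: "ereal t < ?\<tau> (z0 k)" if k: "k \<in> F" for k
    proof (rule ccontr)
      assume "\<not> ereal t < ?\<tau> (z0 k)"
      then have le: "?\<tau> (z0 k) \<le> ereal t" by simp
      from swallowed[OF this] obtain s j where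
        s: "?\<tau> (z0 k) = ereal s" "0 \<le> s" "j \<in> ?J" "g s (z0 k) = of_real (x j s)" by blast
      then show False using z_ne_x[of s j k] le k by simp
    qed
    have xp: "primitive_on t (\<lambda>s. complex_of_real (x j s))
        (\<lambda>s. driving_field ?J F (\<lambda>j. of_real (\<nu> j s)) (\<lambda>j. of_real (x j s)) (\<lambda>k. ?z k s) j)"
      if j: "j \<in> ?J" for j
    proof -
      let ?f = "\<lambda>s. complex_of_real (\<nu> j s) * sle0_drift (rho n x0 \<zeta> j) (transport (2*n) x g s) (x j s) +
          (\<Sum>k\<in>?J - {j}. complex_of_real (2 * \<nu> k s / (x j s - x k s)))"
      have "?f absolutely_integrable_on {0..s} \<and> complex_of_real (x j s) = of_real (x0 j) + integral {0..s} ?f"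
        if "s \<in> {0..t}" for s
        using sup j that sT[of s] unfolding superposition_def Let_def by auto
      then have "primitive_on t (\<lambda>s. complex_of_real (x j s)) ?f"
        using t x_init[OF j] by (intro primitive_onI) auto
      then show ?thesis
      proof (rule primitive_on_cong)
        show "?f s = driving_field ?J F (\<lambda>j. of_real (\<nu> j s)) (\<lambda>j. of_real (x j s)) (\<lambda>k. ?z k s) j" for s
          unfolding F_def z0_def
          by (rule driving_field_eq_superposition[where x = x and \<nu> = \<nu>, OF assms(2-4) x_init j])
      qed simp
    qed
    interpret L: loewner_flow e ?J F \<nu> x ?z t g ?\<tau>
    proof (intro loewner_flow.intro flow.intro loewner_flow_axioms.intro)
      show "inj_on (\<lambda>j. x j s) ?J" if "s \<in> {0..t}" for s
        using nc that unfolding no_collision_def by auto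
      show "inj_on (\<lambda>k. ?z k s) F" if "s \<in> {0..t}" for s
      proof (rule inj_onI)
        fix k l assume kl: "k \<in> F" "l \<in> F" "?z k s = ?z l s"
        then have "map_option (g s) (\<zeta> k) = map_option (g s) (\<zeta> l)" using \<zeta>F by simp
        then show "k = l" using nc that kl FK unfolding no_collision_def by (meson inj_onD subsetD)
      qed
      show "primitive_on t (?z k) (\<lambda>s. loewner_field ?J (\<lambda>j. of_real (\<nu> j s)) (\<lambda>j. of_real (x j s)) (?z k s))"
        if "k \<in> F" for k
        using loewner_chain_trajectory[OF ch t z_alive[OF that]] unfolding trajectory_def by blast
      show "defect ?J F (\<lambda>j. of_real (x j 0)) (\<lambda>k. ?z k 0) k = 0" if "k \<in> F" for k
        using defect[OF that] x_init by (simp add: g0 defect_def)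
      show "\<exists>l\<in>F. ?z l 0 = cnj (?z k 0)" if "k \<in> F" for k
        using sym[OF that] by (simp add: g0)
      show "trajectory ?J \<nu> x q (\<lambda>s. g s w)" if "0 \<le> q" "q \<le> t" "ereal q < ?\<tau> w" for q w
        using loewner_chain_trajectory[OF ch that(1) sT[OF that(2)] that(3)] .
      show "\<exists>s j. ?\<tau> w = ereal s \<and> 0 \<le> s \<and> j \<in> ?J \<and> g s w = of_real (x j s) \<and>
        ((\<lambda>u. g u w) \<longlongrightarrow> g s w) (at s within {0..<s})" if "?\<tau> w \<le> ereal t" for w
        using swallowed[OF that] .
    qed (use F e1 ceq t z_ne_x xp \<nu> g0 in auto)
    have X0: "(\<lambda>j. complex_of_real (x j 0)) ` ?J = ?X" using x_init by (auto intro!: image_cong)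
    have Z0: "(\<lambda>k. ?z k 0) ` F = ?Z" by (simp add: g0)
    define S where "S = rat_map e ((\<lambda>j. complex_of_real (x j t)) ` ?J) ((\<lambda>k. ?z k t) ` F)"
    have cZt: "card ((\<lambda>k. ?z k t) ` F) + e = n + 1"
      using cF card_image[OF L.inj_z[of t]] t by simp
    have "S \<in> CRR (n+1) ((\<lambda>j. x j t) ` ?J)"
      using L.St.rat_map_in_CRR[of "(\<lambda>j. x j t) ` ?J"] unfolding cZt S_def by (simp add: image_image)
    moreover have "?R (Some (inv_into (upper_half - loewner_hull (2*n) T x g t) (g t) w)) = S (Some w)"
      if w: "w \<in> upper_half" for w
    proof -
      let ?D = "upper_half - loewner_hull (2*n) T x g t"
      have D: "v \<in> ?D \<longleftrightarrow> 0 < Im v \<and> ereal t < ?\<tau> v" for v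
        by (auto simp: upper_half_def loewner_hull_def)
      obtain v where "0 < Im v" "ereal t < ?\<tau> v" "g t v = w"
        using L.surj[of w] w by (auto simp: upper_half_def)
      then have "w \<in> g t ` ?D" using D by blast
      \<comment> \<open>Surjectivity makes \<open>inv_into\<close> return a genuine preimage outside
        the hull, and \<open>R\<close> at any such point agrees with \<open>S\<close> at its
        image.\<close>
      then have "inv_into ?D (g t) w \<in> ?D" "g t (inv_into ?D (g t) w) = w"
        by (rule inv_into_into, rule f_inv_into_f)
      then show ?thesis
        using L.rat_map_t[of "inv_into ?D (g t) w"] D unfolding X0 Z0 S_def by metis
    qed
    moreover have "Some ` loewner_hull (2*n) T x g t \<subseteq> real_locus ?R"
      using L.hull_real unfolding X0 Z0 loewner_hull_def by blast
    ultimately show ?thesis by blast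
  qed
  then show ?thesis using R poles by blast
qed

end
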